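(* Let $G$ be a finitely generated abelian group of rank $d$ and let $X$ be a list of $N$ elements of $G$ that generates a subgroup of finite index. Then $$\mathrm{Hilb}(\mathcal{P}^{\mathrm{per}}(X),q)=q^{N-d}\,\mathfrak{T}^{\mathrm{ari}}_X(1,q^{-1}).$$ In particular, if $X$ is contained in a lattice $\Lambda$ whose fundamental region has volume $1$, then $\dim\mathcal{P}^{\mathrm{per}}(X)$ equals the volume of the zonotope $Z(X)=\{\sum_{x\in X}\lambda_x x:0\le\lambda_x\le1\}$.
   Context: **Setup.** Let $G_t$ be the torsion subgroup of $G$, $U=G\otimes_{\mathbb{Z}}\mathbb{R}$, and $X_t$ the sublist of torsion elements of $X$. For $y\in X$, $p_y=y\otimes1\in U$, and $p_Y=\prod_{y\in Y}p_y$. For a list $Y$ in $G$, $$\mathcal{P}(Y)=\operatorname{span}_{\mathbb{R}}\{p_Z:Z\subseteq Y,\ Y\setminus Z\text{ generates a finite-index subgroup of }G\}.$$ **Vertices.** $T(G)=\mathrm{Hom}(G,S^1)$. A basis of $X$ is a sublist of cardinality $d$ generating a finite-index subgroup. For $d\ge1$, $\mathcal{V}(X)=\{e_\phi\in T(G):$ some basis $B\subseteq X$ has $e_\phi(b)=1$ for all $b\in B\}$; if $d=0$, $\mathcal{V}(X)=T(G)$. **Central periodic $\mathcal{P}$-space.** For $e_\phi\in\mathcal{V}(X)$, let $X_\phi=(x\in X:e_\phi(x)=1)$ and $\mathrm{tors}(\phi)=|X_t\setminus X_\phi|$. Then $$\mathcal{P}^{\mathrm{per}}(X)=\bigoplus_{e_\phi\in\mathcal{V}(X)}e_\phi\,p_{X\setminus(X_\phi\cup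 X_t)}s_0^{\mathrm{tors}(\phi)}\mathcal{P}(X_\phi)\subseteq\bigoplus_{e_\phi}e_\phi\,\mathbb{R}[s_0]\otimes\mathrm{Sym}(U),$$ with $s_0$ a new variable. Writing $\mathcal{P}^{\mathrm{per}}(X)=\bigoplus_i\bigoplus_\phi e_\phi P_{i,\phi}$ with $P_{i,\phi}$ consisting of homogeneous polynomials of total degree $i$ in $\mathbb{R}[s_0]\otimes\mathrm{Sym}(U)$, the Hilbert series is $$\mathrm{Hilb}(\mathcal{P}^{\mathrm{per}}(X),q)=\sum_i\Big(\sum_\phi\dim P_{i,\phi}\Big)q^i.$$ **Arithmetic Tutte polynomial.** For $S\subseteq X$: $\operatorname{rank}(S)$ is the rank of the group $\langle S\rangle$; $G_S$ is the largest subgroup of $G$ containing $\langle S\rangle$ with finite index; and $m(S)=|G_S/\langle S\rangle|$. Then $$\mathfrak{T}^{\mathrm{ari}}_X(\alpha,\beta)=\sum_{S\subseteq X}m(S)(\alpha-1)^{d-\operatorname{rank}(S)}(\beta-1)^{|S|-\operatorname{rank}(S)}.$$ *)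

theory Defs
  imports
    "HOL-Analysis.Analysis"
    "HOL-Library.Poly_Mapping"
    "HOL-Computational_Algebra.Polynomial"
    "HOL-Computational_Algebra.Formal_Laurent_Series"
begin

section \<open>Abelian groups as modules over the integers\<close>

text \<open>
  The group \<open>G\<close> is the additive group of a type of class \<^class>\<open>ab_group_add\<close>. Seen as a module over
  the integers, its subgroups are \<open>zmod.subspace\<close>, the generated subgroup is \<open>zmod.span\<close>, and
  linear independence over the integers is \<open>zmod.independent\<close>.
\<close>

definition zscale :: "int \<Rightarrow> 'a::ab_group_add \<Rightarrow> 'a" where
  "zscale k x = (\<Sum>i<nat k. x) - (\<Sum>i<nat (- k). x)"

lemma sum_const_add: "(\<Sum>i<m + n. x) = (\<Sum>i<m. x) + (\<Sum>i<n. x)" for m n :: nat and x :: "'a::ab_group_add"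
  by (induction n) (simp_all add: algebra_simps)

lemma sum_const_mult: "(\<Sum>i<m * n. x) = (\<Sum>i<m. \<Sum>j<n. x)" for m n :: nat and x :: "'a::ab_group_add"
  by (induction m) (simp_all add: sum_const_add add.commute)

lemma zscale_diff: "zscale (int m - int n) x = (\<Sum>i<m. x) - (\<Sum>i<n. x)"
proof (cases "n \<le> m")
  case True
  then obtain k where "m = n + k" using le_Suc_ex by blast
  then show ?thesis by (simp add: zscale_def sum_const_add)
next
  case False
  then obtain k where "n = m + k" using le_Suc_ex nat_le_linear by blast
  then show ?thesis by (simp add: zscale_def sum_const_add)
qed

global_interpretation zmod: module zscale
proof
  fix a b :: int and x y :: 'a
  obtain m n where a: "a = int m - int n" using int_diff_cases by blast
  obtain k l where b: "b = int k - int l" using int_diff_cases by blast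
  show "zscale a (x + y) = zscale a x + zscale a y"
    unfolding a zscale_diff by (simp add: sum.distrib)
  have "a + b = int (m + k) - int (n + l)" using a b by simp
  then show "zscale (a + b) x = zscale a x + zscale b x"
    by (simp only: zscale_diff a b sum_const_add) simp
  have "a * b = int (m * k + n * l) - int (m * l + n * k)"
    by (simp only: a b) (simp add: left_diff_distrib right_diff_distrib)
  then show "zscale a (zscale b x) = zscale (a * b) x"
    by (simp only: zscale_diff a b sum_const_add sum_const_mult sum_subtractf) simp
  show "zscale 1 x = x" by (simp add: zscale_def)
qed

definition cosets :: "'g::ab_group_add set \<Rightarrow> 'g set \<Rightarrow> 'g set set" where
  "cosets H K = (\<lambda>x. (+) x ` K) ` H"

definition finite_index :: "'g::ab_group_add set \<Rightarrow> 'g set \<Rightarrow> bool" where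
  "finite_index H K \<longleftrightarrow> zmod.subspace H \<and> zmod.subspace K \<and> K \<subseteq> H \<and> finite (cosets H K)"

definition zrank :: "'g::ab_group_add set \<Rightarrow> nat" where
  "zrank H = (GREATEST n. \<exists>B\<subseteq>H. finite B \<and> zmod.independent B \<and> card B = n)"

definition torsion :: "'g::ab_group_add \<Rightarrow> bool" where
  "torsion x \<longleftrightarrow> (\<exists>k>0. zscale k x = 0)"


section \<open>Scalar multiplication on polynomials and on finitely supported functions\<close>

instantiation poly :: (real_vector) real_vector
begin

definition scaleR_poly :: "real \<Rightarrow> 'a poly \<Rightarrow> 'a poly" where
  "scaleR_poly r p = map_poly (scaleR r) p"

instance
  by standard
    (simp_all add: scaleR_poly_def poly_eq_iff coeff_map_poly scaleR_add_right scaleR_add_left)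

end

instantiation poly_mapping :: (type, real_vector) real_vector
begin

definition scaleR_poly_mapping :: "real \<Rightarrow> ('a \<Rightarrow>\<^sub>0 'b) \<Rightarrow> ('a \<Rightarrow>\<^sub>0 'b)" where
  "scaleR_poly_mapping r p = Poly_Mapping.map (scaleR r) p"

lemma lookup_scaleR: "Poly_Mapping.lookup (r *\<^sub>R p) x = r *\<^sub>R Poly_Mapping.lookup p x"
  by (simp add: scaleR_poly_mapping_def map.rep_eq when_def)

instance
  by standard
    (rule poly_mapping_eqI; simp add: lookup_scaleR lookup_add scaleR_add_right scaleR_add_left)+

end


section \<open>The real vector space \<open>G \<otimes> \<real>\<close>\<close>

text \<open>
  The tensor product over the integers: the free abelian group on \<open>G \<times> \<real>\<close> modulo the
  relations expressing additivity in each argument.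
\<close>

definition tensor_relations :: "('g::ab_group_add \<times> real \<Rightarrow>\<^sub>0 int) set" where
  "tensor_relations =
     {frag_of (x + y, r) - frag_of (x, r) - frag_of (y, r) | x y r. True} \<union>
     {frag_of (x, r + s) - frag_of (x, r) - frag_of (x, s) | x r s. True}"

definition tensor_rel ::
    "('g::ab_group_add \<times> real \<Rightarrow>\<^sub>0 int) \<Rightarrow> ('g \<times> real \<Rightarrow>\<^sub>0 int) \<Rightarrow> bool" where
  "tensor_rel a b \<longleftrightarrow> a - b \<in> zmod.span tensor_relations"

lemma equivp_diff_in_subgroup:
  fixes H :: "'a::ab_group_add set"
  assumes "0 \<in> H" "\<And>x. x \<in> H \<Longrightarrow> - x \<in> H" "\<And>x y. x \<in> H \<Longrightarrow> y \<in> H \<Longrightarrow> x + y \<in> H"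
  shows "equivp (\<lambda>a b. a - b \<in> H)"
proof (rule equivpI)
  show "reflp (\<lambda>a b. a - b \<in> H)" using assms(1) by (simp add: reflp_def)
  show "symp (\<lambda>a b. a - b \<in> H)" 
  proof (rule sympI)
    fix x y assume "x - y \<in> H"
    then have "- (x - y) \<in> H" by (rule assms(2))
    then show "y - x \<in> H" by simp
  qed
  show "transp (\<lambda>a b. a - b \<in> H)"
  proof (rule transpI)
    fix x y z assume "x - y \<in> H" "y - z \<in> H"
    then have "(x - y) + (y - z) \<in> H" by (rule assms(3))
    then show "x - z \<in> H" by simp
  qed
qed

lemma equivp_tensor_rel: "equivp tensor_rel"
  unfolding tensor_rel_def
  by (rule equivp_diff_in_subgroup) (auto intro: zmod.span_zero zmod.span_neg zmod.span_add)

quotient_type (overloaded) 'g tensor_real = "('g::ab_group_add \<times> real) \<Rightarrow>\<^sub>0 int" / tensor_rel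
  by (rule equivp_tensor_rel)

lift_definition tensor :: "'g::ab_group_add \<Rightarrow> real \<Rightarrow> 'g tensor_real"
  is "\<lambda>x r. frag_of (x, r)" .

lemma zscale_frag: "zscale k a = frag_cmul k a" for a :: "'a \<Rightarrow>\<^sub>0 int"
proof -
  have *: "(\<Sum>i<n. a) = frag_cmul (int n) a" for n
    by (induction n) (simp_all add: frag_cmul_distrib add.commute)
  show ?thesis
    by (cases "k \<ge> 0") (simp_all add: zscale_def *)
qed

lemma frag_extend_span:
  assumes "a \<in> zmod.span R" and "\<And>c. c \<in> R \<Longrightarrow> frag_extend f c \<in> zmod.span R"
  shows "frag_extend f a \<in> zmod.span R"
  using assms(1)
proof (induction rule: zmod.span_induct_alt)
  case base
  then show ?case by (simp add: zmod.span_zero)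
next
  case (step c x y)
  then show ?case
    using assms(2)[of x]
    by (simp add: frag_extend_add zscale_frag frag_extend_cmul zmod.span_add
        flip: zscale_frag) (metis zmod.span_add zmod.span_scale zscale_frag frag_extend_cmul)
qed

instantiation tensor_real :: (ab_group_add) real_vector
begin

lift_definition zero_tensor_real :: "'a tensor_real" is 0 .

lift_definition plus_tensor_real :: "'a tensor_real \<Rightarrow> 'a tensor_real \<Rightarrow> 'a tensor_real" is "(+)"
  unfolding tensor_rel_def by (metis add_diff_add zmod.span_add)

lift_definition uminus_tensor_real :: "'a tensor_real \<Rightarrow> 'a tensor_real" is uminus
  unfolding tensor_rel_def by (metis minus_diff_minus zmod.span_neg)

lift_definition minus_tensor_real :: "'a tensor_real \<Rightarrow> 'a tensor_real \<Rightarrow> 'a tensor_real" is "(-)"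
proof -
  fix a b c d :: "('a \<times> real) \<Rightarrow>\<^sub>0 int"
  assume "tensor_rel a b" "tensor_rel c d"
  then have "(a - b) - (c - d) \<in> zmod.span tensor_relations"
    unfolding tensor_rel_def by (rule zmod.span_diff)
  then show "tensor_rel (a - c) (b - d)"
    by (simp add: tensor_rel_def algebra_simps)
qed

text \<open>\<open>r \<cdot> (x \<otimes> s) = x \<otimes> r s\<close>\<close>

lift_definition scaleR_tensor_real :: "real \<Rightarrow> 'a tensor_real \<Rightarrow> 'a tensor_real"
  is "\<lambda>r. frag_extend (\<lambda>(x, s). frag_of (x, r * s))"
proof -
  fix r :: real and a b :: "('a \<times> real) \<Rightarrow>\<^sub>0 int"
  let ?f = "\<lambda>(x :: 'a, s). frag_of (x, r * s)"
  assume "tensor_rel a b"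
  then have "frag_extend ?f (a - b) \<in> zmod.span tensor_relations"
    unfolding tensor_rel_def
  proof (rule frag_extend_span)
    fix c :: "('a \<times> real) \<Rightarrow>\<^sub>0 int" assume "c \<in> tensor_relations"
    then have "frag_extend ?f c \<in> tensor_relations"
      unfolding tensor_relations_def
    proof (elim UnE CollectE exE conjE)
      fix x y :: 'a and t
      assume "c = frag_of (x + y, t) - frag_of (x, t) - frag_of (y, t)"
      then have "frag_extend ?f c = frag_of (x + y, r * t) - frag_of (x, r * t) - frag_of (y, r * t)"
        by (simp add: frag_extend_diff)
      then show "frag_extend ?f c
          \<in> {frag_of (x + y, r) - frag_of (x, r) - frag_of (y, r) | x y r. True} \<union>
            {frag_of (x, r + s) - frag_of (x, r) - frag_of (x, s) | x r s. True}"
        by blast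
    next
      fix x :: 'a and t u
      assume "c = frag_of (x, t + u) - frag_of (x, t) - frag_of (x, u)"
      then have "frag_extend ?f c
          = frag_of (x, r * t + r * u) - frag_of (x, r * t) - frag_of (x, r * u)"
        by (simp add: frag_extend_diff distrib_left)
      then show "frag_extend ?f c
          \<in> {frag_of (x + y, r) - frag_of (x, r) - frag_of (y, r) | x y r. True} \<union>
            {frag_of (x, r + s) - frag_of (x, r) - frag_of (x, s) | x r s. True}"
        by blast
    qed
    then show "frag_extend ?f c \<in> zmod.span tensor_relations" by (rule zmod.span_base)
  qed
  then show "tensor_rel (frag_extend ?f a) (frag_extend ?f b)"
    by (simp add: tensor_rel_def frag_extend_diff)
qed

instance
proof
  fix a b c :: "'a tensor_real" and r s :: real
  show "a + b + c = a + (b + c)" "a + b = b + a" "0 + a = a" "- a + a = 0" "a - b = a + - b"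
    by (transfer, simp add: tensor_rel_def zmod.span_zero algebra_simps)+
  show "r *\<^sub>R (a + b) = r *\<^sub>R a + r *\<^sub>R b"
    by transfer (simp add: tensor_rel_def frag_extend_add zmod.span_zero)
  show "r *\<^sub>R s *\<^sub>R a = (r * s) *\<^sub>R a"
  proof transfer
    fix r s :: real and a :: "('a \<times> real) \<Rightarrow>\<^sub>0 int"
    have "frag_extend (\<lambda>(x, t). frag_of (x, r * t)) (frag_extend (\<lambda>(x, t). frag_of (x, s * t)) a)
        = frag_extend (\<lambda>(x, t). frag_of (x, r * s * t)) a"
      by (rule frag_induction[of a UNIV]) (auto simp: frag_extend_diff mult.assoc)
    then show "tensor_rel
        (frag_extend (\<lambda>(x, t). frag_of (x, r * t)) (frag_extend (\<lambda>(x, t). frag_of (x, s * t)) a))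
        (frag_extend (\<lambda>(x, t). frag_of (x, r * s * t)) a)"
      by (simp add: tensor_rel_def zmod.span_zero)
  qed
  show "1 *\<^sub>R a = a"
  proof transfer
    fix a :: "('a \<times> real) \<Rightarrow>\<^sub>0 int"
    have "frag_extend (\<lambda>(x, t). frag_of (x, 1 * t)) a = a"
      by (rule frag_induction[of a UNIV]) (auto simp: frag_extend_diff)
    then show "tensor_rel (frag_extend (\<lambda>(x, t). frag_of (x, 1 * t)) a) a"
      by (simp add: tensor_rel_def zmod.span_zero)
  qed
  show "(r + s) *\<^sub>R a = r *\<^sub>R a + s *\<^sub>R a"
  proof transfer
    fix r s :: real and a :: "('a \<times> real) \<Rightarrow>\<^sub>0 int"
    let ?f = "\<lambda>r. frag_extend (\<lambda>(x :: 'a, t). frag_of (x, r * t))"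
    have "?f (r + s) a - (?f r a + ?f s a) \<in> zmod.span tensor_relations"
    proof (rule frag_induction[of a UNIV])
      fix z :: "'a \<times> real"
      obtain x t where z: "z = (x, t)" by (cases z)
      have "frag_of (x, r * t + s * t) - frag_of (x, r * t) - frag_of (x, s * t)
          \<in> tensor_relations"
        unfolding tensor_relations_def by blast
      then show "?f (r + s) (frag_of z) - (?f r (frag_of z) + ?f s (frag_of z))
          \<in> zmod.span tensor_relations"
        by (simp add: z distrib_right diff_diff_eq zmod.span_base)
    next
      fix a b
      assume "?f (r + s) a - (?f r a + ?f s a) \<in> zmod.span tensor_relations"
        and "?f (r + s) b - (?f r b + ?f s b) \<in> zmod.span tensor_relations"
      then have "(?f (r + s) a - (?f r a + ?f s a)) - (?f (r + s) b - (?f r b + ?f s b))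
          \<in> zmod.span tensor_relations"
        by (rule zmod.span_diff)
      then show "?f (r + s) (a - b) - (?f r (a - b) + ?f s (a - b)) \<in> zmod.span tensor_relations"
        by (simp add: frag_extend_diff algebra_simps)
    qed (auto simp: zmod.span_zero)
    then show "tensor_rel (?f (r + s) a) (?f r a + ?f s a)"
      by (simp add: tensor_rel_def)
  qed
qed

end


section \<open>The symmetric algebra of a real vector space\<close>

text \<open>
  Polynomials with real coefficients in one variable for every vector of \<open>U\<close>, modulo the ideal
  that makes the variables depend linearly on the vectors.
\<close>

definition ideal_gen :: "'a::comm_ring_1 set \<Rightarrow> 'a set" where
  "ideal_gen = module.span (*)"

definition pvar :: "'u \<Rightarrow> ('u \<Rightarrow>\<^sub>0 nat) \<Rightarrow>\<^sub>0 real" where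
  "pvar u = Poly_Mapping.single (Poly_Mapping.single u 1) 1"

definition pconst :: "real \<Rightarrow> ('u \<Rightarrow>\<^sub>0 nat) \<Rightarrow>\<^sub>0 real" where
  "pconst r = Poly_Mapping.single 0 r"

definition sym_relations :: "(('u::real_vector \<Rightarrow>\<^sub>0 nat) \<Rightarrow>\<^sub>0 real) set" where
  "sym_relations =
     {pvar (u + v) - pvar u - pvar v | u v. True} \<union>
     {pvar (r *\<^sub>R u) - pconst r * pvar u | r u. True}"

definition sym_rel ::
    "(('u::real_vector \<Rightarrow>\<^sub>0 nat) \<Rightarrow>\<^sub>0 real) \<Rightarrow> (('u \<Rightarrow>\<^sub>0 nat) \<Rightarrow>\<^sub>0 real) \<Rightarrow> bool" where
  "sym_rel a b \<longleftrightarrow> a - b \<in> ideal_gen sym_relations"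

lemma module_times: "module ((*) :: 'a::comm_ring_1 \<Rightarrow> 'a \<Rightarrow> 'a)"
  by standard (simp_all add: algebra_simps)

lemma ideal_gen_closed:
  "0 \<in> ideal_gen S"
  "a \<in> ideal_gen S \<Longrightarrow> b \<in> ideal_gen S \<Longrightarrow> a + b \<in> ideal_gen S"
  "a \<in> ideal_gen S \<Longrightarrow> b \<in> ideal_gen S \<Longrightarrow> a - b \<in> ideal_gen S"
  "a \<in> ideal_gen S \<Longrightarrow> - a \<in> ideal_gen S"
  "a \<in> ideal_gen S \<Longrightarrow> c * a \<in> ideal_gen S"
  using module.span_zero[OF module_times] module.span_add[OF module_times]
    module.span_diff[OF module_times] module.span_neg[OF module_times]
    module.span_scale[OF module_times]
  by (auto simp: ideal_gen_def)

lemma equivp_sym_rel: "equivp sym_rel"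
  unfolding sym_rel_def
  by (rule equivp_diff_in_subgroup) (auto intro: ideal_gen_closed)

quotient_type (overloaded) 'u sym = "('u::real_vector \<Rightarrow>\<^sub>0 nat) \<Rightarrow>\<^sub>0 real" / sym_rel
  by (rule equivp_sym_rel)

lift_definition sym_of :: "'u::real_vector \<Rightarrow> 'u sym" is pvar .

lemma poly_mapping_add_induct [case_names zero add]:
  assumes "P 0" and "\<And>p k c. P p \<Longrightarrow> P (p + Poly_Mapping.single k c)"
  shows "P (p :: 'a \<Rightarrow>\<^sub>0 'b::comm_monoid_add)"
proof (induction p rule: update_induct)
  case (update f a b)
  have "Poly_Mapping.update a b f = f + Poly_Mapping.single a b"
    using update(1)
    by (intro poly_mapping_eqI) (auto simp: lookup_update lookup_add lookup_single in_keys_iff when_def)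
  then show ?case using assms(2) update by simp
qed (use assms in simp)

lemma lookup_mult_zero:
  fixes p q :: "('u \<Rightarrow>\<^sub>0 nat) \<Rightarrow>\<^sub>0 real"
  shows "Poly_Mapping.lookup (p * q) 0 = Poly_Mapping.lookup p 0 * Poly_Mapping.lookup q 0"
proof -
  have nat0: "m + n = 0 \<longleftrightarrow> m = 0 \<and> n = 0" for m n :: "'u \<Rightarrow>\<^sub>0 nat"
    by (auto simp: poly_mapping_eq_iff fun_eq_iff lookup_add)
  have *: "Poly_Mapping.lookup (p * Poly_Mapping.single k c) 0
      = Poly_Mapping.lookup p 0 * Poly_Mapping.lookup (Poly_Mapping.single k c) 0" for k c
    by (induction p rule: poly_mapping_add_induct)
      (auto simp: mult_single lookup_single lookup_add distrib_right when_def nat0)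
  show ?thesis
    by (induction q rule: poly_mapping_add_induct) (simp_all add: lookup_add distrib_left *)
qed

lemma sym_rel_refl: "a = b \<Longrightarrow> sym_rel a b"
  by (simp add: sym_rel_def ideal_gen_closed(1))

lemma one_not_in_sym_ideal: "(1 :: ('u::real_vector \<Rightarrow>\<^sub>0 nat) \<Rightarrow>\<^sub>0 real) \<notin> ideal_gen sym_relations"
proof -
  have "Poly_Mapping.lookup p 0 = 0"
    if "p \<in> ideal_gen sym_relations" for p :: "('u \<Rightarrow>\<^sub>0 nat) \<Rightarrow>\<^sub>0 real"
    using that unfolding ideal_gen_def
  proof (induction rule: module.span_induct_alt[OF module_times, consumes 1, case_names base step])
    case base
    then show ?case by simp
  next
    case (step c x y)
    have "Poly_Mapping.lookup (pvar u) 0 = 0" for u :: 'u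
      by (metis lookup_single_not_eq lookup_single_eq lookup_zero one_neq_zero pvar_def)
    then have "Poly_Mapping.lookup x 0 = 0"
      using step(1) by (auto simp: sym_relations_def lookup_minus lookup_mult_zero)
    then show ?case
      using step by (simp add: lookup_add lookup_mult_zero)
  qed
  then show ?thesis by (metis lookup_one_zero one_neq_zero)
qed

lemma pconst_simps:
  "pconst 1 = 1" "pconst (r + s) = pconst r + pconst s" "pconst (r * s) = pconst r * pconst s"
  by (simp_all add: pconst_def single_add mult_single)

instantiation sym :: (real_vector) "{comm_ring_1, real_algebra_1}"
begin

lift_definition zero_sym :: "'a sym" is 0 .

lift_definition one_sym :: "'a sym" is 1 .

lift_definition plus_sym :: "'a sym \<Rightarrow> 'a sym \<Rightarrow> 'a sym" is "(+)"
  unfolding sym_rel_def by (metis add_diff_add ideal_gen_closed(2))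

lift_definition uminus_sym :: "'a sym \<Rightarrow> 'a sym" is uminus
  unfolding sym_rel_def by (metis minus_diff_minus ideal_gen_closed(4))

lift_definition minus_sym :: "'a sym \<Rightarrow> 'a sym \<Rightarrow> 'a sym" is "(-)"
proof -
  fix a b c d :: "('a \<Rightarrow>\<^sub>0 nat) \<Rightarrow>\<^sub>0 real"
  assume "sym_rel a b" "sym_rel c d"
  then have "(a - b) - (c - d) \<in> ideal_gen sym_relations"
    unfolding sym_rel_def by (rule ideal_gen_closed)
  then show "sym_rel (a - c) (b - d)"
    by (simp add: sym_rel_def algebra_simps)
qed

lift_definition times_sym :: "'a sym \<Rightarrow> 'a sym \<Rightarrow> 'a sym" is "(*)"
proof -
  fix a b c d :: "('a \<Rightarrow>\<^sub>0 nat) \<Rightarrow>\<^sub>0 real"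
  assume "sym_rel a b" "sym_rel c d"
  then have "c * (a - b) + b * (c - d) \<in> ideal_gen sym_relations"
    unfolding sym_rel_def by (intro ideal_gen_closed(2,5))
  then show "sym_rel (a * c) (b * d)"
    by (simp add: sym_rel_def algebra_simps)
qed

lift_definition scaleR_sym :: "real \<Rightarrow> 'a sym \<Rightarrow> 'a sym" is "\<lambda>r p. pconst r * p"
proof -
  fix r :: real and a b :: "('a \<Rightarrow>\<^sub>0 nat) \<Rightarrow>\<^sub>0 real"
  assume "sym_rel a b"
  then have "pconst r * (a - b) \<in> ideal_gen sym_relations"
    unfolding sym_rel_def by (rule ideal_gen_closed)
  then show "sym_rel (pconst r * a) (pconst r * b)"
    by (simp add: sym_rel_def right_diff_distrib)
qed

instance
proof
  fix a b c :: "'a sym" and r s :: real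
  show "a + b + c = a + (b + c)" "a + b = b + a" "0 + a = a" "- a + a = 0" "a - b = a + - b"
    "a * b * c = a * (b * c)" "a * b = b * a" "1 * a = a" "a * 1 = a"
    "(a + b) * c = a * c + b * c" "a * (b + c) = a * b + a * c"
    by (transfer, rule sym_rel_refl, simp add: algebra_simps)+
  show "(0 :: 'a sym) \<noteq> 1"
  proof transfer
    show "\<not> sym_rel (0 :: ('a \<Rightarrow>\<^sub>0 nat) \<Rightarrow>\<^sub>0 real) 1"
      using one_not_in_sym_ideal ideal_gen_closed(4)[of "- 1" sym_relations]
      by (auto simp: sym_rel_def)
  qed
  show "r *\<^sub>R (a + b) = r *\<^sub>R a + r *\<^sub>R b" "(r + s) *\<^sub>R a = r *\<^sub>R a + s *\<^sub>R a"
    "r *\<^sub>R s *\<^sub>R a = (r * s) *\<^sub>R a" "1 *\<^sub>R a = a"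
    "r *\<^sub>R a * b = r *\<^sub>R (a * b)" "a * r *\<^sub>R b = r *\<^sub>R (a * b)"
    by (transfer, rule sym_rel_refl, simp add: pconst_simps algebra_simps)+
qed

end

definition sym_degree :: "nat \<Rightarrow> 'u::real_vector sym set" where
  "sym_degree i = span {prod_list (map sym_of us) | us. length us = i}"


section \<open>The central periodic P-space\<close>

text \<open>
  A sublist of \<open>Y\<close> is \<open>nths Y S\<close> for a set \<open>S\<close> of positions, so repeated entries are kept apart.
\<close>

definition pvec :: "'g::ab_group_add \<Rightarrow> 'g tensor_real sym" where
  "pvec y = sym_of (tensor y 1)"

definition pprod :: "'g::ab_group_add list \<Rightarrow> 'g tensor_real sym" where
  "pprod Y = prod_list (map pvec Y)"

definition central_P :: "'g::ab_group_add list \<Rightarrow> 'g tensor_real sym set" where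
  "central_P Y =
     span {pprod (nths Y S) | S. S \<subseteq> {..<length Y} \<and>
       finite_index UNIV (zmod.span (set (nths Y ({..<length Y} - S))))}"

definition characters :: "('g::ab_group_add \<Rightarrow> complex) set" where
  "characters = {\<phi>. (\<forall>x. norm (\<phi> x) = 1) \<and> (\<forall>x y. \<phi> (x + y) = \<phi> x * \<phi> y)}"

definition bases :: "'g::ab_group_add list \<Rightarrow> 'g list set" where
  "bases X = {nths X S | S. S \<subseteq> {..<length X} \<and> card S = zrank (UNIV :: 'g set) \<and>
     finite_index UNIV (zmod.span (set (nths X S)))}"

definition vertices :: "'g::ab_group_add list \<Rightarrow> ('g \<Rightarrow> complex) set" where
  "vertices X =
     (if zrank (UNIV :: 'g set) = 0 then characters
      else {\<phi> \<in> characters. \<exists>B\<in>bases X. \<forall>b\<in>set B. \<phi> b = 1})"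

definition kernel_sublist :: "'g::ab_group_add list \<Rightarrow> ('g \<Rightarrow> complex) \<Rightarrow> 'g list" where
  "kernel_sublist X \<phi> = filter (\<lambda>x. \<phi> x = 1) X"

definition tors :: "'g::ab_group_add list \<Rightarrow> ('g \<Rightarrow> complex) \<Rightarrow> nat" where
  "tors X \<phi> = length (filter (\<lambda>x. torsion x \<and> \<phi> x \<noteq> 1) X)"

text \<open>
  \<open>\<real>[s\<^sub>0] \<otimes> Sym(U)\<close> is the ring of polynomials in \<open>s\<^sub>0\<close> over \<open>Sym(U)\<close>; multiplying \<open>f \<in> Sym(U)\<close>
  by \<open>s\<^sub>0\<^sup>k\<close> gives \<open>monom f k\<close>.
\<close>

definition Pper_component ::
    "'g::ab_group_add list \<Rightarrow> ('g \<Rightarrow> complex) \<Rightarrow> 'g tensor_real sym poly set" where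
  "Pper_component X \<phi> =
     (\<lambda>f. monom (pprod (filter (\<lambda>x. \<phi> x \<noteq> 1 \<and> \<not> torsion x) X) * f) (tors X \<phi>))
       ` central_P (kernel_sublist X \<phi>)"

text \<open>
  The direct sum over all characters consists of the finitely supported functions on them; the
  summand \<open>e\<^sub>\<phi> f\<close> is \<open>Poly_Mapping.single \<phi> f\<close>.
\<close>

definition Pper ::
    "'g::ab_group_add list \<Rightarrow> (('g \<Rightarrow> complex) \<Rightarrow>\<^sub>0 'g tensor_real sym poly) set" where
  "Pper X = {F. Poly_Mapping.keys F \<subseteq> vertices X \<and>
     (\<forall>\<phi>\<in>vertices X. Poly_Mapping.lookup F \<phi> \<in> Pper_component X \<phi>)}"

text \<open>The variable \<open>s\<^sub>0\<close> has degree one.\<close>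

definition homogeneous :: "nat \<Rightarrow> 'u::real_vector sym poly set" where
  "homogeneous i =
     {f. \<forall>j. if j \<le> i then coeff f j \<in> sym_degree (i - j) else coeff f j = 0}"

definition Pper_degree ::
    "'g::ab_group_add list \<Rightarrow> nat \<Rightarrow> ('g \<Rightarrow> complex) \<Rightarrow> 'g tensor_real sym poly set" where
  "Pper_degree X i \<phi> = {f \<in> homogeneous i. Poly_Mapping.single \<phi> f \<in> Pper X}"

definition Hilb_Pper :: "'g::ab_group_add list \<Rightarrow> int fps" where
  "Hilb_Pper X = Abs_fps (\<lambda>i. \<Sum>\<phi>\<in>vertices X. int (dim (Pper_degree X i \<phi>)))"


section \<open>The arithmetic Tutte polynomial\<close>

text \<open>The largest subgroup that contains the subgroup generated by \<open>S\<close> with finite index.\<close>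

definition saturation :: "'g::ab_group_add set \<Rightarrow> 'g set" where
  "saturation S = (GREATEST H. finite_index H (zmod.span S))"

definition arith_mult :: "'g::ab_group_add set \<Rightarrow> nat" where
  "arith_mult S = card (cosets (saturation S) (zmod.span S))"

definition arith_Tutte :: "'g::ab_group_add list \<Rightarrow> 'r::comm_ring_1 \<Rightarrow> 'r \<Rightarrow> 'r" where
  "arith_Tutte X \<alpha> \<beta> =
     (\<Sum>S\<in>Pow {..<length X}.
        let H = set (nths X S); r = zrank (zmod.span H)
        in of_nat (arith_mult H) * (\<alpha> - 1) ^ (zrank (UNIV :: 'g set) - r)
             * (\<beta> - 1) ^ (card S - r))"


section \<open>Lattices and zonotopes\<close>

text \<open>
  Euclidean types have positive dimension. The lattice \<open>{0}\<close> in \<open>\<real>\<^sup>0\<close>, a point of volume one, is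
  therefore not an instance of the following notions.
\<close>

definition lattice_basis :: "'v::euclidean_space set \<Rightarrow> 'v set \<Rightarrow> bool" where
  "lattice_basis B \<Lambda> \<longleftrightarrow> independent B \<and> span B = UNIV \<and> zmod.span B = \<Lambda>"

definition fundamental_region :: "'v::euclidean_space set \<Rightarrow> 'v set" where
  "fundamental_region B = {\<Sum>b\<in>B. t b *\<^sub>R b | t. \<forall>b\<in>B. 0 \<le> t b \<and> t b < 1}"

definition zonotope :: "'v::euclidean_space list \<Rightarrow> 'v set" where
  "zonotope Y =
     {\<Sum>k<length Y. t k *\<^sub>R Y ! k | t. \<forall>k<length Y. 0 \<le> t k \<and> t k \<le> 1}"

end

theory Submission
  imports
    Defs
    "HOL-Library.Function_Algebras"
    "HOL-Computational_Algebra.Polynomial_FPS"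
begin

text \<open>
  Evaluation identifies \<open>Sym(U)\<close> with the polynomial functions on \<open>Hom(G, \<real>)\<close>, so \<open>\<P>(Y)\<close> becomes a
  space of products of linear forms. It lies in the space \<open>I\<close> of functions whose degree in every
  direction \<open>u\<close> is smaller than the number of forms not vanishing on \<open>u\<close>. For a nonzero form \<open>x\<close>,
  multiplication by \<open>x\<close> and restriction to its kernel give upper bounds for \<open>I\<close> and lower bounds for \<open>\<P>\<close>
  that both satisfy the deletion-contraction recurrence of the Tutte polynomial; hence \<open>\<P> = I\<close> and its
  Hilbert series is \<open>q\<^sup>n\<^sup>-\<^sup>d T(1, 1/q)\<close>. Summing over the vertices, a full-rank sublist \<open>S\<close> is counted once for
  every character that is trivial on it, that is, \<open>m(S)\<close> times.

  At \<open>q = 1\<close> only the bases contribute, with weight \<open>m(S)\<close>. The volume of the zonotope is affine in the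
  length of every edge and homogeneous, so it is the sum of the volumes of the parallelepipeds spanned
  by bases; the volume of such a parallelepiped is the index of the sublattice, because two fundamental
  domains of a lattice have the same volume.
\<close>

section \<open>Real vector spaces without dimension bound\<close>

text \<open>Neither space obeys the recurrence by itself. Restriction to the kernel of x maps
  \<open>I\<close> into the \<open>I\<close> of the contraction, and what it kills is divisible by
  x, but surjectivity is not visible. For \<open>P\<close> surjectivity is visible, since a
  generator for the contraction comes from one for the whole list, while the kernel is only seen to
  contain multiples of x. Each space yields one inequality, and the inclusion of \<open>P\<close> in
  \<open>I\<close> closes the gap. Hence the induction carries spanning sets of \<open>I\<close> and
  independent subsets of \<open>P\<close> instead of dimensions, and it ranges over all subspaces W:
  contraction shrinks the domain of the functions, and no quotient of the group is formed.

  Torsion entries are zero forms; they drop out of the recurrence by q + (1 - q) = 1. The variable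
  s_0 restores their degree: the summand of a character is shifted by |X| - |X_phi| whatever the
  torsion, so the power of q belonging to S does not depend on the character.

  On the volume side only natural multiplicities of the edges are compared, which is enough to
  identify polynomials.\<close>

instantiation "fun" :: (type, real_vector) real_vector
begin

definition scaleR_fun :: "real \<Rightarrow> ('a \<Rightarrow> 'b) \<Rightarrow> 'a \<Rightarrow> 'b" where
  "scaleR_fun r f = (\<lambda>x. r *\<^sub>R f x)"

instance
  by standard (simp_all add: scaleR_fun_def fun_eq_iff scaleR_add_right scaleR_add_left)

end

lemma scaleR_fun_apply: "(r *\<^sub>R f) x = r *\<^sub>R f x"
  by (simp add: scaleR_fun_def)

lemmas fun_ops = plus_fun_apply zero_fun_apply times_fun_apply one_fun_apply
  minus_apply uminus_apply scaleR_fun_apply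

text \<open>As simplification rules these would also turn unapplied functions into abstractions.\<close>

declare plus_fun_apply [simp del] zero_fun_apply [simp del] times_fun_apply [simp del]
  one_fun_apply [simp del] minus_apply [simp del] uminus_apply [simp del]

lemma dim_injective_image:
  fixes f :: "'a::real_vector \<Rightarrow> 'b::real_vector"
  assumes "linear f" "inj_on f (span S)"
  shows "dim (f ` S) = dim S"
proof -
  obtain B where B: "B \<subseteq> S" "independent B" "S \<subseteq> span B" "card B = dim S"
    using real_vector.basis_exists by blast
  have BS: "span B \<subseteq> span S" using B(1) by (rule span_mono)
  have "independent (f ` B)"
    using linear_independent_injective_image[OF assms(1) B(2)] assms(2) BS inj_on_subset by blast
  moreover have "f ` S \<subseteq> span (f ` B)"
    using B(3) linear_span_image[OF assms(1), of B] by blast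
  moreover have "card (f ` B) = dim S"
    using B(4) card_image[of f B] assms(2) inj_on_subset BS span_superset by metis
  ultimately show ?thesis
    using B(1) by (intro real_vector.dim_unique[of "f ` B"]) auto
qed

text \<open>Upper half of rank-nullity: subtracting a combination of preimages of a basis of the
  image moves any element of \<open>I\<close> into the kernel of \<open>f\<close>. Spanning sets
  appear instead of \<open>dim\<close> because the induction that uses this establishes finite
  dimension only along the way.\<close>

lemma finite_span_extension:
  fixes f :: "'a::real_vector \<Rightarrow> 'b::real_vector"
  assumes f: "linear f" and I: "subspace I"
    and T1: "finite T1" "f ` I \<subseteq> span T1"
    and T2: "finite T2" "{x\<in>I. f x = 0} \<subseteq> span T2"
  shows "\<exists>T. finite T \<and> card T \<le> card T1 + card T2 \<and> I \<subseteq> span T"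
proof -
  obtain B where B: "B \<subseteq> f ` I" "independent B" "f ` I \<subseteq> span B"
    using real_vector.basis_exists by metis
  have Bf: "finite B" "card B \<le> card T1"
    using independent_span_bound[OF T1(1) B(2)] B(1) T1(2) by auto
  obtain g where g: "\<And>b. b \<in> B \<Longrightarrow> g b \<in> I \<and> f (g b) = b"
    using B(1) by (metis (full_types) image_iff subsetD)
  let ?T = "g ` B \<union> T2"
  have "I \<subseteq> span ?T"
  proof
    fix x assume x: "x \<in> I"
    have gB: "g ` B \<subseteq> I" using g by auto
    have "f ` (g ` B) = B" using g by force
    then have "f x \<in> f ` span (g ` B)"
      using B(3) x by (metis image_eqI linear_span_image[OF f] subsetD)
    then obtain y where y: "y \<in> span (g ` B)" "f x = f y" by auto
    have "y \<in> I" using y(1) gB I by (meson span_minimal subsetD)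
    then have "x - y \<in> span T2"
      using T2(2) x y(2) I by (auto simp: subspace_diff linear_diff[OF f])
    then have "(x - y) + y \<in> span ?T"
      using y(1) by (meson span_add span_mono subsetD Un_upper1 Un_upper2)
    then show "x \<in> span ?T" by simp
  qed
  moreover have "card ?T \<le> card T1 + card T2"
    using Bf by (meson add_mono card_Un_le card_image_le le_trans order_refl)
  moreover have "finite ?T" using Bf(1) T2(1) by simp
  ultimately show ?thesis by blast
qed

text \<open>Lower half of rank-nullity. Applying \<open>f\<close> to a linear relation kills the
  part from \<open>B2\<close> and shows that the coefficients on the lifts of \<open>B1\<close> are
  zero; independence of \<open>B2\<close> does the rest.\<close>

lemma independent_extension:
  fixes f :: "'a::real_vector \<Rightarrow> 'b::real_vector"
  assumes f: "linear f" and P: "subspace P"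
    and B1: "finite B1" "independent B1" "B1 \<subseteq> f ` P"
    and B2: "finite B2" "independent B2" "B2 \<subseteq> P" "\<And>x. x \<in> B2 \<Longrightarrow> f x = 0"
  shows "\<exists>B. finite B \<and> independent B \<and> card B = card B1 + card B2 \<and> B \<subseteq> P"
proof -
  obtain g where g: "\<And>b. b \<in> B1 \<Longrightarrow> g b \<in> P \<and> f (g b) = b"
    using B1(3) by (metis (full_types) image_iff subsetD)
  have inj: "inj_on g B1" by (metis g inj_onI)
  have ker: "f x = 0" if "x \<in> span B2" for x
  proof -
    have "f ` span B2 = span (f ` B2)" by (simp add: linear_span_image[OF f])
    also have "\<dots> \<subseteq> span {0}" using B2(4) by (intro span_mono) auto
    finally show ?thesis using that by auto
  qed
  have disj: "g ` B1 \<inter> B2 = {}"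
  proof -
    have "b \<noteq> 0" if "b \<in> B1" for b using that B1(2) dependent_zero by metis
    then show ?thesis using g B2(4) by force
  qed
  have "independent (g ` B1 \<union> B2)"
    unfolding dependent_finite[OF finite_UnI[OF finite_imageI[OF B1(1)] B2(1)]]
  proof clarify
    fix u v assume s: "(\<Sum>v\<in>g ` B1 \<union> B2. u v *\<^sub>R v) = 0" and v: "v \<in> g ` B1 \<union> B2" "u v \<noteq> 0"
    have s': "(\<Sum>b\<in>B1. u (g b) *\<^sub>R g b) + (\<Sum>v\<in>B2. u v *\<^sub>R v) = 0"
      using s disj B1(1) B2(1) by (simp add: sum.union_disjoint sum.reindex[OF inj])
    have k2: "(\<Sum>v\<in>B2. u v *\<^sub>R v) \<in> span B2" by (auto intro: span_sum span_scale span_base)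
    have "f (\<Sum>b\<in>B1. u (g b) *\<^sub>R g b) = (\<Sum>b\<in>B1. u (g b) *\<^sub>R b)"
      unfolding linear_sum[OF f] using g by (intro sum.cong) (simp_all add: linear_scale[OF f])
    then have "f ((\<Sum>b\<in>B1. u (g b) *\<^sub>R g b) + (\<Sum>v\<in>B2. u v *\<^sub>R v)) = (\<Sum>b\<in>B1. u (g b) *\<^sub>R b)"
      using ker[OF k2] by (simp only: linear_add[OF f] add_0_right)
    then have z: "(\<Sum>b\<in>B1. u (g b) *\<^sub>R b) = 0" using s' linear_0[OF f] by simp
    have u1: "u (g b) = 0" if "b \<in> B1" for b
      using independentD[OF B1(2,1) subset_refl z that] .
    then have "(\<Sum>v\<in>B2. u v *\<^sub>R v) = 0" using s' by simp
    then have "u b = 0" if "b \<in> B2" for b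
      using independentD[OF B2(2,1) subset_refl _ that] by blast
    with u1 v show False by blast
  qed
  moreover have "card (g ` B1 \<union> B2) = card B1 + card B2"
    using disj B1(1) B2(1) by (simp add: card_Un_disjoint card_image[OF inj])
  moreover have "g ` B1 \<union> B2 \<subseteq> P" using g B2(3) by blast
  moreover have "finite (g ` B1 \<union> B2)" using B1(1) B2(1) by simp
  ultimately show ?thesis by blast
qed

lemma dim_direct_sum:
  fixes V :: "'j \<Rightarrow> 'v::real_vector set"
  assumes J: "finite J" and V: "\<And>j. j \<in> J \<Longrightarrow> subspace (V j)"
    and fin: "\<And>j. j \<in> J \<Longrightarrow> \<exists>F. finite F \<and> V j \<subseteq> span F"
    and indep: "\<And>v. (\<And>j. j \<in> J \<Longrightarrow> v j \<in> V j) \<Longrightarrow> (\<Sum>j\<in>J. v j) = 0 \<Longrightarrow> \<forall>j\<in>J. v j = 0"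
  shows "dim {\<Sum>j\<in>J. v j | v. \<forall>j\<in>J. v j \<in> V j} = (\<Sum>j\<in>J. dim (V j))"
proof -
  have "\<forall>j\<in>J. \<exists>B. B \<subseteq> V j \<and> independent B \<and> V j \<subseteq> span B \<and> card B = dim (V j) \<and> finite B"
  proof
    fix j assume j: "j \<in> J"
    obtain B where B: "B \<subseteq> V j" "independent B" "V j \<subseteq> span B" "card B = dim (V j)"
      using real_vector.basis_exists by blast
    obtain F where F: "finite F" "V j \<subseteq> span F" using fin[OF j] by blast
    have "B \<subseteq> span F" using B(1) F(2) by blast
    then have "finite B" using independent_span_bound[OF F(1) B(2)] by blast
    then show "\<exists>B. B \<subseteq> V j \<and> independent B \<and> V j \<subseteq> span B \<and> card B = dim (V j) \<and> finite B"
      using B by blast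
  qed
  from bchoice[OF this] obtain B where
    B: "\<And>j. j \<in> J \<Longrightarrow> B j \<subseteq> V j" "\<And>j. j \<in> J \<Longrightarrow> independent (B j)" "\<And>j. j \<in> J \<Longrightarrow> V j \<subseteq> span (B j)"
    "\<And>j. j \<in> J \<Longrightarrow> card (B j) = dim (V j)" "\<And>j. j \<in> J \<Longrightarrow> finite (B j)" by blast
  let ?S = "{\<Sum>j\<in>J. v j | v. \<forall>j\<in>J. v j \<in> V j}"
  have disj: "B i \<inter> B j = {}" if ij: "i \<in> J" "j \<in> J" "i \<noteq> j" for i j
  proof (rule ccontr)
    assume "B i \<inter> B j \<noteq> {}"
    then obtain b where b: "b \<in> B i" "b \<in> B j" by blast
    \<comment> \<open>A common element of two bases gives \<open>b\<close> in one summand and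
      \<open>- b\<close> in the other: a zero sum with nonzero terms.\<close>
    define v where "v k = (if k = i then b else if k = j then - b else 0)" for k
    have "v k \<in> V k" if "k \<in> J" for k
      using that b B(1)[OF ij(1)] B(1)[OF ij(2)] V[OF that] by (auto simp: v_def subspace_0 subspace_neg)
    moreover have "(\<Sum>k\<in>J. v k) = (\<Sum>k\<in>{i, j}. v k)"
      using J ij by (intro sum.mono_neutral_right) (auto simp: v_def)
    then have "(\<Sum>k\<in>J. v k) = 0" using ij(3) by (simp add: v_def)
    ultimately have "v i = 0" using indep ij(1) by blast
    then have "b = 0" by (simp add: v_def)
    then show False using B(2)[OF ij(1)] b(1) dependent_zero by blast
  qed
  have fB: "finite (\<Union>j\<in>J. B j)" using J B(5) by blast
  have "independent (\<Union>j\<in>J. B j)"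
  proof (rule ccontr)
    assume "\<not> independent (\<Union>j\<in>J. B j)"
    then obtain u w where s: "(\<Sum>b\<in>(\<Union>j\<in>J. B j). u b *\<^sub>R b) = 0" and w: "w \<in> (\<Union>j\<in>J. B j)" "u w \<noteq> 0"
      unfolding dependent_finite[OF fB] by blast
    have s2: "(\<Sum>j\<in>J. \<Sum>b\<in>B j. u b *\<^sub>R b) = 0"
      using s B(5) disj by (subst (asm) sum.UNION_disjoint[OF J]) auto
    have "(\<Sum>b\<in>B j. u b *\<^sub>R b) \<in> V j" if "j \<in> J" for j
      using B(1)[OF that] V[OF that] by (intro subspace_sum subspace_scale) auto
    from indep[OF this s2] have z: "(\<Sum>b\<in>B j. u b *\<^sub>R b) = 0" if "j \<in> J" for j using that by blast
    obtain j where j: "j \<in> J" "w \<in> B j" using w(1) by blast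
    from independentD[OF B(2)[OF j(1)] B(5)[OF j(1)] subset_refl z[OF j(1)] j(2)] show False using w(2) by simp
  qed
  moreover have "(\<Union>j\<in>J. B j) \<subseteq> ?S"
  proof clarify
    fix j b assume j: "j \<in> J" "b \<in> B j"
    have "b = (\<Sum>k\<in>J. if k = j then b else 0)" using J j(1) by simp
    moreover have "\<forall>k\<in>J. (if k = j then b else 0) \<in> V k"
      using j B(1)[OF j(1)] V by (auto simp: subspace_0)
    ultimately show "\<exists>v. b = (\<Sum>j\<in>J. v j) \<and> (\<forall>j\<in>J. v j \<in> V j)"
      by (intro exI[of _ "\<lambda>k. if k = j then b else 0"]) auto
  qed
  moreover have "?S \<subseteq> span (\<Union>j\<in>J. B j)"
  proof clarify
    fix v assume v: "\<forall>j\<in>J. v j \<in> V j"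
    have "v j \<in> span (\<Union>j\<in>J. B j)" if "j \<in> J" for j
      using v B(3)[OF that] that span_mono[of "B j" "\<Union>j\<in>J. B j"] by blast
    then show "(\<Sum>j\<in>J. v j) \<in> span (\<Union>j\<in>J. B j)" by (rule span_sum)
  qed
  moreover have "card (\<Union>j\<in>J. B j) = (\<Sum>j\<in>J. dim (V j))"
    using card_UN_disjoint[OF J, of B] B(4,5) disj by simp
  ultimately show ?thesis by (intro real_vector.dim_unique[of "\<Union>j\<in>J. B j"])
qed

section \<open>Homogeneous polynomial functions\<close>

text \<open>Extension by zero keeps functions on a subspace inside one function type, so that
  equality on \<open>W\<close> becomes equality of functions.\<close>

definition restr :: "'v set \<Rightarrow> ('v \<Rightarrow> real) \<Rightarrow> 'v \<Rightarrow> real" where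
  "restr W f = (\<lambda>v. if v \<in> W then f v else 0)"

lemma restr_apply: "v \<in> W \<Longrightarrow> restr W f v = f v" "v \<notin> W \<Longrightarrow> restr W f v = 0"
  by (simp_all add: restr_def)

lemma linear_restr: "linear (restr W)"
  by (rule linearI) (simp_all add: restr_def fun_eq_iff fun_ops)

lemma restr_restr: "W' \<subseteq> W \<Longrightarrow> restr W' (restr W f) = restr W' f"
  by (auto simp: restr_def fun_eq_iff)

definition hom_poly :: "nat \<Rightarrow> 'v::real_vector set \<Rightarrow> ('v \<Rightarrow> real) set" where
  "hom_poly i W = span {restr W (\<lambda>v. \<Prod>f\<leftarrow>fs. f v) | fs. length fs = i \<and> (\<forall>f\<in>set fs. linear f)}"

lemma hom_poly_base: "\<forall>f\<in>set fs. linear f \<Longrightarrow> length fs = i \<Longrightarrow> restr W (\<lambda>v. \<Prod>f\<leftarrow>fs. f v) \<in> hom_poly i W"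
  unfolding hom_poly_def by (intro span_base) blast

lemma hom_poly_induct [consumes 1, case_names zero add]:
  assumes "g \<in> hom_poly i W" "P 0"
    and "\<And>c fs h. length fs = i \<Longrightarrow> \<forall>f\<in>set fs. linear f \<Longrightarrow> h \<in> hom_poly i W \<Longrightarrow> P h \<Longrightarrow>
      P (c *\<^sub>R restr W (\<lambda>v. \<Prod>f\<leftarrow>fs. f v) + h)"
  shows "P g"
proof -
  have "g \<in> hom_poly i W \<and> P g"
    using assms(1) unfolding hom_poly_def
  proof (induction rule: span_induct_alt)
    case base
    then show ?case using assms(2) span_zero by blast
  next
    case (step c x y)
    then obtain fs where "length fs = i" "\<forall>f\<in>set fs. linear f" "x = restr W (\<lambda>v. \<Prod>f\<leftarrow>fs. f v)"
      by blast
    moreover have "y \<in> hom_poly i W" using step by (simp add: hom_poly_def)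
    ultimately have "P (c *\<^sub>R x + y)" using assms(3)[of fs y c] step by simp
    moreover have "c *\<^sub>R x + y \<in> span {restr W (\<lambda>v. \<Prod>f\<leftarrow>fs. f v) | fs. length fs = i \<and> (\<forall>f\<in>set fs. linear f)}"
      using step by (intro span_add span_scale) (auto intro: span_base)
    ultimately show ?case by blast
  qed
  then show ?thesis ..
qed

lemma subspace_hom_poly: "subspace (hom_poly i W)"
  by (simp add: hom_poly_def)

lemma hom_poly_outside: "g \<in> hom_poly i W \<Longrightarrow> v \<notin> W \<Longrightarrow> g v = 0"
  by (induction rule: hom_poly_induct) (simp_all add: restr_apply fun_ops)

lemma hom_poly_restr:
  assumes "g \<in> hom_poly i W" "W' \<subseteq> W"
  shows "restr W' g \<in> hom_poly i W'"
  using assms(1)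
proof (induction rule: hom_poly_induct)
  case zero
  then show ?case by (simp add: linear_0[OF linear_restr] subspace_0[OF subspace_hom_poly])
next
  case (add c fs h)
  then show ?case
    by (simp add: linear_add[OF linear_restr] linear_scale[OF linear_restr] restr_restr[OF assms(2)]
      subspace_add[OF subspace_hom_poly] subspace_scale[OF subspace_hom_poly] hom_poly_base)
qed

lemma hom_poly_mult_linear:
  assumes "g \<in> hom_poly i W" "linear l"
  shows "l * g \<in> hom_poly (Suc i) W"
  using assms(1)
proof (induction rule: hom_poly_induct)
  case zero
  then show ?case by (simp add: subspace_0[OF subspace_hom_poly])
next
  case (add c fs h)
  have "l * (c *\<^sub>R restr W (\<lambda>v. \<Prod>f\<leftarrow>fs. f v) + h) = c *\<^sub>R restr W (\<lambda>v. \<Prod>f\<leftarrow>l # fs. f v) + l * h"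
    by (auto simp: fun_eq_iff restr_def algebra_simps fun_ops)
  moreover have "restr W (\<lambda>v. \<Prod>f\<leftarrow>l # fs. f v) \<in> hom_poly (Suc i) W"
    using add assms(2) by (intro hom_poly_base) auto
  ultimately show ?case
    using add by (simp add: subspace_add[OF subspace_hom_poly] subspace_scale[OF subspace_hom_poly])
qed

text \<open>The outer variable of \<open>Q\<close> is \<open>t\<close>, the inner one
  \<open>s\<close>: each coefficient of a power of \<open>t\<close> is itself a polynomial in
  \<open>s\<close>. Division by a form needs exactly this dependence on the base point.\<close>

lemma hom_poly_plane:
  assumes "g \<in> hom_poly i W" "subspace W" "w \<in> W" "e \<in> W" "u \<in> W"
  shows "\<exists>Q :: real poly poly. \<forall>s t. g (w + s *\<^sub>R e + t *\<^sub>R u) = poly (poly Q [:t:]) s"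
  using assms(1)
proof (induction rule: hom_poly_induct)
  case zero
  then show ?case by (intro exI[of _ 0]) (simp add: fun_ops)
next
  case (add c fs h)
  have W: "w + s *\<^sub>R e + t *\<^sub>R u \<in> W" for s t
    using assms by (simp add: subspace_add subspace_scale)
  have "\<exists>Q :: real poly poly. \<forall>s t. (\<Prod>f\<leftarrow>fs. f (w + s *\<^sub>R e + t *\<^sub>R u)) = poly (poly Q [:t:]) s"
    using add(2)
  proof (induction fs)
    case Nil
    then show ?case by (intro exI[of _ 1]) simp
  next
    case (Cons f fs)
    then obtain Q :: "real poly poly" where
      Q: "\<And>s t. (\<Prod>f\<leftarrow>fs. f (w + s *\<^sub>R e + t *\<^sub>R u)) = poly (poly Q [:t:]) s" by auto
    have f: "linear f" using Cons by simp
    have "f (w + s *\<^sub>R e + t *\<^sub>R u) = poly (poly [:[:f w, f e:], [:f u:]:] [:t:]) s" for s t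
      by (simp add: linear_add[OF f] linear_scale[OF f])
    then show ?case
      by (intro exI[of _ "[:[:f w, f e:], [:f u:]:] * Q"]) (simp only: list.map prod_list.Cons Q poly_mult simp_thms)
  qed
  then obtain Q where Q: "\<And>s t. (\<Prod>f\<leftarrow>fs. f (w + s *\<^sub>R e + t *\<^sub>R u)) = poly (poly Q [:t:]) s" by auto
  obtain R where R: "\<And>s t. h (w + s *\<^sub>R e + t *\<^sub>R u) = poly (poly R [:t:]) s" using add by auto
  show ?case
    by (rule exI[of _ "[:[:c:]:] * Q + R"]) (simp add: Q R restr_apply W fun_ops)
qed

lemma hom_poly_line:
  assumes "g \<in> hom_poly i W" "subspace W" "w \<in> W" "u \<in> W"
  shows "\<exists>q :: real poly. \<forall>t. g (w + t *\<^sub>R u) = poly q t"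
proof -
  obtain Q where Q: "\<And>s t. g (w + s *\<^sub>R u + t *\<^sub>R 0) = poly (poly Q [:t:]) s"
    using hom_poly_plane[OF assms(1-4) subspace_0[OF assms(2)]] by auto
  show ?thesis using Q[of _ 0] by auto
qed

lemma poly_cofinite_zero:
  fixes p :: "real poly"
  assumes "\<And>t. t \<noteq> a \<Longrightarrow> poly p t = 0"
  shows "p = 0"
proof (rule ccontr)
  assume "p \<noteq> 0"
  then have "finite {t. poly p t = 0}" by (rule poly_roots_finite)
  moreover have "UNIV \<subseteq> insert a {t. poly p t = 0}" using assms by auto
  ultimately show False using infinite_UNIV_char_0 by (metis finite_insert finite_subset)
qed

text \<open>On a line in direction \<open>e\<close> the form \<open>l\<close> vanishes at a single
  parameter, so all other parameters are roots of the polynomial that \<open>g\<close> induces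
  there.\<close>

lemma hom_poly_cancel_linear:
  assumes "g \<in> hom_poly i W" "subspace W" "linear l" "e \<in> W" "l e \<noteq> 0" "l * g = 0"
  shows "g = 0"
proof
  fix w
  show "g w = 0 w"
  proof (cases "w \<in> W")
    case True
    obtain q where q: "\<And>t. g (w + t *\<^sub>R e) = poly q t"
      using hom_poly_line[OF assms(1,2) True assms(4)] by auto
    have "poly q t = 0" if "t \<noteq> - l w / l e" for t
    proof -
      have "l (w + t *\<^sub>R e) \<noteq> 0"
        using that assms(5) by (auto simp: linear_add[OF assms(3)] linear_scale[OF assms(3)] field_simps)
      moreover have "l (w + t *\<^sub>R e) * g (w + t *\<^sub>R e) = 0" using assms(6) by (metis times_fun_apply zero_fun_apply)
      ultimately show ?thesis by (simp add: q)
    qed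
    then have "q = 0" by (rule poly_cofinite_zero)
    then show ?thesis using q[of 0] by (simp add: fun_ops)
  qed (simp add: hom_poly_outside[OF assms(1)] fun_ops)
qed

text \<open>For a projection \<open>p\<close> onto the kernel of \<open>l\<close>, the difference of
  \<open>f\<close> and \<open>f\<close> composed with \<open>p\<close> is divisible by
  \<open>l\<close>, as is seen factor by factor; the composed function vanishes by hypothesis. The
  quotient is again homogeneous.\<close>

lemma hom_poly_divide:
  assumes f: "f \<in> hom_poly (Suc i) W" and W: "subspace W" and l: "linear l" and e: "e \<in> W" "l e \<noteq> 0"
    and zero: "\<And>w. w \<in> W \<Longrightarrow> l w = 0 \<Longrightarrow> f w = 0"
  shows "\<exists>g\<in>hom_poly i W. f = l * g"
proof -
  \<comment> \<open>The projection onto the kernel of \<open>l\<close> along \<open>e\<close>; it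
    preserves \<open>W\<close> because \<open>e\<close> lies in \<open>W\<close>.\<close>
  define p where "p w = w - (l w / l e) *\<^sub>R e" for w
  have lp: "linear p"
    unfolding p_def by (rule linearI) (simp_all add: linear_add[OF l] linear_scale[OF l] algebra_simps add_divide_distrib)
  have pW: "p w \<in> W" "l (p w) = 0" if "w \<in> W" for w
    using that e W by (auto simp: p_def subspace_diff subspace_scale linear_diff[OF l] linear_scale[OF l])
  have *: "\<exists>G\<in>hom_poly (length fs) W. \<forall>w\<in>W. (\<Prod>f\<leftarrow>h # fs. f w) - (\<Prod>f\<leftarrow>h # fs. f (p w)) = l w * G w"
    if "\<forall>f\<in>set (h # fs). linear f" for h fs
    using that
  proof (induction fs arbitrary: h)
    case Nil
    have "h w - h (p w) = l w * (h e / l e)" for w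
      using Nil by (simp add: p_def linear_diff linear_scale)
    moreover have "(h e / l e) *\<^sub>R restr W (\<lambda>v. \<Prod>f\<leftarrow>[]. f v) \<in> hom_poly 0 W"
      by (intro subspace_scale[OF subspace_hom_poly] hom_poly_base) auto
    ultimately show ?case
      by (intro bexI[of _ "(h e / l e) *\<^sub>R restr W (\<lambda>v. \<Prod>f\<leftarrow>[]. f v)"]) (auto simp: restr_apply fun_ops)
  next
    case (Cons k fs)
    then obtain G where G: "G \<in> hom_poly (length fs) W"
      "\<And>w. w \<in> W \<Longrightarrow> (\<Prod>f\<leftarrow>k # fs. f w) - (\<Prod>f\<leftarrow>k # fs. f (p w)) = l w * G w" by fastforce
    define H where "H = restr W (\<lambda>v. \<Prod>f\<leftarrow>map (\<lambda>f. f \<circ> p) (k # fs). f v)"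
    have H: "H \<in> hom_poly (Suc (length fs)) W"
      unfolding H_def using Cons.prems lp by (intro hom_poly_base) (auto intro: linear_compose)
    have Hw: "H w = (\<Prod>f\<leftarrow>k # fs. f (p w))" if "w \<in> W" for w
      using that by (simp add: H_def restr_apply comp_def)
    have h: "linear h" using Cons.prems by simp
    have "h * G + (h e / l e) *\<^sub>R H \<in> hom_poly (length (k # fs)) W"
      using hom_poly_mult_linear[OF G(1) h] H by (simp add: subspace_add[OF subspace_hom_poly] subspace_scale[OF subspace_hom_poly])
    moreover have "(\<Prod>f\<leftarrow>h # k # fs. f w) - (\<Prod>f\<leftarrow>h # k # fs. f (p w)) = l w * (h * G + (h e / l e) *\<^sub>R H) w"
      if w: "w \<in> W" for w
    proof -
      define a b where "a = (\<Prod>f\<leftarrow>k # fs. f w)" and "b = (\<Prod>f\<leftarrow>k # fs. f (p w))"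
      have d: "h w - h (p w) = l w * (h e / l e)"
        by (simp add: p_def linear_diff[OF h] linear_scale[OF h])
      \<comment> \<open>Telescoping: \<open>a - b\<close> is divisible by the induction hypothesis,
        and \<open>h w - h (p w)\<close> is a multiple of \<open>l w\<close> because
        \<open>w - p w\<close> is \<open>l w / l e\<close> times \<open>e\<close>.\<close>
      have "h w * a - h (p w) * b = h w * (a - b) + (h w - h (p w)) * b" by (simp add: algebra_simps)
      also have "\<dots> = h w * (l w * G w) + l w * (h e / l e) * b"
        using G(2)[OF w] d by (simp add: a_def b_def)
      also have "\<dots> = l w * (h * G + (h e / l e) *\<^sub>R H) w"
        by (simp add: Hw[OF w] b_def algebra_simps fun_ops)
      finally show ?thesis by (simp add: a_def b_def)
    qed
    ultimately show ?case by blast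
  qed
  have "\<exists>g\<in>hom_poly i W. \<forall>w\<in>W. f w - f (p w) = l w * g w"
    using f
  proof (induction rule: hom_poly_induct)
    case zero
    then show ?case by (intro bexI[of _ 0]) (auto simp: fun_ops subspace_0[OF subspace_hom_poly])
  next
    case (add c fs h)
    then obtain k fs' where fs: "fs = k # fs'" "length fs' = i" by (cases fs) auto
    obtain G where G: "G \<in> hom_poly i W"
      "\<And>w. w \<in> W \<Longrightarrow> (\<Prod>f\<leftarrow>fs. f w) - (\<Prod>f\<leftarrow>fs. f (p w)) = l w * G w"
      using *[of k fs'] add(2) fs by metis
    obtain g where g: "g \<in> hom_poly i W" "\<And>w. w \<in> W \<Longrightarrow> h w - h (p w) = l w * g w"
      using add by blast
    show ?case
    proof (intro bexI[of _ "c *\<^sub>R G + g"] ballI)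
      fix w assume w: "w \<in> W"
      have "c * ((\<Prod>f\<leftarrow>fs. f w) - (\<Prod>f\<leftarrow>fs. f (p w))) + (h w - h (p w)) = l w * (c *\<^sub>R G + g) w"
        using G(2)[OF w] g(2)[OF w] by (simp add: algebra_simps fun_ops)
      then show "(c *\<^sub>R restr W (\<lambda>v. \<Prod>f\<leftarrow>fs. f v) + h) w - (c *\<^sub>R restr W (\<lambda>v. \<Prod>f\<leftarrow>fs. f v) + h) (p w)
          = l w * (c *\<^sub>R G + g) w"
        using w pW by (simp add: restr_apply algebra_simps fun_ops)
    qed (use G g in \<open>simp add: subspace_add[OF subspace_hom_poly] subspace_scale[OF subspace_hom_poly]\<close>)
  qed
  then obtain g where g: "g \<in> hom_poly i W" "\<And>w. w \<in> W \<Longrightarrow> f w - f (p w) = l w * g w" by blast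
  have "f w = (l * g) w" for w
    using g(2)[of w] zero[OF pW, of w] hom_poly_outside[OF f, of w] hom_poly_outside[OF g(1), of w]
    by (cases "w \<in> W") (auto simp: fun_ops)
  then show ?thesis using g(1) by blast
qed

section \<open>Spaces of products of linear forms\<close>

text \<open>Full rank in dual form: on a finite-dimensional \<open>W\<close> it says that the forms
  in \<open>S\<close> span the dual space. Contraction then amounts to replacing \<open>W\<close> by
  a kernel.\<close>

definition separating :: "('i \<Rightarrow> 'v::zero \<Rightarrow> real) \<Rightarrow> 'i set \<Rightarrow> 'v set \<Rightarrow> bool" where
  "separating l S W \<longleftrightarrow> (\<forall>w\<in>W. (\<forall>y\<in>S. l y w = 0) \<longrightarrow> w = 0)"

definition P_space :: "('i \<Rightarrow> 'v::real_vector \<Rightarrow> real) \<Rightarrow> 'i set \<Rightarrow> 'v set \<Rightarrow> nat \<Rightarrow> ('v \<Rightarrow> real) set" where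
  "P_space l A W i =
     span {restr W (\<lambda>v. \<Prod>y\<in>Z. l y v) | Z. Z \<subseteq> A \<and> card Z = i \<and> separating l (A - Z) W}"

text \<open>Vanishing of all coefficients from \<open>m\<close> on, rather than an inequality for
  \<open>degree\<close>: for \<open>m = 0\<close> the function must vanish on the line, and the zero
  function satisfies every bound, so the bounded functions form a subspace.\<close>

definition line_degree_less :: "('v::real_vector \<Rightarrow> real) \<Rightarrow> 'v \<Rightarrow> 'v \<Rightarrow> nat \<Rightarrow> bool" where
  "line_degree_less f w u m \<longleftrightarrow>
     (\<exists>q :: real poly. (\<forall>t. f (w + t *\<^sub>R u) = poly q t) \<and> (\<forall>k\<ge>m. coeff q k = 0))"

text \<open>
  The inverse system of the power ideal: in every direction \<open>u\<close> the degree stays below the number of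
  forms that do not vanish on \<open>u\<close>.
\<close>

definition I_space :: "('i \<Rightarrow> 'v::real_vector \<Rightarrow> real) \<Rightarrow> 'i set \<Rightarrow> 'v set \<Rightarrow> nat \<Rightarrow> ('v \<Rightarrow> real) set" where
  "I_space l A W i = {f \<in> hom_poly i W.
     \<forall>w\<in>W. \<forall>u\<in>W. u \<noteq> 0 \<longrightarrow> line_degree_less f w u (card {y\<in>A. l y u \<noteq> 0})}"

text \<open>
  This is \<open>q\<^sup>n\<^sup>-\<^sup>d T(1, 1/q)\<close> with \<open>n\<close> the number of forms, \<open>d\<close> the dimension and the denominators cleared.
\<close>

definition hilb_poly :: "('i \<Rightarrow> 'v::real_vector \<Rightarrow> real) \<Rightarrow> 'i set \<Rightarrow> 'v set \<Rightarrow> int poly" where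
  "hilb_poly l A W = (\<Sum>S\<in>Pow A. if separating l S W
     then [:0, 1:] ^ (card A - card S) * [:1, -1:] ^ (card S - dim W) else 0)"

lemma subspace_P_space: "subspace (P_space l A W i)"
  by (simp add: P_space_def)

lemma line_degree_less_add:
  assumes "line_degree_less f w u m" "line_degree_less g w u m"
  shows "line_degree_less (f + g) w u m"
proof -
  obtain p q where "\<forall>t. f (w + t *\<^sub>R u) = poly p t" "\<forall>k\<ge>m. coeff p k = 0"
    "\<forall>t. g (w + t *\<^sub>R u) = poly q t" "\<forall>k\<ge>m. coeff q k = 0"
    using assms unfolding line_degree_less_def by auto
  then show ?thesis unfolding line_degree_less_def by (intro exI[of _ "p + q"]) (simp add: fun_ops)
qed

lemma line_degree_less_scale:
  assumes "line_degree_less f w u m"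
  shows "line_degree_less (c *\<^sub>R f) w u m"
proof -
  obtain p where "\<forall>t. f (w + t *\<^sub>R u) = poly p t" "\<forall>k\<ge>m. coeff p k = 0"
    using assms unfolding line_degree_less_def by auto
  then show ?thesis unfolding line_degree_less_def by (intro exI[of _ "smult c p"]) (simp add: fun_ops)
qed

lemma line_degree_less_0: "line_degree_less 0 w u m"
  unfolding line_degree_less_def by (intro exI[of _ 0]) (simp add: fun_ops)

lemma subspace_I_space: "subspace (I_space l A W i)"
  unfolding I_space_def
  by (rule subspaceI)
    (auto simp: subspace_0[OF subspace_hom_poly] subspace_add[OF subspace_hom_poly]
      subspace_scale[OF subspace_hom_poly] line_degree_less_0 line_degree_less_add line_degree_less_scale)

lemma restr_prod_in_hom_poly:
  assumes "finite Z" "\<And>y. linear (l y)"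
  shows "restr W (\<lambda>v. \<Prod>y\<in>Z. l y v) \<in> hom_poly (card Z) W"
proof -
  obtain zs where zs: "set zs = Z" "distinct zs" using finite_distinct_list[OF assms(1)] by auto
  have "restr W (\<lambda>v. \<Prod>f\<leftarrow>map l zs. f v) \<in> hom_poly (card Z) W"
    using zs assms(2) by (intro hom_poly_base) (auto simp: distinct_card)
  moreover have "(\<Prod>f\<leftarrow>map l zs. f v) = (\<Prod>y\<in>Z. l y v)" for v
    using zs(2) unfolding zs(1)[symmetric] by (simp add: comp_def prod.distinct_set_conv_list)
  ultimately show ?thesis by simp
qed

text \<open>Along \<open>u\<close> the degree of the product over \<open>Z\<close> is at most the
  number of its factors not vanishing on \<open>u\<close>. As \<open>A - Z\<close> is separating,
  some form outside \<open>Z\<close> does not vanish on \<open>u\<close> either, which makes the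
  bound strict.\<close>

lemma P_space_subset_I_space:
  assumes A: "finite A" and l: "\<And>y. linear (l y)" and W: "subspace W"
  shows "P_space l A W i \<subseteq> I_space l A W i"
  unfolding P_space_def
proof (rule span_minimal[OF _ subspace_I_space], clarify)
  fix Z assume Z: "Z \<subseteq> A" "separating l (A - Z) W" "i = card Z"
  have fZ: "finite Z" using Z A finite_subset by blast
  have "line_degree_less (restr W (\<lambda>v. \<Prod>y\<in>Z. l y v)) w u (card {y\<in>A. l y u \<noteq> 0})"
    if w: "w \<in> W" and u: "u \<in> W" "u \<noteq> 0" for w u
    unfolding line_degree_less_def
  proof (intro exI[of _ "\<Prod>y\<in>Z. [:l y w, l y u:]"] conjI allI impI)
    fix t
    have "w + t *\<^sub>R u \<in> W" using w u W by (simp add: subspace_add subspace_scale)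
    then show "restr W (\<lambda>v. \<Prod>y\<in>Z. l y v) (w + t *\<^sub>R u) = poly (\<Prod>y\<in>Z. [:l y w, l y u:]) t"
      by (simp add: restr_apply poly_prod linear_add[OF l] linear_scale[OF l])
  next
    fix k assume k: "card {y\<in>A. l y u \<noteq> 0} \<le> k"
    obtain y where y: "y \<in> A - Z" "l y u \<noteq> 0" using Z(2) u unfolding separating_def by blast
    have "degree (\<Prod>y\<in>Z. [:l y w, l y u:]) \<le> (\<Sum>y\<in>Z. degree [:l y w, l y u:])"
      using degree_prod_sum_le[OF fZ, of "\<lambda>y. [:l y w, l y u:]"] by (simp add: comp_def)
    also have "\<dots> = (\<Sum>y\<in>Z. if l y u \<noteq> 0 then 1 else 0)" by (intro sum.cong) auto
    also have "\<dots> = card {y\<in>Z. l y u \<noteq> 0}"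
      using fZ by (simp add: sum.inter_filter[symmetric])
    also have "\<dots> < card {y\<in>A. l y u \<noteq> 0}"
      using Z(1) y A by (intro psubset_card_mono) auto
    finally show "coeff (\<Prod>y\<in>Z. [:l y w, l y u:]) k = 0"
      using k by (intro coeff_eq_0) linarith
  qed
  then show "restr W (\<lambda>v. \<Prod>y\<in>Z. l y v) \<in> I_space l A W (card Z)"
    unfolding I_space_def using restr_prod_in_hom_poly[OF fZ l] by auto
qed

section \<open>Deletion and contraction for the subset expansion\<close>

lemma sum_Pow_insert:
  fixes f :: "'a set \<Rightarrow> 'b::comm_monoid_add"
  assumes "finite A" "x \<notin> A"
  shows "(\<Sum>S\<in>Pow (insert x A). f S) = (\<Sum>S\<in>Pow A. f S) + (\<Sum>S\<in>Pow A. f (insert x S))"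
proof -
  have inj: "inj_on (insert x) (Pow A)" using assms(2) by (intro inj_onI) (metis PowD insert_ident subsetD)
  have "Pow A \<inter> insert x ` Pow A = {}" using assms(2) by auto
  then show ?thesis
    using assms(1) by (simp add: Pow_insert sum.union_disjoint sum.reindex[OF inj] comp_def)
qed

lemma subspace_kernel: "subspace W \<Longrightarrow> linear l \<Longrightarrow> subspace (W \<inter> {w. l w = 0})"
  by (auto simp: subspace_def linear_0 linear_add linear_scale)

lemma dim_kernel:
  fixes l :: "'v::real_vector \<Rightarrow> real"
  assumes W: "subspace W" "finite F" "W \<subseteq> span F" and l: "linear l" and e: "e \<in> W" "l e \<noteq> 0"
  shows "dim W = Suc (dim (W \<inter> {w. l w = 0}))"
proof -
  let ?K = "W \<inter> {w. l w = 0}"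
  obtain B where B: "B \<subseteq> ?K" "independent B" "?K \<subseteq> span B" "card B = dim ?K"
    using real_vector.basis_exists by blast
  have fB: "finite B" using independent_span_bound[OF W(2) B(2)] B(1) W(3) by blast
  have K: "span B \<subseteq> ?K" by (rule span_minimal[OF B(1) subspace_kernel[OF W(1) l]])
  then have eB: "e \<notin> span B" using e by auto
  have "W \<subseteq> span (insert e B)"
  proof
    fix w assume w: "w \<in> W"
    have "w - (l w / l e) *\<^sub>R e \<in> ?K"
      using w e W(1) by (auto simp: subspace_diff subspace_scale linear_diff[OF l] linear_scale[OF l])
    then have "w - (l w / l e) *\<^sub>R e \<in> span B" using B(3) by blast
    then show "w \<in> span (insert e B)" by (meson span_breakdown_eq)
  qed
  moreover have "independent (insert e B)" using eB B(2) by (simp add: independent_insertI)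
  moreover have "card (insert e B) = Suc (dim ?K)"
    using eB fB B(4) span_base by (metis card_insert_disjoint)
  ultimately show ?thesis using B(1) e(1) by (intro real_vector.dim_unique[of "insert e B"]) auto
qed

lemma separating_insert:
  "separating l (insert x S) W \<longleftrightarrow> separating l S (W \<inter> {w. l x w = 0})"
  unfolding separating_def by auto

text \<open>For a zero form, \<open>S\<close> and \<open>insert x S\<close> separate alike, and
  relative to the term of \<open>S\<close> for \<open>A\<close> their weights carry the factors q
  and 1 - q, which add up to 1. The bound on \<open>dim W\<close> keeps the truncated subtraction in
  the exponent exact.\<close>

lemma hilb_poly_loop:
  assumes "finite A" "x \<notin> A" "\<And>w. w \<in> W \<Longrightarrow> l x w = 0" "\<And>S. S \<subseteq> A \<Longrightarrow> separating l S W \<Longrightarrow> dim W \<le> card S"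
  shows "hilb_poly l (insert x A) W = hilb_poly l A W"
proof -
  have *: "separating l (insert x S) W \<longleftrightarrow> separating l S W" for S
    using assms(3) by (auto simp: separating_def)
  show ?thesis
    unfolding hilb_poly_def sum_Pow_insert[OF assms(1,2)] sum.distrib[symmetric]
  proof (rule sum.cong)
    fix S assume S: "S \<in> Pow A"
    then have S': "finite S" "x \<notin> S" "card S \<le> card A"
      using assms(1,2) by (auto intro: finite_subset card_mono)
    have "[:0, 1:] ^ Suc (card A - card S) * [:1, -1:] ^ (card S - dim W)
        + [:0, 1:] ^ (card A - card S) * [:1, -1:] ^ Suc (card S - dim W)
        = [:0, 1:] ^ (card A - card S) * [:1, -1:] ^ (card S - dim W) * ([:0, 1:] + [:1, -1:] :: int poly)"
      unfolding power_Suc by (simp only: distrib_right distrib_left mult_ac)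
    also have "[:0, 1:] + [:1, -1:] = (1 :: int poly)" by (simp add: one_pCons)
    finally show "(if separating l S W then [:0, 1:] ^ (card (insert x A) - card S) * [:1, -1:] ^ (card S - dim W) else 0)
        + (if separating l (insert x S) W then [:0, 1:] ^ (card (insert x A) - card (insert x S)) *
            [:1, -1:] ^ (card (insert x S) - dim W) else 0)
        = (if separating l S W then [:0, 1:] ^ (card A - card S) * [:1, -1:] ^ (card S - dim W) else (0 :: int poly))"
      using S S' assms(1,2,4) by (simp add: * Suc_diff_le)
  qed simp
qed

text \<open>Subsets without \<open>x\<close> give the deletion, subsets containing \<open>x\<close>
  the contraction to its kernel. A bridge is no separate case: once it is deleted no subset
  separates \<open>W\<close>, and the deletion term is zero.\<close>

lemma hilb_poly_step:
  assumes "finite A" "x \<notin> A" "subspace W" "finite F" "W \<subseteq> span F" "linear (l x)" "e \<in> W" "l x e \<noteq> 0"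
  shows "hilb_poly l (insert x A) W = pCons 0 (hilb_poly l A W) + hilb_poly l A (W \<inter> {w. l x w = 0})"
proof -
  have p: "pCons 0 (hilb_poly l A W) = [:0, 1:] * hilb_poly l A W" by simp
  show ?thesis
    unfolding p unfolding hilb_poly_def sum_Pow_insert[OF assms(1,2)] sum_distrib_left
  proof (intro arg_cong2[of _ _ _ _ "(+)"] sum.cong refl)
    fix S assume S: "S \<in> Pow A"
    then have S': "finite S" "x \<notin> S" "card S \<le> card A"
      using assms(1,2) by (auto intro: finite_subset card_mono)
    show "(if separating l S W then [:0, 1:] ^ (card (insert x A) - card S) * [:1, -1:] ^ (card S - dim W) else 0)
      = [:0, 1:] * (if separating l S W then [:0, 1:] ^ (card A - card S) * [:1, -1:] ^ (card S - dim W) else (0 :: int poly))"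
      using S' assms(1,2) by (simp add: Suc_diff_le mult.assoc del: mult_pCons_left mult_pCons_right)
    show "(if separating l (insert x S) W then [:0, 1:] ^ (card (insert x A) - card (insert x S)) *
            [:1, -1:] ^ (card (insert x S) - dim W) else 0)
      = (if separating l S (W \<inter> {w. l x w = 0}) then [:0, 1:] ^ (card A - card S) *
            [:1, -1:] ^ (card S - dim (W \<inter> {w. l x w = 0})) else (0 :: int poly))"
      using S' assms(1,2) dim_kernel[OF assms(3-8)] by (simp add: separating_insert)
  qed
qed

text \<open>Evaluation at the forms in \<open>S\<close> embeds \<open>W\<close> into the functions
  supported on \<open>S\<close>.\<close>

lemma separating_dim_le:
  fixes l :: "'i \<Rightarrow> 'v::real_vector \<Rightarrow> real"
  assumes W: "subspace W" and S: "finite S" "separating l S W" and l: "\<And>y. linear (l y)"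
  shows "dim W \<le> card S"
proof -
  define T where "T w = (\<lambda>y. if y \<in> S then l y w else 0)" for w
  have T: "linear T"
    by (rule linearI) (auto simp: T_def fun_ops fun_eq_iff linear_add[OF l] linear_scale[OF l])
  have "inj_on T W"
  proof (rule inj_onI)
    fix v w assume vw: "v \<in> W" "w \<in> W" "T v = T w"
    have "l y (v - w) = 0" if "y \<in> S" for y
      using fun_cong[OF vw(3), of y] that by (simp add: T_def linear_diff[OF l])
    then show "v = w" using S(2) vw W by (metis separating_def subspace_diff eq_iff_diff_eq_0)
  qed
  then have d: "dim (T ` W) = dim W"
    by (intro dim_injective_image[OF T]) (use W span_eq_iff in metis)
  let ?U = "(\<lambda>y z. if z = y then 1 else 0 :: real) ` S"
  have "T ` W \<subseteq> span ?U"
  proof clarify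
    fix w
    have "T w = (\<Sum>y\<in>S. l y w *\<^sub>R (\<lambda>z. if z = y then 1 else 0))"
    proof
      fix z :: 'i
      have ev: "sum f S z = (\<Sum>y\<in>S. f y z)" for f :: "'i \<Rightarrow> 'i \<Rightarrow> real"
        by (induction S rule: infinite_finite_induct) (simp_all add: fun_ops)
      show "T w z = (\<Sum>y\<in>S. l y w *\<^sub>R (\<lambda>z. if z = y then 1 else 0)) z"
        using S(1) unfolding ev by (simp add: T_def fun_ops if_distrib[of "(*) _"] cong: if_cong)
    qed
    moreover have "\<dots> \<in> span ?U" by (intro span_sum span_scale span_base) auto
    ultimately show "T w \<in> span ?U" by simp
  qed
  then have "dim (T ` W) \<le> card ?U" using S(1) by (intro real_vector.dim_le_card) auto
  also have "\<dots> \<le> card S" by (rule card_image_le[OF S(1)])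
  finally show ?thesis using d by simp
qed

text \<open>The preceding bound says nothing about an infinite-dimensional \<open>W\<close>, whose
  \<open>dim\<close> is 0. Finiteness comes from applying it to the spans of finite independent
  subsets.\<close>

lemma separating_finite_dim:
  fixes l :: "'i \<Rightarrow> 'v::real_vector \<Rightarrow> real"
  assumes W: "subspace W" and S: "finite S" "separating l S W" and l: "\<And>y. linear (l y)"
  shows "\<exists>F. finite F \<and> W \<subseteq> span F"
proof -
  obtain B where B: "B \<subseteq> W" "independent B" "W \<subseteq> span B"
    using real_vector.basis_exists by metis
  have "finite B"
  proof (rule ccontr)
    assume "infinite B"
    then obtain C where C: "finite C" "card C = Suc (card S)" "C \<subseteq> B"
      using infinite_arbitrarily_large by blast
    have "independent C" using independent_mono[OF B(2) C(3)] .
    then have "dim (span C) = Suc (card S)" using C(2) real_vector.dim_span_eq_card_independent by metis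
    moreover have "span C \<subseteq> W" using C(3) B(1) by (intro span_minimal[OF _ W]) auto
    then have "separating l S (span C)" using S(2) unfolding separating_def by blast
    then have "dim (span C) \<le> card S" using S(1) by (intro separating_dim_le[OF _ _ _ l]) auto
    ultimately show False by simp
  qed
  then show ?thesis using B(3) by blast
qed

text \<open>Greedy choice of a basis: a form that vanishes on \<open>W\<close> is dropped, any other
  is kept and \<open>W\<close> shrinks to its kernel.\<close>

lemma separating_subset:
  fixes l :: "'i \<Rightarrow> 'v::real_vector \<Rightarrow> real"
  assumes "finite S" "separating l S W" "\<And>y. linear (l y)" "subspace W" "finite F" "W \<subseteq> span F"
  shows "\<exists>S'\<subseteq>S. card S' = dim W \<and> separating l S' W"
  using assms(1,2,4-6)
proof (induction S arbitrary: W rule: finite_induct)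
  case empty
  have "dim W \<le> card ({} :: 'i set)"
    using empty by (intro separating_dim_le[OF _ _ _ assms(3)]) auto
  then show ?case using empty(1) by simp
next
  case (insert x S)
  show ?case
  proof (cases "\<forall>w\<in>W. l x w = 0")
    case True
    then have "separating l S W" using insert(4) unfolding separating_def by blast
    then show ?thesis using insert(3)[OF _ insert(5-7)] by (meson subset_insertI2)
  next
    case False
    then obtain e where e: "e \<in> W" "l x e \<noteq> 0" by blast
    let ?K = "W \<inter> {w. l x w = 0}"
    have "?K \<subseteq> span F" using insert(7) by blast
    then obtain S' where S': "S' \<subseteq> S" "card S' = dim ?K" "separating l S' ?K"
      using insert(3)[OF _ subspace_kernel[OF insert(5) assms(3)] insert(6)] insert(4)
      by (metis separating_insert)
    have "finite S'" "x \<notin> S'" using S'(1) insert(1,2) finite_subset by auto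
    then have "card (insert x S') = dim W"
      using S'(2) dim_kernel[OF insert(5-7) assms(3) e] by simp
    moreover have "separating l (insert x S') W" using S'(3) by (simp add: separating_insert)
    ultimately show ?thesis using S'(1) by (meson insert_mono)
  qed
qed

text \<open>In directions on which \<open>x\<close> does not vanish, degree and count both drop by
  one. In the other directions the count stays the same and \<open>l x\<close> is constant along the
  line; the difficulty is a line on which this constant is zero.\<close>

lemma I_space_divide:
  assumes A: "finite A" "x \<notin> A" and l: "\<And>y. linear (l y)" and W: "subspace W"
    and e: "e \<in> W" "l x e \<noteq> 0"
    and f: "f \<in> I_space l (insert x A) W (Suc i)" and zero: "\<And>w. w \<in> W \<Longrightarrow> l x w = 0 \<Longrightarrow> f w = 0"
  shows "\<exists>g\<in>I_space l A W i. f = l x * g"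
proof -
  have fh: "f \<in> hom_poly (Suc i) W" using f by (simp add: I_space_def)
  obtain g where g: "g \<in> hom_poly i W" and fg: "f = l x * g"
    using hom_poly_divide[OF fh W l e zero] by blast
  have "line_degree_less g w u (card {y\<in>A. l y u \<noteq> 0})" if w: "w \<in> W" and u: "u \<in> W" "u \<noteq> 0" for w u
  proof -
    let ?m = "card {y\<in>A. l y u \<noteq> 0}"
    show ?thesis
    proof (cases "l x u = 0")
      case False
      then have "{y\<in>insert x A. l y u \<noteq> 0} = insert x {y\<in>A. l y u \<noteq> 0}" by auto
      then have "card {y\<in>insert x A. l y u \<noteq> 0} = Suc ?m" using A by simp
      then obtain q where q: "\<And>t. f (w + t *\<^sub>R u) = poly q t" "\<And>k. k \<ge> Suc ?m \<Longrightarrow> coeff q k = 0"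
        using f w u unfolding I_space_def line_degree_less_def by force
      obtain r where r: "\<And>t. g (w + t *\<^sub>R u) = poly r t" using hom_poly_line[OF g W w u(1)] by blast
      have "poly q = poly ([:l x w, l x u:] * r)"
        by (rule ext) (simp add: q(1)[symmetric] r[symmetric] fg fun_ops linear_add[OF l] linear_scale[OF l] algebra_simps)
      then have qr: "q = [:l x w, l x u:] * r" by (simp only: poly_eq_poly_eq_iff)
      have "coeff r k = 0" if "k \<ge> ?m" for k
      proof (cases "r = 0")
        case r0: False
        then have "q \<noteq> 0" using False unfolding qr mult_eq_0_iff by simp
        have "degree q = Suc (degree r)"
          using False r0 unfolding qr by (subst degree_mult_eq) auto
        then have "degree r < ?m" using q(2)[of "degree q"] \<open>q \<noteq> 0\<close> by (metis leading_coeff_0_iff not_less_eq not_less)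
        then show ?thesis using that by (intro coeff_eq_0) linarith
      qed simp
      then show ?thesis unfolding line_degree_less_def using r by blast
    next
      case True
      then have "{y\<in>insert x A. l y u \<noteq> 0} = {y\<in>A. l y u \<noteq> 0}" by auto
      moreover have "line_degree_less f w' u (card {y\<in>insert x A. l y u \<noteq> 0})" if "w' \<in> W" for w'
        using f that u unfolding I_space_def by blast
      ultimately have ld: "line_degree_less f w' u ?m" if "w' \<in> W" for w' using that by simp
      \<comment> \<open>Shift the line by \<open>s *\<^sub>R e\<close>. For all but one
        \<open>s\<close> the form \<open>l x\<close> is a nonzero constant on it, and
        \<open>g\<close> inherits the bound from \<open>f\<close>. The high coefficients, being
        polynomials in \<open>s\<close>, then vanish at the remaining \<open>s\<close> as
        well.\<close>
      obtain Q where Q: "\<And>s t. g (w + s *\<^sub>R e + t *\<^sub>R u) = poly (poly Q [:t:]) s"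
        using hom_poly_plane[OF g W w e(1) u(1)] by blast
      define q where "q s = map_poly (\<lambda>c. poly c s) Q" for s
      have q: "poly (q s) t = poly (poly Q [:t:]) s" for s t
        unfolding q_def by (induction Q) (simp_all add: map_poly_pCons)
      have coeff_q: "coeff (q s) k = poly (coeff Q k) s" for s k
        by (simp add: q_def coeff_map_poly)
      have "coeff Q k = 0" if k: "k \<ge> ?m" for k
      proof (rule poly_cofinite_zero)
        fix s assume s: "s \<noteq> - l x w / l x e"
        let ?c = "l x (w + s *\<^sub>R e)"
        have c: "?c \<noteq> 0" using s e(2) by (auto simp: linear_add[OF l] linear_scale[OF l] field_simps)
        have "w + s *\<^sub>R e \<in> W" using w e W by (simp add: subspace_add subspace_scale)
        from ld[OF this] obtain p where p: "\<And>t. f (w + s *\<^sub>R e + t *\<^sub>R u) = poly p t" "coeff p k = 0"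
          using k unfolding line_degree_less_def by blast
        have "poly p = poly (smult ?c (q s))"
          by (rule ext) (simp add: p(1)[symmetric] q Q[symmetric] fg fun_ops linear_add[OF l] linear_scale[OF l] True)
        then have "p = smult ?c (q s)" by (simp only: poly_eq_poly_eq_iff)
        then show "poly (coeff Q k) s = 0" using p(2) c by (simp add: coeff_q[symmetric])
      qed
      then show ?thesis
        unfolding line_degree_less_def using Q[of 0] by (intro exI[of _ "q 0"]) (simp add: q coeff_q)
    qed
  qed
  then have "g \<in> I_space l A W i" using g by (simp add: I_space_def)
  then show ?thesis using fg by blast
qed

text \<open>Directions inside the kernel of \<open>l x\<close> do not count \<open>x\<close>, so the
  bounds for the two lists agree there.\<close>

lemma I_space_restr:
  assumes W: "subspace W" and l: "linear (l x)" and f: "f \<in> I_space l (insert x A) W i"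
  shows "restr (W \<inter> {w. l x w = 0}) f \<in> I_space l A (W \<inter> {w. l x w = 0}) i"
proof -
  let ?K = "W \<inter> {w. l x w = 0}"
  have "line_degree_less (restr ?K f) w u (card {y\<in>A. l y u \<noteq> 0})" if w: "w \<in> ?K" and u: "u \<in> ?K" "u \<noteq> 0" for w u
  proof -
    have "{y\<in>insert x A. l y u \<noteq> 0} = {y\<in>A. l y u \<noteq> 0}" using u by auto
    moreover have "line_degree_less f w u (card {y\<in>insert x A. l y u \<noteq> 0})"
      using f w u unfolding I_space_def by blast
    ultimately have "line_degree_less f w u (card {y\<in>A. l y u \<noteq> 0})" by simp
    moreover have "w + t *\<^sub>R u \<in> ?K" for t
      using w u subspace_kernel[OF W l] by (meson subspace_add subspace_scale)
    ultimately show ?thesis by (simp add: line_degree_less_def restr_apply(1))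
  qed
  then show ?thesis
    using f hom_poly_restr[of f i W ?K] by (simp add: I_space_def)
qed

text \<open>A product admissible for the contraction is admissible on \<open>W\<close> with
  \<open>x\<close> left in the complement, so restriction reaches every generator.\<close>

lemma P_space_restr:
  assumes A: "finite A" "x \<notin> A"
  shows "P_space l A (W \<inter> {w. l x w = 0}) i \<subseteq> restr (W \<inter> {w. l x w = 0}) ` P_space l (insert x A) W i"
proof -
  let ?K = "W \<inter> {w. l x w = 0}"
  have "{restr ?K (\<lambda>v. \<Prod>y\<in>Z. l y v) | Z. Z \<subseteq> A \<and> card Z = i \<and> separating l (A - Z) ?K}
      \<subseteq> restr ?K ` {restr W (\<lambda>v. \<Prod>y\<in>Z. l y v) | Z. Z \<subseteq> insert x A \<and> card Z = i \<and> separating l (insert x A - Z) W}"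
  proof clarify
    fix Z assume Z: "Z \<subseteq> A" "separating l (A - Z) ?K" "i = card Z"
    have "insert x A - Z = insert x (A - Z)" using A Z by auto
    then have "separating l (insert x A - Z) W" using Z(2) by (simp add: separating_insert)
    then show "restr ?K (\<lambda>v. \<Prod>y\<in>Z. l y v) \<in> restr ?K ` {restr W (\<lambda>v. \<Prod>y\<in>Za. l y v) | Za. Za \<subseteq> insert x A \<and> card Za = card Z \<and> separating l (insert x A - Za) W}"
      using Z by (intro image_eqI[of _ _ "restr W (\<lambda>v. \<Prod>y\<in>Z. l y v)"]) (auto simp: restr_restr)
  qed
  then show ?thesis
    unfolding P_space_def linear_span_image[OF linear_restr, symmetric] by (rule span_mono)
qed

text \<open>Moving \<open>x\<close> into the product leaves the complement, and with it the
  separation condition, unchanged.\<close>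

lemma P_space_mult:
  assumes A: "finite A" "x \<notin> A" and g: "g \<in> P_space l A W i"
  shows "l x * g \<in> P_space l (insert x A) W (Suc i)"
  using g unfolding P_space_def[of l A]
proof (induction rule: span_induct_alt)
  case base
  then show ?case by (simp add: subspace_0[OF subspace_P_space])
next
  case (step c f h)
  then obtain Z where Z: "Z \<subseteq> A" "card Z = i" "separating l (A - Z) W" and f: "f = restr W (\<lambda>v. \<Prod>y\<in>Z. l y v)"
    by blast
  have x: "x \<notin> Z" "finite Z" using Z A finite_subset by auto
  have "l x * f = restr W (\<lambda>v. \<Prod>y\<in>insert x Z. l y v)"
    using x by (auto simp: f restr_def fun_eq_iff fun_ops)
  moreover have "insert x A - insert x Z = A - Z" using A x by auto
  ultimately have "l x * f \<in> P_space l (insert x A) W (Suc i)"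
    unfolding P_space_def using Z x by (intro span_base CollectI exI[of _ "insert x Z"]) auto
  moreover have "l x * (c *\<^sub>R f + h) = c *\<^sub>R (l x * f) + l x * h"
    by (simp add: fun_eq_iff fun_ops algebra_simps)
  ultimately show ?case
    using step by (simp add: subspace_add[OF subspace_P_space] subspace_scale[OF subspace_P_space])
qed

lemma linear_mult_left_fun: "linear (\<lambda>g. l * g)" for l :: "'a \<Rightarrow> real"
  by (rule linearI) (simp_all add: fun_eq_iff fun_ops algebra_simps)

lemma hom_poly_0_zero: "hom_poly i {0::'v::real_vector} \<subseteq> (if i = 0 then span {restr {0} (\<lambda>_. 1)} else {0})"
proof (cases "i = 0")
  case True
  have "{restr {0::'v} (\<lambda>v. \<Prod>f\<leftarrow>fs. f v) | fs. length fs = 0 \<and> (\<forall>f\<in>set fs. linear f)} \<subseteq> {restr {0} (\<lambda>_. 1)}"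
    by auto
  then show ?thesis using True by (simp add: hom_poly_def span_mono)
next
  case False
  have "g = 0" if "g \<in> hom_poly i {0}" for g :: "'v \<Rightarrow> real"
    using that
  proof (induction rule: hom_poly_induct)
    case (add c fs h)
    then obtain f fs' where "fs = f # fs'" "linear f" using False by (cases fs) auto
    then have "restr {0} (\<lambda>v. \<Prod>f\<leftarrow>fs. f v) = 0" by (auto simp: restr_def fun_eq_iff fun_ops linear_0)
    then show ?case using add by simp
  qed simp
  then show ?thesis using False by auto
qed

text \<open>The induction leaves \<open>W\<close> and \<open>i\<close> free: deletion keeps
  \<open>W\<close> and lowers the degree by one, contraction keeps the degree and replaces
  \<open>W\<close> by the kernel of \<open>x\<close>. Explicit finite sets carry the finiteness
  along with the bounds.\<close>

lemma hilb_poly_bounds: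
  fixes l :: "'i \<Rightarrow> 'v::real_vector \<Rightarrow> real"
  assumes A: "finite A" and l: "\<And>y. linear (l y)" and W: "subspace W" "finite F" "W \<subseteq> span F"
  shows "(\<exists>T. finite T \<and> int (card T) \<le> coeff (hilb_poly l A W) i \<and> I_space l A W i \<subseteq> span T) \<and>
    (\<exists>B. finite B \<and> independent B \<and> coeff (hilb_poly l A W) i \<le> int (card B) \<and> B \<subseteq> P_space l A W i)"
  using A W
proof (induction A arbitrary: W i rule: finite_induct)
  case empty
  show ?case
  proof (cases "W = {0}")
    case True
    have h: "hilb_poly l {} W = 1" by (simp add: hilb_poly_def separating_def True)
    let ?T = "if i = 0 then {restr {0::'v} (\<lambda>_. 1::real)} else {}"
    have "I_space l {} W i \<subseteq> span ?T"
      using hom_poly_0_zero[of i, where ?'v = 'v] by (auto simp: I_space_def True split: if_splits)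
    moreover have "independent ?T"
      by (auto simp: restr_def fun_eq_iff fun_ops dependent_single independent_empty)
    moreover have "?T \<subseteq> P_space l {} W i"
      by (auto simp: P_space_def True separating_def intro!: span_base)
    ultimately show ?thesis
      by (intro conjI exI[of _ ?T]) (auto simp: h coeff_1)
  next
    case False
    then obtain u where u: "u \<in> W" "u \<noteq> 0" using subspace_0[OF empty(1)] by auto
    then have "\<not> separating l {} W" by (auto simp: separating_def)
    then have h: "hilb_poly l {} W = 0" by (simp add: hilb_poly_def)
    \<comment> \<open>With no forms the bound in direction \<open>u\<close> is 0, which forces
      \<open>f\<close> to vanish on every line in that direction.\<close>
    have "f = 0" if f: "f \<in> I_space l {} W i" for f
    proof
      fix w
      show "f w = 0 w"
      proof (cases "w \<in> W")
        case True
        then have "line_degree_less f w u 0" using f u by (auto simp: I_space_def)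
        then obtain q where q: "\<forall>t. f (w + t *\<^sub>R u) = poly q t" "\<forall>k. coeff q k = 0"
          unfolding line_degree_less_def by auto
        then have "q = 0" by (simp add: poly_eq_iff)
        then show ?thesis using q(1)[rule_format, of 0] by (simp add: fun_ops)
      qed (use f hom_poly_outside in \<open>auto simp: I_space_def fun_ops\<close>)
    qed
    then have "I_space l {} W i \<subseteq> span {}" by auto
    then show ?thesis by (intro conjI exI[of _ "{}"]) (auto simp: h independent_empty)
  qed
next
  case (insert x A)
  show ?case
  proof (cases "\<forall>w\<in>W. l x w = 0")
    case True
    \<comment> \<open>A zero form changes no degree bound, and every product for \<open>A\<close>
      stays admissible with \<open>x\<close> in its complement.\<close>
    have hl: "hilb_poly l (insert x A) W = hilb_poly l A W"
    proof (rule hilb_poly_loop[OF insert(1,2)])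
      fix S assume "S \<subseteq> A" "separating l S W"
      then show "dim W \<le> card S"
        using insert(1,4) by (intro separating_dim_le[OF _ _ _ l]) (auto intro: finite_subset)
    qed (use True in auto)
    have "card {y\<in>insert x A. l y u \<noteq> 0} = card {y\<in>A. l y u \<noteq> 0}" if "u \<in> W" for u
      using True that by (intro arg_cong[of _ _ card]) auto
    then have Il: "I_space l (insert x A) W i = I_space l A W i"
      unfolding I_space_def by auto
    have "P_space l A W i \<subseteq> P_space l (insert x A) W i"
      unfolding P_space_def
    proof (rule span_mono, clarify)
      fix Z assume Z: "Z \<subseteq> A" "separating l (A - Z) W" "i = card Z"
      then have "separating l (insert x A - Z) W" unfolding separating_def by auto
      then show "\<exists>Za. restr W (\<lambda>v. \<Prod>y\<in>Z. l y v) = restr W (\<lambda>v. \<Prod>y\<in>Za. l y v) \<and> Za \<subseteq> insert x A \<and>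
          card Za = card Z \<and> separating l (insert x A - Za) W"
        using Z by (intro exI[of _ Z]) auto
    qed
    then show ?thesis using insert(3)[OF insert(4-6), of i] unfolding hl Il by blast
  next
    case False
    then obtain e where e: "e \<in> W" "l x e \<noteq> 0" by auto
    let ?K = "W \<inter> {w. l x w = 0}"
    have K: "subspace ?K" "?K \<subseteq> span F" using subspace_kernel[OF insert(4) l] insert(6) by auto
    note h = hilb_poly_step[where l = l and x = x, OF insert(1,2,4,5,6) l e]
    note IHK = insert(3)[OF K(1) insert(5) K(2), of i]
    have zero_on_K: "f w = 0" if "restr ?K f = 0" "w \<in> W" "l x w = 0" for f w
      using fun_cong[OF that(1), of w] that(2,3) by (simp add: restr_def fun_ops)
    obtain T1 where T1: "finite T1" "int (card T1) \<le> coeff (hilb_poly l A ?K) i" "I_space l A ?K i \<subseteq> span T1"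
      using IHK by blast
    obtain B1 where B1: "finite B1" "independent B1" "coeff (hilb_poly l A ?K) i \<le> int (card B1)" "B1 \<subseteq> P_space l A ?K i"
      using IHK by blast
    have rI: "restr ?K ` I_space l (insert x A) W i \<subseteq> span T1"
      using I_space_restr[of W l x _ A i] insert(4) l T1(3) by blast
    have rP: "B1 \<subseteq> restr ?K ` P_space l (insert x A) W i"
      using B1(4) P_space_restr[OF insert(1,2), of l W i] by blast
    have "\<exists>T2. finite T2 \<and> int (card T2) \<le> coeff (pCons 0 (hilb_poly l A W)) i \<and>
        {f \<in> I_space l (insert x A) W i. restr ?K f = 0} \<subseteq> span T2"
    proof (cases i)
      case 0
      \<comment> \<open>In degree 0 there is no deletion term. A constant on \<open>W\<close> that
        vanishes on the kernel is zero, since the kernel contains 0.\<close>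
      have "f = 0" if f: "f \<in> I_space l (insert x A) W i" "restr ?K f = 0" for f
      proof -
        have "f \<in> span {restr W (\<lambda>_. 1)}"
        proof -
          have "{restr W (\<lambda>v. \<Prod>f\<leftarrow>fs. f v) | fs. length fs = 0 \<and> (\<forall>f\<in>set fs. linear f)} \<subseteq> {restr W (\<lambda>_. 1)}"
            by auto
          then show ?thesis using f(1) 0 unfolding I_space_def hom_poly_def by (auto dest: span_mono)
        qed
        then obtain c where c: "f = c *\<^sub>R restr W (\<lambda>_. 1)" by (auto simp: span_singleton)
        have "f 0 = 0" using zero_on_K[OF f(2), of 0] subspace_0[OF insert(4)] linear_0[OF l] by auto
        then have "c = 0" using subspace_0[OF insert(4)] by (simp add: c fun_ops restr_apply)
        then show ?thesis by (simp add: c)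
      qed
      then show ?thesis by (intro exI[of _ "{}"]) (auto simp: 0)
    next
      case (Suc j)
      obtain T where T: "finite T" "int (card T) \<le> coeff (hilb_poly l A W) j" "I_space l A W j \<subseteq> span T"
        using insert(3)[OF insert(4-6), of j] by blast
      have "int (card ((\<lambda>g. l x * g) ` T)) \<le> coeff (hilb_poly l A W) j"
        using T(2) card_image_le[OF T(1), of "\<lambda>g. l x * g"] by linarith
      moreover have "{f \<in> I_space l (insert x A) W i. restr ?K f = 0} \<subseteq> span ((\<lambda>g. l x * g) ` T)"
      proof clarify
        fix f assume f: "f \<in> I_space l (insert x A) W i" "restr ?K f = 0"
        obtain g where "g \<in> I_space l A W j" "f = l x * g"
          using I_space_divide[where l = l, OF insert(1,2) l insert(4) e f(1)[unfolded Suc] zero_on_K[OF f(2)]] by blast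
        then show "f \<in> span ((\<lambda>g. l x * g) ` T)"
          using T(3) unfolding linear_span_image[OF linear_mult_left_fun] by blast
      qed
      ultimately show ?thesis using T(1) by (intro exI[of _ "(\<lambda>g. l x * g) ` T"]) (auto simp: Suc)
    qed
    then obtain T2 where T2: "finite T2" "int (card T2) \<le> coeff (pCons 0 (hilb_poly l A W)) i"
      "{f \<in> I_space l (insert x A) W i. restr ?K f = 0} \<subseteq> span T2" by blast
    obtain T where T: "finite T" "card T \<le> card T1 + card T2" "I_space l (insert x A) W i \<subseteq> span T"
      using finite_span_extension[OF linear_restr subspace_I_space T1(1) rI T2(1,3)] by blast
    have "\<exists>B2. finite B2 \<and> independent B2 \<and> coeff (pCons 0 (hilb_poly l A W)) i \<le> int (card B2) \<and>
        B2 \<subseteq> P_space l (insert x A) W i \<and> (\<forall>f\<in>B2. restr ?K f = 0)"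
    proof (cases i)
      case 0
      then show ?thesis by (intro exI[of _ "{}"]) (auto simp: independent_empty)
    next
      case (Suc j)
      obtain B where B: "finite B" "independent B" "coeff (hilb_poly l A W) j \<le> int (card B)" "B \<subseteq> P_space l A W j"
        using insert(3)[OF insert(4-6), of j] by blast
      have PH: "P_space l A W j \<subseteq> hom_poly j W"
        using P_space_subset_I_space[where l = l and i = j, OF insert(1) l insert(4)] by (auto simp: I_space_def)
      \<comment> \<open>Multiplication by a form that is nonzero on \<open>W\<close> is injective on
        homogeneous functions, so an independent set keeps both its independence and its
        size.\<close>
      have "inj_on (\<lambda>g. l x * g) (hom_poly j W)"
        unfolding linear_inj_on_iff_eq_0[OF linear_mult_left_fun subspace_hom_poly]
        using hom_poly_cancel_linear[OF _ insert(4) l[of x] e] by blast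
      moreover have "span B \<subseteq> hom_poly j W" using B(4) PH by (intro span_minimal[OF _ subspace_hom_poly]) auto
      ultimately have inj: "inj_on (\<lambda>g. l x * g) (span B)" by (rule inj_on_subset)
      have "independent ((\<lambda>g. l x * g) ` B)"
        using linear_independent_injective_image[OF linear_mult_left_fun B(2) inj] .
      moreover have "card ((\<lambda>g. l x * g) ` B) = card B"
        using inj span_superset by (intro card_image) (rule inj_on_subset)
      moreover have "(\<lambda>g. l x * g) ` B \<subseteq> P_space l (insert x A) W i"
        using P_space_mult[where l = l and W = W and i = j, OF insert(1,2)] B(4) Suc by blast
      moreover have "restr ?K (l x * g) = 0" for g
        by (auto simp: restr_def fun_eq_iff fun_ops)
      ultimately show ?thesis
        using B(1,3) by (intro exI[of _ "(\<lambda>g. l x * g) ` B"]) (auto simp: Suc)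
    qed
    then obtain B2 where B2: "finite B2" "independent B2" "coeff (pCons 0 (hilb_poly l A W)) i \<le> int (card B2)"
      "B2 \<subseteq> P_space l (insert x A) W i" "\<And>f. f \<in> B2 \<Longrightarrow> restr ?K f = 0" by blast
    obtain B where B: "finite B" "independent B" "card B = card B1 + card B2" "B \<subseteq> P_space l (insert x A) W i"
      using independent_extension[OF linear_restr subspace_P_space B1(1,2) rP B2(1,2,4,5)] by blast
    have "int (card T) \<le> coeff (hilb_poly l (insert x A) W) i" using T(2) T1(2) T2(2) unfolding h by simp
    moreover have "coeff (hilb_poly l (insert x A) W) i \<le> int (card B)" using B(3) B1(3) B2(3) unfolding h by simp
    ultimately show ?thesis using T B by blast
  qed
qed

text \<open>The gap closes: \<open>P\<close> contains \<open>B\<close> and lies in the span of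
  \<open>T\<close>, while \<open>card T\<close> is at most the coefficient and \<open>card B\<close>
  at least the coefficient.\<close>

theorem dim_P_space:
  fixes l :: "'i \<Rightarrow> 'v::real_vector \<Rightarrow> real"
  assumes A: "finite A" and l: "\<And>y. linear (l y)" and W: "subspace W" "finite F" "W \<subseteq> span F"
  shows "int (dim (P_space l A W i)) = coeff (hilb_poly l A W) i"
proof -
  obtain T B where T: "finite T" "int (card T) \<le> coeff (hilb_poly l A W) i" "I_space l A W i \<subseteq> span T"
    and B: "finite B" "independent B" "coeff (hilb_poly l A W) i \<le> int (card B)" "B \<subseteq> P_space l A W i"
    using hilb_poly_bounds[where l = l and i = i, OF assms] by blast
  have PT: "P_space l A W i \<subseteq> span T" using P_space_subset_I_space[where l = l, OF A l W(1)] T(3) by blast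
  then have "dim (P_space l A W i) \<le> card T" using T(1) by (rule real_vector.dim_le_card)
  moreover have "card B \<le> dim (P_space l A W i)"
  proof -
    obtain C where C: "B \<subseteq> C" "C \<subseteq> P_space l A W i" "independent C" "P_space l A W i \<subseteq> span C"
      using real_vector.maximal_independent_subset_extend[OF B(4,2)] by blast
    have "finite C" using independent_span_bound[OF T(1) C(3)] C(2) PT by blast
    then have "card B \<le> card C" using C(1) by (rule card_mono)
    then show ?thesis using real_vector.basis_card_eq_dim[OF C(2,4,3)] by simp
  qed
  ultimately show ?thesis using T(2) B(3) by linarith
qed

section \<open>Homomorphisms into divisible groups\<close>

definition fin_gen :: "'g::ab_group_add itself \<Rightarrow> bool" where
  "fin_gen _ \<longleftrightarrow> (\<exists>F :: 'g set. finite F \<and> zmod.span F = UNIV)"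

lemma additive_zscale:
  fixes f :: "'g::ab_group_add \<Rightarrow> 'v::real_vector"
  assumes "\<And>x y. f (x + y) = f x + f y"
  shows "f (zscale k x) = of_int k *\<^sub>R f x"
proof -
  interpret Modules.additive f using assms by unfold_locales
  have "(\<Sum>i<n. v) = of_nat n *\<^sub>R v" for n :: nat and v :: 'v by (simp add: sum_constant_scaleR)
  then show ?thesis unfolding zscale_def by (cases "k \<ge> 0") (simp_all add: diff sum minus)
qed

definition real_homs :: "('g::ab_group_add \<Rightarrow> real) set" where
  "real_homs = {h. Modules.additive h}"

lemma real_hom_add: "h \<in> real_homs \<Longrightarrow> h (x + y) = h x + h y"
  by (simp add: real_homs_def Modules.additive_def)

lemma real_hom_zscale: "h \<in> real_homs \<Longrightarrow> h (zscale k x) = of_int k * h x"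
  using additive_zscale[of h k x] real_hom_add[of h] by simp

lemma zscale_mem_imp_zero:
  assumes H: "zmod.subspace H" and none: "\<not> (\<exists>k>0. zscale (int k) x \<in> H)" and n: "zscale n x \<in> H"
  shows "n = 0"
proof (rule ccontr)
  assume n0: "n \<noteq> 0"
  have "zscale (- n) x \<in> H" using zmod.subspace_neg[OF H n] by (simp add: zmod.scale_minus_left)
  then have "zscale \<bar>n\<bar> x \<in> H" using n by (simp add: abs_if)
  then have "zscale (int (nat \<bar>n\<bar>)) x \<in> H" by simp
  moreover have "nat \<bar>n\<bar> > 0" using n0 by simp
  ultimately show False using none by blast
qed

text \<open>One extension argument for two targets: the circle for characters, and the positive
  reals, which stand for the additive reals by way of the logarithm. The existence of roots is the
  divisibility that makes extension possible.\<close>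

locale divisible_mult_group =
  fixes T :: "'c::field set"
  assumes one_closed: "1 \<in> T"
    and mult_closed: "\<And>a b. a \<in> T \<Longrightarrow> b \<in> T \<Longrightarrow> a * b \<in> T"
    and inverse_closed: "\<And>a. a \<in> T \<Longrightarrow> inverse a \<in> T"
    and nonzero: "0 \<notin> T"
    and root: "\<And>a n. a \<in> T \<Longrightarrow> n > 0 \<Longrightarrow> \<exists>z\<in>T. z ^ n = a"
begin

definition hom_on :: "'g::ab_group_add set \<Rightarrow> ('g \<Rightarrow> 'c) \<Rightarrow> bool" where
  "hom_on H f \<longleftrightarrow> (\<forall>x\<in>H. f x \<in> T) \<and> (\<forall>x\<in>H. \<forall>y\<in>H. f (x + y) = f x * f y)"

lemma power_closed: "a \<in> T \<Longrightarrow> a ^ n \<in> T"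
  by (induction n) (auto simp: one_closed mult_closed)

lemma powi_closed: "a \<in> T \<Longrightarrow> a powi n \<in> T"
  by (auto simp: power_int_def power_closed inverse_closed)

lemma hom_on_0:
  assumes "hom_on H f" "zmod.subspace H"
  shows "f 0 = 1"
proof -
  have "f 0 * f 0 = f 0" "f 0 \<noteq> 0"
    using assms zmod.subspace_0[OF assms(2)] nonzero unfolding hom_on_def by (metis add_0)+
  then show ?thesis by simp
qed

lemma hom_on_sum:
  assumes "hom_on H f" "zmod.subspace H" "x \<in> H"
  shows "f (\<Sum>i<n. x) = f x ^ n"
proof (induction n)
  case 0
  then show ?case using hom_on_0[OF assms(1,2)] by simp
next
  case (Suc n)
  have "(\<Sum>i<n. x) \<in> H" using assms by (auto intro: zmod.subspace_sum)
  then show ?case using Suc assms by (simp add: hom_on_def mult.commute)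
qed

lemma hom_on_diff:
  assumes "hom_on H f" "zmod.subspace H" "x \<in> H" "y \<in> H"
  shows "f (x - y) = f x / f y"
proof -
  have "f (x - y + y) = f (x - y) * f y"
    using assms zmod.subspace_diff[OF assms(2-4)] unfolding hom_on_def by blast
  moreover have "f y \<noteq> 0" using assms nonzero unfolding hom_on_def by metis
  ultimately show ?thesis by (simp add: field_simps)
qed

lemma hom_on_zscale:
  assumes "hom_on H f" "zmod.subspace H" "x \<in> H"
  shows "f (zscale n x) = f x powi n"
proof (cases "n \<ge> 0")
  case True
  then have "zscale n x = (\<Sum>i<nat n. x)" by (simp add: zscale_def)
  then show ?thesis using hom_on_sum[OF assms, of "nat n"] True by (simp add: power_int_def)
next
  case False
  then have "zscale n x = 0 - (\<Sum>i<nat (- n). x)" by (simp add: zscale_def)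
  moreover have "(\<Sum>i<nat (- n). x) \<in> H" using assms by (auto intro: zmod.subspace_sum)
  ultimately show ?thesis
    using hom_on_diff[OF assms(1,2) zmod.subspace_0[OF assms(2)], of "\<Sum>i<nat (- n). x"]
      hom_on_sum[OF assms, of "nat (- n)"] hom_on_0[OF assms(1,2)] False
    by (simp add: power_int_def divide_inverse power_inverse)
qed

text \<open>An element of the larger subgroup is an element of \<open>H\<close> plus
  \<open>zscale n x\<close>, with \<open>n\<close> determined up to integers \<open>k\<close> for
  which \<open>zscale k x\<close> lies in \<open>H\<close>. On those the assumption
  \<open>compat\<close> makes the two prescriptions agree.\<close>

lemma extend_step:
  assumes f: "hom_on H f" and H: "zmod.subspace H" and z: "z \<in> T"
    and compat: "\<And>n. zscale n x \<in> H \<Longrightarrow> f (zscale n x) = z powi n"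
  shows "\<exists>f'. hom_on (zmod.span (insert x H)) f' \<and> (\<forall>y\<in>H. f' y = f y) \<and> f' x = z"
proof -
  have z0: "z \<noteq> 0" using z nonzero by auto
  have mem: "y \<in> zmod.span (insert x H) \<longleftrightarrow> (\<exists>n. y - zscale n x \<in> H)" for y
    using H by (simp add: zmod.span_breakdown_eq zmod.span_eq_iff[THEN iffD2])
  define f' where "f' y = (let n = (SOME n. y - zscale n x \<in> H) in f (y - zscale n x) * z powi n)" for y
  have f': "f' y = f (y - zscale n x) * z powi n" if "y - zscale n x \<in> H" for y n
  proof -
    define m where "m = (SOME n. y - zscale n x \<in> H)"
    have m: "y - zscale m x \<in> H" unfolding m_def using that by (rule someI)
    have e: "zscale (n - m) x = (y - zscale m x) - (y - zscale n x)"
      by (simp add: zmod.scale_left_diff_distrib)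
    then have "zscale (n - m) x \<in> H" using zmod.subspace_diff[OF H m that] by simp
    then have "z powi (n - m) = f (y - zscale m x) / f (y - zscale n x)"
      using compat hom_on_diff[OF f H m that] e by metis
    moreover have "f (y - zscale n x) \<noteq> 0" using f that nonzero unfolding hom_on_def by metis
    ultimately have "f (y - zscale m x) = f (y - zscale n x) * z powi (n - m)" by simp
    then show ?thesis using z0 unfolding f'_def m_def[symmetric] Let_def
      by (simp add: power_int_diff)
  qed
  have "hom_on (zmod.span (insert x H)) f'"
    unfolding hom_on_def
  proof (intro conjI ballI)
    fix y assume "y \<in> zmod.span (insert x H)"
    then obtain n where n: "y - zscale n x \<in> H" using mem by blast
    then show "f' y \<in> T" using f z powi_closed mult_closed by (simp add: f'[OF n] hom_on_def)
  next
    fix y y' assume "y \<in> zmod.span (insert x H)" "y' \<in> zmod.span (insert x H)"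
    then obtain n n' where n: "y - zscale n x \<in> H" "y' - zscale n' x \<in> H" using mem by blast
    have e: "y + y' - zscale (n + n') x = (y - zscale n x) + (y' - zscale n' x)"
      by (simp add: zmod.scale_left_distrib)
    have "y + y' - zscale (n + n') x \<in> H" unfolding e by (rule zmod.subspace_add[OF H n])
    from f'[OF this] show "f' (y + y') = f' y * f' y'"
      using f n z0 unfolding e f'[OF n(1)] f'[OF n(2)] hom_on_def
      by (simp add: power_int_add)
  qed
  moreover have "f' y = f y" if "y \<in> H" for y using f'[of y 0] that by simp
  moreover have "f' x = z" using f'[of x 1] zmod.subspace_0[OF H] hom_on_0[OF f H] by simp
  ultimately show ?thesis by blast
qed

text \<open>Division with remainder: the remainder gives a smaller nonnegative multiple in
  \<open>H\<close>, which by minimality is the zeroth.\<close>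

lemma multiple_dvd:
  assumes H: "zmod.subspace H" and k: "k > 0" "zscale (int k) x \<in> H"
    and least: "\<And>j. j > 0 \<Longrightarrow> zscale (int j) x \<in> H \<Longrightarrow> k \<le> j" and n: "zscale n x \<in> H"
  shows "int k dvd n"
proof -
  have "zscale (n mod int k) x = zscale n x - zscale (n div int k) (zscale (int k) x)"
    by (simp add: minus_div_mult_eq_mod[symmetric] zmod.scale_left_diff_distrib)
  also have "\<dots> \<in> H" by (intro zmod.subspace_diff zmod.subspace_scale H k(2) n)
  finally have "zscale (int (nat (n mod int k))) x \<in> H" using k by simp
  moreover have "nat (n mod int k) < k" using k(1) by (simp add: nat_less_iff)
  ultimately have "\<not> nat (n mod int k) > 0"
    using least[of "nat (n mod int k)"] by (meson not_less)
  moreover have "n mod int k \<ge> 0" using k(1) by (intro pos_mod_sign) simp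
  ultimately have "n mod int k = 0" by linarith
  then show ?thesis by (simp add: dvd_eq_mod_eq_0)
qed

lemma hom_on_extend_one:
  assumes f: "hom_on H f" and H: "zmod.subspace H"
  shows "\<exists>f'. hom_on (zmod.span (insert x H)) f' \<and> (\<forall>y\<in>H. f' y = f y)"
proof -
  \<comment> \<open>The value at \<open>x\<close> is a k-th root of the value at the least positive
    multiple of \<open>x\<close> in \<open>H\<close>; if there is no such multiple, any value works
    and 1 is taken.\<close>
  have "\<exists>z\<in>T. \<forall>n. zscale n x \<in> H \<longrightarrow> f (zscale n x) = z powi n"
  proof (cases "\<exists>k>0. zscale (int k) x \<in> H")
    case True
    define k where "k = (LEAST k. k > 0 \<and> zscale (int k) x \<in> H)"
    have k: "k > 0" "zscale (int k) x \<in> H" using LeastI_ex[OF True] by (auto simp: k_def)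
    obtain z where z: "z \<in> T" "z ^ k = f (zscale (int k) x)"
      using root[OF _ k(1)] f k(2) unfolding hom_on_def by metis
    have "f (zscale n x) = z powi n" if n: "zscale n x \<in> H" for n
    proof -
      obtain m where m: "n = int k * m"
        using multiple_dvd[OF H k _ n] by (metis (mono_tags, lifting) Least_le k_def dvdE)
      have "zscale n x = zscale m (zscale (int k) x)" by (simp add: m mult.commute)
      then show ?thesis
        using hom_on_zscale[OF f H k(2), of m] z by (simp add: m power_int_mult)
    qed
    then show ?thesis using z(1) by blast
  next
    case False
    have "n = 0" if "zscale n x \<in> H" for n
      using zscale_mem_imp_zero[OF H False that] .
    then have "f (zscale n x) = 1 powi n" if "zscale n x \<in> H" for n
      using hom_on_0[OF f H] that by fastforce
    then show ?thesis using one_closed by blast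
  qed
  then show ?thesis using extend_step[OF f H, of _ x] by blast
qed

lemma hom_on_extend:
  assumes f: "hom_on H f" and H: "zmod.subspace H" and F: "finite F"
  shows "\<exists>f'. hom_on (zmod.span (F \<union> H)) f' \<and> (\<forall>y\<in>H. f' y = f y)"
  using F
proof (induction F rule: finite_induct)
  case empty
  then show ?case using f H by (metis sup_bot_left zmod.span_eq_iff)
next
  case (insert x F)
  then obtain f' where f': "hom_on (zmod.span (F \<union> H)) f'" "\<forall>y\<in>H. f' y = f y" by blast
  obtain f'' where f'': "hom_on (zmod.span (insert x (zmod.span (F \<union> H)))) f''"
    "\<forall>y\<in>zmod.span (F \<union> H). f'' y = f' y"
    using hom_on_extend_one[OF f'(1) zmod.subspace_span, of x] by blast
  have "zmod.span (insert x (zmod.span (F \<union> H))) = zmod.span (insert x F \<union> H)"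
    unfolding zmod.span_eq
    by (auto intro: zmod.span_base zmod.span_mono[THEN subsetD, rotated])
  moreover have "f'' y = f y" if "y \<in> H" for y
    using f''(2) f'(2) that zmod.span_base[of y "F \<union> H"] by auto
  ultimately show ?case using f''(1) by auto
qed

lemma hom_on_extend_UNIV:
  fixes f :: "'g::ab_group_add \<Rightarrow> 'c"
  assumes f: "hom_on H f" and H: "zmod.subspace H" and G: "fin_gen TYPE('g)"
  shows "\<exists>f'. hom_on UNIV f' \<and> (\<forall>y\<in>H. f' y = f y)"
proof -
  obtain F :: "'g set" where F: "finite F" "zmod.span F = UNIV" using G by (auto simp: fin_gen_def)
  have "zmod.span (F \<union> H) = UNIV" using F(2) zmod.span_mono[of F "F \<union> H"] by auto
  then show ?thesis using hom_on_extend[OF f H F(1)] by metis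
qed

end

interpretation pos: divisible_mult_group "{0<..} :: real set"
proof
  fix a :: real and n :: nat
  assume "a \<in> {0<..}" "n > 0"
  then show "\<exists>z\<in>{0<..}. z ^ n = a" by (intro bexI[of _ "root n a"]) auto
qed auto

interpretation circle: divisible_mult_group "sphere 0 1 :: complex set"
proof
  fix a :: complex and n :: nat
  assume a: "a \<in> sphere 0 1" and n: "n > 0"
  have "a \<noteq> 0" "norm a = 1" using a by auto
  then have "a = cis (Arg a)" by (simp add: cis_Arg sgn_eq)
  moreover have "cis (Arg a / n) ^ n = cis (Arg a)" using n by (simp add: Complex.DeMoivre)
  ultimately show "\<exists>z\<in>sphere 0 1. z ^ n = a" by (intro bexI[of _ "cis (Arg a / n)"]) auto
qed (auto simp: norm_mult norm_inverse)

text \<open>Start with the trivial homomorphism on \<open>K\<close> and the value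
  \<open>exp 1\<close> at \<open>x\<close>, which is free because no positive multiple of
  \<open>x\<close> lies in \<open>K\<close>. The logarithm of an extension to the whole group is the
  additive map.\<close>

lemma real_hom_exists:
  fixes x :: "'g::ab_group_add"
  assumes G: "fin_gen TYPE('g)" and K: "zmod.subspace K" and x: "\<And>k. k > 0 \<Longrightarrow> zscale k x \<notin> K"
  shows "\<exists>h :: 'g \<Rightarrow> real. h \<in> real_homs \<and> (\<forall>y\<in>K. h y = 0) \<and> h x = 1"
proof -
  have one: "pos.hom_on K (\<lambda>_. 1)" by (simp add: pos.hom_on_def)
  have "\<not> (\<exists>k>0. zscale (int k) x \<in> K)" using x by auto
  then have "n = 0" if "zscale n x \<in> K" for n
    using zscale_mem_imp_zero[OF K _ that] by blast
  then obtain f where f: "pos.hom_on (zmod.span (insert x K)) f" "\<forall>y\<in>K. f y = 1" "f x = exp 1"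
    using pos.extend_step[OF one K, of "exp 1" x] by force
  obtain g where g: "pos.hom_on UNIV g" "\<forall>y\<in>zmod.span (insert x K). g y = f y"
    using pos.hom_on_extend_UNIV[OF f(1) _ G] by auto
  have "g y > 0" for y using g(1) by (simp add: pos.hom_on_def)
  then have "g y \<noteq> 0" for y by (metis less_irrefl)
  then have "(\<lambda>y. ln (g y)) \<in> real_homs"
    using g(1) unfolding real_homs_def by (intro CollectI Modules.additive.intro) (simp add: pos.hom_on_def ln_mult)
  moreover have "ln (g y) = 0" if "y \<in> K" for y
    using that g(2) f(2) zmod.span_base[of y "insert x K"] by simp
  moreover have "ln (g x) = 1" using g(2) f(3) zmod.span_base[of x "insert x K"] by simp
  ultimately show ?thesis by (intro exI[of _ "\<lambda>y. ln (g y)"]) auto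
qed

lemma characters_hom_on: "characters = {\<phi>. circle.hom_on UNIV \<phi>}"
  by (auto simp: characters_def circle.hom_on_def)

lemma character_exists:
  fixes x :: "'g::ab_group_add"
  assumes G: "fin_gen TYPE('g)" and K: "zmod.subspace K" and x: "x \<notin> K"
  shows "\<exists>\<phi>\<in>characters. (\<forall>y\<in>K. \<phi> y = 1) \<and> \<phi> x \<noteq> 1"
proof -
  have one: "circle.hom_on K (\<lambda>_. 1)" by (simp add: circle.hom_on_def)
  \<comment> \<open>The value at \<open>x\<close> is a primitive root of unity whose order is the
    order of \<open>x\<close> modulo \<open>K\<close>, or -1 if that order is infinite.\<close>
  have "\<exists>z\<in>sphere (0::complex) 1. z \<noteq> 1 \<and> (\<forall>n. zscale n x \<in> K \<longrightarrow> 1 = z powi n)"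
  proof (cases "\<exists>k>0. zscale (int k) x \<in> K")
    case True
    define k where "k = (LEAST k. k > 0 \<and> zscale (int k) x \<in> K)"
    have k: "k > 0" "zscale (int k) x \<in> K" using LeastI_ex[OF True] by (auto simp: k_def)
    have "k \<noteq> 1" using k x by auto
    then have k1: "k > 1" using k by simp
    define z where "z = cis (2 * pi / k)"
    have z: "z ^ k = 1" using k by (simp add: z_def Complex.DeMoivre)
    have "z \<noteq> 1"
    proof
      assume "z = 1"
      then have "cos (2 * pi / k) = 1" by (metis z_def cis.simps(1) one_complex.simps(1))
      then obtain m :: int where m: "2 * pi / k = of_int m * 2 * pi"
        unfolding cos_one_2pi_int by blast
      then have "1 = of_int m * real k" using k by (simp add: field_simps)
      then have "of_int 1 = (of_int (m * int k) :: real)" by simp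
      then have "1 = m * int k" by (simp only: of_int_eq_iff)
      then have "int k dvd 1" by (metis dvd_triv_right)
      then show False using k1 by simp
    qed
    moreover have "1 = z powi n" if n: "zscale n x \<in> K" for n
    proof -
      obtain m where m: "n = int k * m"
        using circle.multiple_dvd[OF K k _ n] by (metis (mono_tags, lifting) Least_le k_def dvdE)
      then show ?thesis using z by (simp add: m power_int_mult)
    qed
    ultimately show ?thesis by (intro bexI[of _ z]) (auto simp: z_def)
  next
    case False
    have "n = 0" if "zscale n x \<in> K" for n
      using zscale_mem_imp_zero[OF K False that] .
    then have "1 = (-1 :: complex) powi n" if "zscale n x \<in> K" for n
      using that by fastforce
    then show ?thesis by (intro bexI[of _ "-1"]) auto
  qed
  then obtain z where z: "z \<in> sphere (0::complex) 1" "z \<noteq> 1" "\<And>n. zscale n x \<in> K \<Longrightarrow> 1 = z powi n" by blast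
  obtain f where f: "circle.hom_on (zmod.span (insert x K)) f" "\<forall>y\<in>K. f y = 1" "f x = z"
    using circle.extend_step[OF one K z(1,3)] by force
  obtain g where g: "circle.hom_on UNIV g" "\<forall>y\<in>zmod.span (insert x K). g y = f y"
    using circle.hom_on_extend_UNIV[OF f(1) _ G] by auto
  have "g y = 1" if "y \<in> K" for y
    using that g(2) f(2) zmod.span_base[of y "insert x K"] by simp
  moreover have "g x \<noteq> 1" using g(2) f(3) z(2) zmod.span_base[of x "insert x K"] by simp
  ultimately show ?thesis using g(1) by (auto simp: characters_hom_on)
qed

section \<open>Finite index, characters and rank\<close>

lemma coset_eq_iff:
  assumes K: "zmod.subspace K"
  shows "(+) x ` K = (+) y ` K \<longleftrightarrow> x - y \<in> K"
proof
  assume e: "(+) x ` K = (+) y ` K"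
  have "x + 0 \<in> (+) x ` K" using zmod.subspace_0[OF K] by blast
  then obtain k where "k \<in> K" "x = y + k" unfolding e by auto
  then show "x - y \<in> K" by simp
next
  assume xy: "x - y \<in> K"
  have sub: "(+) a ` K \<subseteq> (+) b ` K" if "a - b \<in> K" for a b
  proof clarify
    fix k assume "k \<in> K"
    then have "(a - b) + k \<in> K" using that zmod.subspace_add[OF K] by blast
    then show "a + k \<in> (+) b ` K" by (intro image_eqI[of _ _ "(a - b) + k"]) (auto simp: algebra_simps)
  qed
  have "y - x \<in> K" using zmod.subspace_neg[OF K xy] by simp
  then show "(+) x ` K = (+) y ` K" using sub[OF xy] sub[of y x] by blast
qed

text \<open>Pigeonhole: two different multiples of \<open>x\<close> lie in the same coset.\<close>

lemma finite_index_multiple: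
  assumes "finite_index UNIV K"
  shows "\<exists>k>0. zscale (int k) x \<in> K"
proof -
  have K: "zmod.subspace K" "finite (cosets UNIV K)" using assms by (auto simp: finite_index_def)
  have "\<not> inj (\<lambda>n::nat. (+) (zscale (int n) x) ` K)"
  proof
    assume "inj (\<lambda>n::nat. (+) (zscale (int n) x) ` K)"
    moreover have "range (\<lambda>n::nat. (+) (zscale (int n) x) ` K) \<subseteq> cosets UNIV K" by (auto simp: cosets_def)
    ultimately have "finite (UNIV :: nat set)" using K(2) inj_on_finite by blast
    then show False by simp
  qed
  then obtain m n :: nat where mn: "m \<noteq> n" "(+) (zscale (int m) x) ` K = (+) (zscale (int n) x) ` K"
    by (auto simp: inj_def)
  have "\<exists>k>0. zscale (int k) x \<in> K" if "a < b" "(+) (zscale (int a) x) ` K = (+) (zscale (int b) x) ` K" for a b :: nat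
  proof -
    have "zscale (int b) x - zscale (int a) x \<in> K" using that(2) coset_eq_iff[OF K(1)] by blast
    then have "zscale (int (b - a)) x \<in> K"
      using that(1) by (simp add: zmod.scale_left_diff_distrib[symmetric] of_nat_diff)
    then show ?thesis using that(1) by (metis zero_less_diff)
  qed
  then show ?thesis using mn by (metis nat_neq_iff)
qed

text \<open>Reducing the coefficient of each generator \<open>x\<close> modulo \<open>k x\<close>
  changes an element only within its coset, so finitely many residue vectors represent all
  cosets.\<close>

lemma finite_index_if_multiples:
  fixes K :: "'g::ab_group_add set"
  assumes G: "fin_gen TYPE('g)" and K: "zmod.subspace K" and m: "\<And>x. \<exists>k>0. zscale (int k) x \<in> K"
  shows "finite_index UNIV K"
proof -
  obtain F :: "'g set" where F: "finite F" "zmod.span F = UNIV" using G by (auto simp: fin_gen_def)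
  obtain k where k: "\<And>x. k x > 0 \<and> zscale (int (k x)) x \<in> K" using m by metis
  let ?P = "PiE F (\<lambda>x. {0..<int (k x)})"
  let ?C = "\<lambda>c. (+) (\<Sum>x\<in>F. zscale (c x) x) ` K"
  have "cosets UNIV K \<subseteq> ?C ` ?P"
    unfolding cosets_def
  proof clarify
    fix y :: 'g
    have "y \<in> zmod.span F" using F(2) by simp
    then obtain u where u: "y = (\<Sum>x\<in>F. zscale (u x) x)"
      unfolding zmod.span_finite[OF F(1)] by (rule rangeE)
    define c where "c = restrict (\<lambda>x. u x mod int (k x)) F"
    have "int (k x) > 0" for x using k[of x] by simp
    then have c: "c \<in> ?P" unfolding c_def restrict_PiE_iff by simp
    have "y - (\<Sum>x\<in>F. zscale (c x) x) = (\<Sum>x\<in>F. zscale (u x div int (k x)) (zscale (int (k x)) x))"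
      unfolding u sum_subtractf[symmetric]
    proof (rule sum.cong[OF refl])
      fix x assume "x \<in> F"
      then have "zscale (u x) x - zscale (c x) x = zscale (u x - u x mod int (k x)) x"
        by (simp add: c_def zmod.scale_left_diff_distrib)
      then show "zscale (u x) x - zscale (c x) x = zscale (u x div int (k x)) (zscale (int (k x)) x)"
        by (simp add: minus_mod_eq_div_mult)
    qed
    also have "\<dots> \<in> K" using k by (meson zmod.subspace_sum[OF K] zmod.subspace_scale[OF K])
    finally have "(+) y ` K = ?C c" using coset_eq_iff[OF K] by blast
    then show "(+) y ` K \<in> ?C ` ?P" using c by blast
  qed
  moreover have "finite (?C ` ?P)" using F(1) by (intro finite_imageI finite_PiE) auto
  ultimately have "finite (cosets UNIV K)" by (rule finite_subset)
  then show ?thesis using K by (simp add: finite_index_def)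
qed

lemma subspace_real_homs: "subspace (real_homs :: ('g::ab_group_add \<Rightarrow> real) set)"
  by (rule subspaceI) (auto simp: real_homs_def Modules.additive_def fun_ops algebra_simps)

lemma real_hom_sum: "h \<in> real_homs \<Longrightarrow> h (\<Sum>i\<in>I. f i) = (\<Sum>i\<in>I. h (f i))"
  by (simp add: real_homs_def Modules.additive.sum)

lemma real_hom_zero_on_span:
  assumes h: "h \<in> real_homs" and S: "\<And>x. x \<in> S \<Longrightarrow> h x = 0" and x: "x \<in> zmod.span S"
  shows "h x = 0"
  using x
proof (induction rule: zmod.span_induct_alt)
  case base
  then show ?case using h by (simp add: real_homs_def Modules.additive.zero)
next
  case (step c x y)
  then show ?case using S[of x] by (simp add: real_hom_add[OF h] real_hom_zscale[OF h])
qed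

text \<open>The dictionary between the group and linear forms. A real homomorphism that kills a
  positive multiple of \<open>y\<close> kills \<open>y\<close>; conversely, an element without
  positive multiples in the subgroup is detected by a homomorphism that kills the subgroup. Indices
  instead of elements keep repeated entries apart.\<close>

lemma finite_index_iff_separating:
  fixes x :: "'i \<Rightarrow> 'g::ab_group_add"
  assumes G: "fin_gen TYPE('g)"
  shows "finite_index UNIV (zmod.span (x ` S)) \<longleftrightarrow> separating (\<lambda>i h. h (x i)) S real_homs"
proof
  assume fi: "finite_index UNIV (zmod.span (x ` S))"
  show "separating (\<lambda>i h. h (x i)) S real_homs"
    unfolding separating_def
  proof (intro ballI impI ext)
    fix h :: "'g \<Rightarrow> real" and y assume h: "h \<in> real_homs" "\<forall>i\<in>S. h (x i) = 0"
    obtain k where k: "k > 0" "zscale (int k) y \<in> zmod.span (x ` S)" using finite_index_multiple[OF fi] by blast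
    have "h (zscale (int k) y) = 0" using h by (intro real_hom_zero_on_span[OF h(1) _ k(2)]) auto
    then show "h y = 0 y" using k(1) by (simp add: real_hom_zscale[OF h(1)] fun_ops)
  qed
next
  assume sep: "separating (\<lambda>i h. h (x i)) S real_homs"
  show "finite_index UNIV (zmod.span (x ` S))"
  proof (rule finite_index_if_multiples[OF G zmod.subspace_span], rule ccontr)
    fix y assume n: "\<not> (\<exists>k>0. zscale (int k) y \<in> zmod.span (x ` S))"
    have "zscale k y \<notin> zmod.span (x ` S)" if "k > 0" for k :: int
    proof
      assume "zscale k y \<in> zmod.span (x ` S)"
      then have "zscale (int (nat k)) y \<in> zmod.span (x ` S)" using that by simp
      moreover have "nat k > 0" using that by simp
      ultimately show False using n by blast
    qed
    then obtain h :: "'g \<Rightarrow> real" where h: "h \<in> real_homs" "\<forall>z\<in>zmod.span (x ` S). h z = 0" "h y = 1"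
      using real_hom_exists[OF G zmod.subspace_span, of y] by blast
    have "h (x i) = 0" if "i \<in> S" for i using h(2) that zmod.span_base by blast
    then have "h = 0" using sep h(1) unfolding separating_def by blast
    then show False using h(3) by (simp add: fun_ops)
  qed
qed

section \<open>Characters trivial on a subgroup of finite index\<close>

definition annihilator :: "'g::ab_group_add set \<Rightarrow> ('g \<Rightarrow> complex) set" where
  "annihilator K = {\<phi>\<in>characters. \<forall>x\<in>K. \<phi> x = 1}"

lemma character_add: "\<phi> \<in> characters \<Longrightarrow> \<phi> (x + y) = \<phi> x * \<phi> y"
  by (simp add: characters_def)

lemma character_nonzero: "\<phi> \<in> characters \<Longrightarrow> \<phi> x \<noteq> 0"
  by (auto simp: characters_def) (metis norm_zero zero_neq_one)

lemma character_zscale: "\<phi> \<in> characters \<Longrightarrow> \<phi> (zscale n x) = \<phi> x powi n"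
  using circle.hom_on_zscale[of UNIV \<phi> x n] by (simp add: characters_hom_on)

lemma annihilator_span: "annihilator (zmod.span S) = {\<phi>\<in>characters. \<forall>x\<in>S. \<phi> x = 1}"
proof -
  have "\<phi> x = 1" if "\<phi> \<in> characters" "\<forall>x\<in>S. \<phi> x = 1" "x \<in> zmod.span S" for \<phi> x
    using that(3)
  proof (induction rule: zmod.span_induct_alt)
    case base
    then show ?case using that(1) circle.hom_on_0[of UNIV \<phi>] by (simp add: characters_hom_on)
  next
    case (step c x y)
    then show ?case using that(1,2) by (simp add: character_add character_zscale)
  qed
  then show ?thesis by (auto simp: annihilator_def zmod.span_base)
qed

text \<open>Multiplication by \<psi> permutes \<Phi>, so the sum equals itself times
  \<open>\<psi> a\<close>, which is not 1.\<close>

lemma sum_annihilator: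
  assumes fin: "finite \<Phi>" and mult: "\<And>\<phi>. \<phi> \<in> \<Phi> \<Longrightarrow> (\<lambda>x. \<psi> x * \<phi> x) \<in> \<Phi>"
    and nz: "\<And>x. \<psi> x \<noteq> (0 :: complex)" and a: "\<psi> a \<noteq> 1"
  shows "(\<Sum>\<phi>\<in>\<Phi>. \<phi> a) = 0"
proof -
  let ?m = "\<lambda>\<phi> x. \<psi> x * \<phi> x"
  have inj: "inj_on ?m \<Phi>"
  proof (rule inj_onI, rule ext)
    fix \<phi> \<phi>' x assume "?m \<phi> = ?m \<phi>'"
    then show "\<phi> x = \<phi>' x" using nz[of x] by (metis mult_left_cancel)
  qed
  have im: "?m ` \<Phi> = \<Phi>"
    using endo_inj_surj[OF fin _ inj] mult by blast
  have "(\<Sum>\<phi>\<in>\<Phi>. \<phi> a) = (\<Sum>\<phi>\<in>?m ` \<Phi>. \<phi> a)" by (simp only: im)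
  also have "\<dots> = \<psi> a * (\<Sum>\<phi>\<in>\<Phi>. \<phi> a)"
    by (simp only: sum.reindex[OF inj] comp_def sum_distrib_left)
  finally have "(\<psi> a - 1) * (\<Sum>\<phi>\<in>\<Phi>. \<phi> a) = 0" by (simp add: algebra_simps)
  then show ?thesis using a by simp
qed

text \<open>Both orthogonality relations, read off from one double sum.\<close>

theorem card_annihilator:
  fixes K :: "'g::ab_group_add set"
  assumes G: "fin_gen TYPE('g)" and fi: "finite_index UNIV K"
  shows "finite (annihilator K)" "card (annihilator K) = card (cosets UNIV K)"
proof -
  have K: "zmod.subspace K" "finite (cosets UNIV K)" using fi by (auto simp: finite_index_def)
  \<comment> \<open>Coset representatives take the place of the quotient group: a character trivial
    on \<open>K\<close> has the same value at \<open>x\<close> and at \<open>rep x\<close>.\<close>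
  define rep where "rep x = (SOME y. y \<in> (+) x ` K)" for x
  have rep_mem: "rep x - x \<in> K" for x
  proof -
    have "x + 0 \<in> (+) x ` K" using zmod.subspace_0[OF K(1)] by blast
    then have "rep x \<in> (+) x ` K" unfolding rep_def by (rule someI)
    then show ?thesis by auto
  qed
  have rep_eq: "rep x = rep y" if "x - y \<in> K" for x y
    using coset_eq_iff[OF K(1), of x y] that by (simp add: rep_def)
  have rep_eq_iff: "rep x = rep y \<longleftrightarrow> x - y \<in> K" for x y
  proof
    assume e: "rep x = rep y"
    have "(rep y - y) - (rep x - x) \<in> K" using rep_mem zmod.subspace_diff[OF K(1)] by blast
    then show "x - y \<in> K" using e by simp
  qed (rule rep_eq)
  have rep_rep: "rep (rep x) = rep x" for x using rep_eq_iff rep_mem by blast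
  let ?R = "range rep"
  have "?R = (\<lambda>C. SOME y. y \<in> C) ` cosets UNIV K"
    by (auto simp: rep_def cosets_def image_image)
  then have finR: "finite ?R" using K(2) by simp
  have cardR: "card ?R = card (cosets UNIV K)"
  proof (rule bij_betw_same_card[of "\<lambda>r. (+) r ` K"], rule bij_betw_imageI)
    show "inj_on (\<lambda>r. (+) r ` K) ?R"
      using coset_eq_iff[OF K(1)] rep_eq_iff rep_rep by (auto intro!: inj_onI) metis
    show "(\<lambda>r. (+) r ` K) ` ?R = cosets UNIV K"
      unfolding cosets_def
      using coset_eq_iff[OF K(1)] rep_mem by (auto simp: image_image image_iff) metis+
  qed
  have char_rep: "\<phi> (rep x) = \<phi> x" if "\<phi> \<in> annihilator K" for \<phi> x
  proof -
    have "\<phi> ((rep x - x) + x) = \<phi> (rep x - x) * \<phi> x"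
      using that by (intro character_add) (simp add: annihilator_def)
    then show ?thesis using that rep_mem by (simp add: annihilator_def)
  qed
  show fin: "finite (annihilator K)"
  proof -
    obtain k where k: "\<And>x. k x > 0 \<and> zscale (int (k x)) x \<in> K"
      using finite_index_multiple[OF fi] by metis
    let ?P = "PiE ?R (\<lambda>x. {z::complex. z ^ k x = 1})"
    \<comment> \<open>The value at \<open>x\<close> is a root of unity of order dividing
      \<open>k x\<close>, and the values at the finitely many representatives determine the
      character.\<close>
    have "finite ?P" using finR k by (intro finite_PiE finite_roots_unity) (auto simp: Suc_le_eq)
    moreover have "(\<lambda>\<phi>. restrict \<phi> ?R) ` annihilator K \<subseteq> ?P"
    proof clarify
      fix \<phi> assume p: "\<phi> \<in> annihilator K"
      have "\<phi> x ^ k x = 1" for x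
      proof -
        have "\<phi> (zscale (int (k x)) x) = \<phi> x powi int (k x)"
          using p by (intro character_zscale) (simp add: annihilator_def)
        then show ?thesis using p k by (simp add: annihilator_def)
      qed
      then show "restrict \<phi> ?R \<in> ?P" unfolding restrict_PiE_iff by simp
    qed
    moreover have "inj_on (\<lambda>\<phi>. restrict \<phi> ?R) (annihilator K)"
    proof (rule inj_onI, rule ext)
      fix \<phi> \<psi> x assume p: "\<phi> \<in> annihilator K" "\<psi> \<in> annihilator K" "restrict \<phi> ?R = restrict \<psi> ?R"
      have "\<phi> (rep x) = \<psi> (rep x)" using fun_cong[OF p(3), of "rep x"] by simp
      then show "\<phi> x = \<psi> x" using char_rep[OF p(1)] char_rep[OF p(2)] by simp
    qed
    ultimately show ?thesis using inj_on_finite by blast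
  qed
  have row: "(\<Sum>r\<in>?R. \<phi> r) = (if \<phi> = (\<lambda>_. 1) then of_nat (card ?R) else 0)" if p: "\<phi> \<in> annihilator K" for \<phi>
  proof (cases "\<phi> = (\<lambda>_. 1)")
    case True
    then show ?thesis by simp
  next
    case False
    then obtain a where a: "\<phi> a \<noteq> 1" by auto
    \<comment> \<open>Translation by \<open>a\<close> permutes the representatives, so the sum over
      them equals itself times \<open>\<phi> a\<close>.\<close>
    let ?t = "\<lambda>r. rep (r + a)"
    have inj: "inj_on ?t ?R"
    proof (rule inj_onI)
      fix r s assume rs: "r \<in> ?R" "s \<in> ?R" "rep (r + a) = rep (s + a)"
      then have "rep r = rep s" using rep_eq_iff by simp
      then show "r = s" using rs(1,2) rep_rep by auto
    qed
    have im: "?t ` ?R = ?R" using endo_inj_surj[OF finR _ inj] by blast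
    have "(\<Sum>r\<in>?R. \<phi> r) = (\<Sum>r\<in>?t ` ?R. \<phi> r)" by (simp only: im)
    also have "\<dots> = (\<Sum>r\<in>?R. \<phi> (rep (r + a)))" by (simp only: sum.reindex[OF inj] comp_def)
    also have "\<dots> = (\<Sum>r\<in>?R. \<phi> r) * \<phi> a"
      using p by (simp add: char_rep[OF p] character_add annihilator_def sum_distrib_right)
    finally have "(\<Sum>r\<in>?R. \<phi> r) * (\<phi> a - 1) = 0" by (simp add: algebra_simps)
    then show ?thesis using a False by simp
  qed
  have col: "(\<Sum>\<phi>\<in>annihilator K. \<phi> r) = (if r = rep 0 then of_nat (card (annihilator K)) else 0)" if r: "r \<in> ?R" for r
  proof (cases "r = rep 0")
    case True
    then have "r \<in> K" using rep_mem[of 0] by simp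
    then show ?thesis using True by (simp add: annihilator_def)
  next
    case False
    have "r \<notin> K"
    proof
      assume "r \<in> K"
      then have "rep r = rep 0" using rep_eq_iff by simp
      then show False using False r rep_rep by auto
    qed
    then obtain \<psi> where psi: "\<psi> \<in> characters" "\<forall>y\<in>K. \<psi> y = 1" "\<psi> r \<noteq> 1"
      using character_exists[OF G K(1)] by blast
    have "(\<Sum>\<phi>\<in>annihilator K. \<phi> r) = 0"
    proof (rule sum_annihilator[where \<psi> = \<psi>, OF fin])
      fix \<phi> assume "\<phi> \<in> annihilator K"
      then show "(\<lambda>x. \<psi> x * \<phi> x) \<in> annihilator K"
        using psi(1,2) by (simp add: annihilator_def characters_def norm_mult)
    qed (use psi(3) character_nonzero[OF psi(1)] in auto)
    then show ?thesis using False by simp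
  qed
  have triv: "(\<lambda>_. 1) \<in> annihilator K" by (simp add: annihilator_def characters_def)
  have "of_nat (card ?R) = (\<Sum>\<phi>\<in>annihilator K. \<Sum>r\<in>?R. \<phi> r)"
    using fin triv by (simp add: row sum.delta cong: sum.cong)
  also have "\<dots> = (\<Sum>r\<in>?R. \<Sum>\<phi>\<in>annihilator K. \<phi> r)" by (rule sum.swap)
  also have "\<dots> = of_nat (card (annihilator K))"
    using finR by (simp add: col sum.delta cong: sum.cong)
  finally have "card ?R = card (annihilator K)" by (simp only: of_nat_eq_iff)
  then show "card (annihilator K) = card (cosets UNIV K)" using cardR by simp
qed

section \<open>Rank over the integers and the dimension of Hom(G, R)\<close>

lemma linear_eval: "linear (\<lambda>h :: 'a \<Rightarrow> real. h x)"
  by (rule linearI) (simp_all add: fun_ops)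

lemma generators_separate:
  assumes "zmod.span F = UNIV"
  shows "separating (\<lambda>x h. h x) F real_homs"
  unfolding separating_def
proof (intro ballI impI ext)
  fix h :: "'a \<Rightarrow> real" and x assume h: "h \<in> real_homs" "\<forall>x\<in>F. h x = 0"
  have "x \<in> zmod.span F" using assms by simp
  then show "h x = 0 x" using real_hom_zero_on_span[OF h(1), of F x] h(2) by (simp add: fun_ops)
qed

lemma real_homs_finite_dim:
  assumes "fin_gen TYPE('g::ab_group_add)"
  shows "\<exists>F. finite F \<and> (real_homs :: ('g \<Rightarrow> real) set) \<subseteq> span F"
proof -
  obtain F :: "'g set" where F: "finite F" "zmod.span F = UNIV" using assms by (auto simp: fin_gen_def)
  show ?thesis
    by (rule separating_finite_dim[OF subspace_real_homs F(1) generators_separate[OF F(2)] linear_eval])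
qed

text \<open>By independence no positive multiple of \<open>b\<close> lies in the span of the other
  elements, so some homomorphism kills these and is 1 at \<open>b\<close>.\<close>

lemma dual_basis_exists:
  fixes B :: "'g::ab_group_add set"
  assumes G: "fin_gen TYPE('g)" and B: "finite B" "zmod.independent B"
  shows "\<exists>e :: 'g \<Rightarrow> 'g \<Rightarrow> real. \<forall>b\<in>B. e b \<in> real_homs \<and> (\<forall>c\<in>B. e b c = (if b = c then 1 else 0))"
proof -
  have "\<exists>h :: 'g \<Rightarrow> real. h \<in> real_homs \<and> (\<forall>c\<in>B. h c = (if b = c then 1 else 0))" if b: "b \<in> B" for b
  proof -
    let ?K = "zmod.span (B - {b})"
    have "zscale k b \<notin> ?K" if k: "k > 0" for k :: int
    proof
      assume "zscale k b \<in> ?K"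
      then obtain u where u: "zscale k b = (\<Sum>c\<in>B - {b}. zscale (u c) c)"
        using zmod.span_finite[of "B - {b}"] B(1) by auto
      have "(\<Sum>c\<in>B. zscale ((u(b := - k)) c) c) = zscale (- k) b + (\<Sum>c\<in>B - {b}. zscale ((u(b := - k)) c) c)"
        using sum.remove[OF B(1) b, of "\<lambda>c. zscale ((u(b := - k)) c) c"] by simp
      also have "(\<Sum>c\<in>B - {b}. zscale ((u(b := - k)) c) c) = (\<Sum>c\<in>B - {b}. zscale (u c) c)"
        by (rule sum.cong) auto
      finally have "(\<Sum>c\<in>B. zscale ((u(b := - k)) c) c) = 0"
        unfolding u[symmetric] by (simp add: zmod.scale_minus_left)
      from zmod.independentD[OF B(2,1) subset_refl this b] show False using k by simp
    qed
    then obtain h :: "'g \<Rightarrow> real" where h: "h \<in> real_homs" "\<forall>y\<in>?K. h y = 0" "h b = 1"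
      using real_hom_exists[OF G zmod.subspace_span, of b] by blast
    have "h c = (if b = c then 1 else 0)" if "c \<in> B" for c
      using h(2,3) that zmod.span_base[of c "B - {b}"] by auto
    then show ?thesis using h(1) by blast
  qed
  then have "\<forall>b\<in>B. \<exists>h :: 'g \<Rightarrow> real. h \<in> real_homs \<and> (\<forall>c\<in>B. h c = (if b = c then 1 else 0))" by blast
  from bchoice[OF this] show ?thesis .
qed

text \<open>The dual family is linearly independent. The resulting uniform bound gives the
  \<open>GREATEST\<close> in \<open>zrank\<close> its meaning.\<close>

lemma independent_card_le_dim_real_homs:
  fixes B :: "'g::ab_group_add set"
  assumes G: "fin_gen TYPE('g)" and B: "finite B" "zmod.independent B"
  shows "card B \<le> dim (real_homs :: ('g \<Rightarrow> real) set)"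
proof -
  obtain e :: "'g \<Rightarrow> 'g \<Rightarrow> real" where e: "\<And>b. b \<in> B \<Longrightarrow> e b \<in> real_homs"
    "\<And>b c. b \<in> B \<Longrightarrow> c \<in> B \<Longrightarrow> e b c = (if b = c then 1 else 0)"
    using dual_basis_exists[OF assms] by blast
  have inj: "inj_on e B"
  proof (rule inj_onI)
    fix b c assume bc: "b \<in> B" "c \<in> B" "e b = e c"
    then have "e c b = 1" using e(2)[of b b] by simp
    then show "b = c" using e(2)[OF bc(2,1)] by (auto split: if_splits)
  qed
  have "independent (e ` B)"
  proof (rule ccontr)
    assume "\<not> independent (e ` B)"
    then obtain u v where s: "(\<Sum>f\<in>e ` B. u f *\<^sub>R f) = 0" and v: "v \<in> e ` B" "u v \<noteq> 0"
      using dependent_finite[OF finite_imageI[OF B(1), of e]] by blast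
    obtain b where b: "b \<in> B" "v = e b" using v(1) by blast
    have ev: "sum f B x = (\<Sum>c\<in>B. f c x)" for f :: "'g \<Rightarrow> 'g \<Rightarrow> real" and x
      by (induction B rule: infinite_finite_induct) (simp_all add: fun_ops)
    have "0 = (\<Sum>c\<in>B. u (e c) *\<^sub>R e c) b" using s by (simp add: sum.reindex[OF inj] fun_ops)
    also have "\<dots> = (\<Sum>c\<in>B. u (e c) * e c b)" by (simp add: ev fun_ops)
    also have "\<dots> = (\<Sum>c\<in>B. if c = b then u (e c) else 0)"
      using e(2) b(1) by (intro sum.cong) auto
    also have "\<dots> = u (e b)" using B(1) b(1) by simp
    finally show False using v(2) b(2) by simp
  qed
  obtain F where F: "finite F" "(real_homs :: ('g \<Rightarrow> real) set) \<subseteq> span F"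
    using real_homs_finite_dim[OF G] by blast
  have eB: "e ` B \<subseteq> real_homs" using e(1) by blast
  obtain C where C: "e ` B \<subseteq> C" "C \<subseteq> real_homs" "independent C" "real_homs \<subseteq> span C"
    using real_vector.maximal_independent_subset_extend[OF eB \<open>independent (e ` B)\<close>] by blast
  have "finite C" using independent_span_bound[OF F(1) C(3)] C(2) F(2) by blast
  then have "card (e ` B) \<le> card C" using C(1) by (rule card_mono)
  then show ?thesis
    using real_vector.basis_card_eq_dim[OF C(2,4,3)] by (simp add: card_image[OF inj])
qed

lemma zrank_props:
  fixes H :: "'g::ab_group_add set"
  assumes G: "fin_gen TYPE('g)"
  shows "\<exists>B\<subseteq>H. finite B \<and> zmod.independent B \<and> card B = zrank H"
    and "\<And>B. B \<subseteq> H \<Longrightarrow> finite B \<Longrightarrow> zmod.independent B \<Longrightarrow> card B \<le> zrank H"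
proof -
  let ?P = "\<lambda>n. \<exists>B\<subseteq>H. finite B \<and> zmod.independent B \<and> card B = n"
  have bound: "n \<le> dim (real_homs :: ('g \<Rightarrow> real) set)" if "?P n" for n
    using that independent_card_le_dim_real_homs[OF G] by blast
  have "?P 0" using zmod.independent_empty by (intro exI[of _ "{}"]) simp
  then have "?P (zrank H)" unfolding zrank_def by (rule GreatestI_nat) (use bound in blast)
  then show "\<exists>B\<subseteq>H. finite B \<and> zmod.independent B \<and> card B = zrank H" .
  fix B assume "B \<subseteq> H" "finite B" "zmod.independent B"
  then have "?P (card B)" by blast
  then show "card B \<le> zrank H" unfolding zrank_def by (rule Greatest_le_nat) (use bound in blast)
qed

text \<open>Otherwise \<open>x\<close> could be adjoined to \<open>B\<close>: in any relation the
  coefficient of \<open>x\<close> yields a multiple of \<open>x\<close> in the span, hence is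
  zero.\<close>

lemma maximal_independent_multiple:
  fixes B :: "'g::ab_group_add set"
  assumes G: "fin_gen TYPE('g)" and B: "finite B" "zmod.independent B" "card B \<ge> zrank (UNIV :: 'g set)"
  shows "\<exists>k>0. zscale (int k) x \<in> zmod.span B"
proof (rule ccontr)
  assume no: "\<not> (\<exists>k>0. zscale (int k) x \<in> zmod.span B)"
  have x: "x \<notin> B"
  proof
    assume "x \<in> B"
    then have "zscale (int 1) x \<in> zmod.span B" by (simp add: zmod.span_base)
    then show False using no by (metis zero_less_one)
  qed
  have "zmod.independent (insert x B)"
  proof (rule ccontr)
    assume "\<not> zmod.independent (insert x B)"
    then obtain u where u: "\<exists>v\<in>insert x B. u v \<noteq> 0" "(\<Sum>v\<in>insert x B. zscale (u v) v) = 0"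
      using zmod.dependent_finite[of "insert x B"] B(1) by auto
    have s: "zscale (u x) x + (\<Sum>v\<in>B. zscale (u v) v) = 0" using u(2) B(1) x by simp
    have "(\<Sum>v\<in>B. zscale (u v) v) \<in> zmod.span B"
      by (intro zmod.span_sum zmod.span_scale zmod.span_base)
    then have "zscale (u x) x \<in> zmod.span B"
      using s by (metis add_eq_0_iff2 zmod.span_neg)
    then have ux: "u x = 0" using zscale_mem_imp_zero[OF zmod.subspace_span no] by blast
    then have "(\<Sum>v\<in>B. zscale (u v) v) = 0" using s by simp
    then have "u v = 0" if "v \<in> B" for v
      using zmod.independentD[OF B(2,1) subset_refl _ that] by blast
    then show False using u(1) ux by blast
  qed
  then have "card (insert x B) \<le> zrank (UNIV :: 'g set)"
    using B(1) by (intro zrank_props(2)[OF G]) auto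
  then show False using B(1,3) x by simp
qed

text \<open>If the ranks agree, a maximal independent subset of \<open>K\<close> is already maximal
  in the whole group, and every element has a positive multiple in its span.\<close>

lemma zrank_eq_iff_finite_index:
  fixes K :: "'g::ab_group_add set"
  assumes G: "fin_gen TYPE('g)" and K: "zmod.subspace K"
  shows "zrank K \<le> zrank (UNIV :: 'g set)"
    and "zrank (UNIV :: 'g set) \<le> zrank K \<longleftrightarrow> finite_index UNIV K"
proof -
  show le: "zrank K \<le> zrank (UNIV :: 'g set)"
    using zrank_props(1)[OF G, of K] zrank_props(2)[OF G, of _ UNIV] by (metis subset_UNIV)
  show "zrank (UNIV :: 'g set) \<le> zrank K \<longleftrightarrow> finite_index UNIV K"
  proof
    assume r: "zrank (UNIV :: 'g set) \<le> zrank K"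
    obtain B where B: "B \<subseteq> K" "finite B" "zmod.independent B" "card B = zrank K"
      using zrank_props(1)[OF G, of K] by blast
    have "zmod.span B \<subseteq> K" by (rule zmod.span_minimal[OF B(1) K])
    moreover have "\<exists>k>0. zscale (int k) x \<in> zmod.span B" for x
      using maximal_independent_multiple[OF G B(2,3)] r B(4) by simp
    ultimately show "finite_index UNIV K" by (intro finite_index_if_multiples[OF G K]) blast
  next
    assume fi: "finite_index UNIV K"
    obtain B :: "'g set" where B: "finite B" "zmod.independent B" "card B = zrank (UNIV :: 'g set)"
      using zrank_props(1)[OF G, of UNIV] by blast
    obtain k where k: "\<And>x. k x > 0" "\<And>x. zscale (int (k x)) x \<in> K"
      using finite_index_multiple[OF fi] by metis
    \<comment> \<open>For the converse, positive multiples push a maximal independent set of the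
      whole group into \<open>K\<close> without creating relations.\<close>
    define m where "m x = zscale (int (k x)) x" for x
    have ind: "u b = 0" if "(\<Sum>b\<in>B. zscale (u b) (m b)) = 0" "b \<in> B" for u b
    proof -
      have "(\<Sum>b\<in>B. zscale (u b * int (k b)) b) = 0" using that(1) by (simp add: m_def)
      from zmod.independentD[OF B(2,1) subset_refl this that(2)] show ?thesis using k(1)[of b] by simp
    qed
    have inj: "inj_on m B"
    proof (rule inj_onI, rule ccontr)
      fix a b assume ab: "a \<in> B" "b \<in> B" "m a = m b" "a \<noteq> b"
      define u where "u c = (if c = a then 1 else if c = b then -1 else 0 :: int)" for c
      have "(\<Sum>c\<in>B. zscale (u c) (m c)) = (\<Sum>c\<in>{a, b}. zscale (u c) (m c))"
        using ab B(1) by (intro sum.mono_neutral_right) (auto simp: u_def)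
      also have "\<dots> = 0" using ab by (simp add: u_def zmod.scale_minus_left)
      finally have "u a = 0" using ind ab(1) by blast
      then show False by (simp add: u_def)
    qed
    have "zmod.independent (m ` B)"
    proof (rule ccontr)
      assume "\<not> zmod.independent (m ` B)"
      then obtain u where u: "\<exists>v\<in>m ` B. u v \<noteq> 0" "(\<Sum>v\<in>m ` B. zscale (u v) v) = 0"
        using zmod.dependent_finite[of "m ` B"] B(1) by auto
      have "(\<Sum>b\<in>B. zscale (u (m b)) (m b)) = 0" using u(2) by (simp add: sum.reindex[OF inj])
      from ind[of "\<lambda>b. u (m b)", OF this] show False using u(1) by blast
    qed
    moreover have "m ` B \<subseteq> K" using k(2) by (auto simp: m_def)
    ultimately have "card (m ` B) \<le> zrank K" using B(1) by (intro zrank_props(2)[OF G]) auto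
    then show "zrank (UNIV :: 'g set) \<le> zrank K" using B(3) by (simp add: card_image[OF inj])
  qed
qed

text \<open>A maximal independent set separates the homomorphisms, which bounds the dimension from
  above; its dual family bounds it from below.\<close>

lemma dim_real_homs:
  assumes G: "fin_gen TYPE('g::ab_group_add)"
  shows "dim (real_homs :: ('g \<Rightarrow> real) set) = zrank (UNIV :: 'g set)"
proof -
  obtain B :: "'g set" where B: "finite B" "zmod.independent B" "card B = zrank (UNIV :: 'g set)"
    using zrank_props(1)[OF G, of UNIV] by blast
  have "finite_index UNIV (zmod.span B)"
    using maximal_independent_multiple[OF G B(1,2)] B(3)
    by (intro finite_index_if_multiples[OF G zmod.subspace_span]) simp
  then have "separating (\<lambda>x h. h x) B real_homs"
    using finite_index_iff_separating[OF G, of "\<lambda>x. x" B] by simp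
  then have "dim (real_homs :: ('g \<Rightarrow> real) set) \<le> card B"
    by (rule separating_dim_le[OF subspace_real_homs B(1) _ linear_eval])
  then show ?thesis using independent_card_le_dim_real_homs[OF G B(1,2)] B(3) by simp
qed

text \<open>When the generated subgroup has finite index, its saturation is the whole group.\<close>

lemma arith_mult_finite_index:
  assumes "finite_index UNIV (zmod.span S)"
  shows "arith_mult S = card (cosets UNIV (zmod.span S))"
proof -
  have "saturation S = UNIV"
    unfolding saturation_def by (rule Greatest_equality) (use assms in auto)
  then show ?thesis by (simp add: arith_mult_def)
qed

section \<open>The symmetric algebra as polynomial functions\<close>

definition frag_eval :: "('a \<Rightarrow> real) \<Rightarrow> ('a \<Rightarrow>\<^sub>0 int) \<Rightarrow> real" where
  "frag_eval g a = (\<Sum>z\<in>Poly_Mapping.keys a. of_int (Poly_Mapping.lookup a z) * g z)"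

lemma frag_eval_superset:
  assumes "finite S" "Poly_Mapping.keys a \<subseteq> S"
  shows "frag_eval g a = (\<Sum>z\<in>S. of_int (Poly_Mapping.lookup a z) * g z)"
  unfolding frag_eval_def using assms by (intro sum.mono_neutral_left) (auto simp: in_keys_iff)

lemma frag_eval_diff: "frag_eval g (a - b) = frag_eval g a - frag_eval g b"
proof -
  let ?S = "Poly_Mapping.keys a \<union> Poly_Mapping.keys b"
  have "Poly_Mapping.keys (a - b) \<subseteq> ?S" by (rule keys_diff)
  then show ?thesis
    by (simp add: frag_eval_superset[of ?S] lookup_minus left_diff_distrib sum_subtractf)
qed

lemma frag_eval_0: "frag_eval g 0 = 0"
  by (simp add: frag_eval_def)

lemma frag_eval_add: "frag_eval g (a + b) = frag_eval g a + frag_eval g b"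
  using frag_eval_diff[of g a "0 - b"] frag_eval_diff[of g 0 b] by (simp add: frag_eval_0)

lemma frag_eval_of: "frag_eval g (frag_of z) = g z"
  by (simp add: frag_eval_def)

lemma frag_eval_extend:
  "frag_eval g (frag_extend f a) = frag_eval (\<lambda>z. frag_eval g (f z)) a"
  by (rule frag_induction[of a UNIV]) (auto simp: frag_eval_0 frag_eval_of frag_extend_diff frag_eval_diff)

lemma frag_eval_scale: "frag_eval (\<lambda>z. r * g z) a = r * frag_eval g a"
  unfolding frag_eval_def sum_distrib_left by (intro sum.cong) auto

lemma real_homs_0: "0 \<in> real_homs"
  by (rule subspace_0[OF subspace_real_homs])

text \<open>Outside the homomorphisms the functional is junk (zero), so that the lifting is total.\<close>

lift_definition tensor_eval :: "('g::ab_group_add \<Rightarrow> real) \<Rightarrow> 'g tensor_real \<Rightarrow> real"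
  is "\<lambda>h a. if h \<in> real_homs then frag_eval (\<lambda>(x, r). h x * r) a else 0"
proof -
  fix h :: "'g \<Rightarrow> real" and a b :: "('g \<times> real) \<Rightarrow>\<^sub>0 int"
  assume "tensor_rel a b"
  then have ab: "a - b \<in> zmod.span tensor_relations" by (simp add: tensor_rel_def)
  have "frag_eval (\<lambda>(x, r). h x * r) c = 0" if h: "h \<in> real_homs" and c: "c \<in> zmod.span tensor_relations" for c
    using c
  proof (induction rule: zmod.span_induct_alt)
    case base
    then show ?case by (simp add: frag_eval_0)
  next
    case (step k x y)
    have "frag_eval (\<lambda>(x, r). h x * r) x = 0"
      using step(1) unfolding tensor_relations_def
      by (elim UnE CollectE exE conjE; hypsubst)
        (simp_all add: frag_eval_diff frag_eval_of real_hom_add[OF h] distrib_left distrib_right)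
    moreover have "frag_eval g (zscale k x) = of_int k *\<^sub>R frag_eval g x" for g
      by (rule additive_zscale) (rule frag_eval_add)
    ultimately show ?case using step(2) by (simp add: frag_eval_add)
  qed
  from this[OF _ ab] show "(if h \<in> real_homs then frag_eval (\<lambda>(x, r). h x * r) a else 0)
      = (if h \<in> real_homs then frag_eval (\<lambda>(x, r). h x * r) b else 0)"
    by (simp add: frag_eval_diff)
qed

lemma tensor_eval_add: "tensor_eval h (u + v) = tensor_eval h u + tensor_eval h v"
  by transfer (simp add: frag_eval_add)

lemma tensor_eval_scaleR: "tensor_eval h (r *\<^sub>R u) = r * tensor_eval h u"
proof transfer
  fix h :: "'a \<Rightarrow> real" and r and a :: "('a \<times> real) \<Rightarrow>\<^sub>0 int"
  have "(\<lambda>z. frag_eval (\<lambda>(x, r). h x * r) ((\<lambda>(x, s). frag_of (x, r * s)) z)) = (\<lambda>z. r * (\<lambda>(x, s). h x * s) z)"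
    by (auto simp: fun_eq_iff frag_eval_of)
  then show "(if h \<in> real_homs then frag_eval (\<lambda>(x, r). h x * r) (frag_extend (\<lambda>(x, s). frag_of (x, r * s)) a) else 0)
      = r * (if h \<in> real_homs then frag_eval (\<lambda>(x, r). h x * r) a else 0)"
    by (simp only: frag_eval_extend frag_eval_scale) simp
qed

lemma linear_tensor_eval: "linear (tensor_eval h)"
  by (rule linearI) (simp_all add: tensor_eval_add tensor_eval_scaleR)

lemma tensor_eval_tensor: "h \<in> real_homs \<Longrightarrow> tensor_eval h (tensor x r) = h x * r"
  by transfer (simp add: frag_eval_of)

text \<open>The tensors generate the additive group, so differences suffice; real multiples are
  absorbed by the second factor.\<close>

lemma tensor_induct [case_names zero tensor diff]:
  assumes "P 0" "\<And>x r. P (tensor x r)" "\<And>u v. P u \<Longrightarrow> P v \<Longrightarrow> P (u - v)"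
  shows "P u"
proof (rule tensor_real.abs_induct)
  fix a
  show "P (abs_tensor_real a)"
  proof (rule frag_induction[of a UNIV])
    show "P (abs_tensor_real 0)" using assms(1) by (simp add: zero_tensor_real_def)
    fix z :: "'a \<times> real"
    show "P (abs_tensor_real (frag_of z))" using assms(2)[of "fst z" "snd z"] by (simp add: tensor.abs_eq)
  next
    fix a b assume "P (abs_tensor_real a)" "P (abs_tensor_real b)"
    then show "P (abs_tensor_real (a - b))" using assms(3) minus_tensor_real.abs_eq by metis
  qed auto
qed

lemma tensor_add: "tensor (x + y) r = tensor x r + tensor y r"
proof transfer
  fix x y :: 'a and r
  have "frag_of (x + y, r) - frag_of (x, r) - frag_of (y, r) \<in> tensor_relations"
    unfolding tensor_relations_def by blast
  then show "tensor_rel (frag_of (x + y, r)) (frag_of (x, r) + frag_of (y, r))"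
    by (simp add: tensor_rel_def zmod.span_base diff_diff_eq)
qed

lemma tensor_scaleR: "r *\<^sub>R tensor x s = tensor x (r * s)"
  by transfer (simp add: tensor_rel_def zmod.span_zero)

lemma tensor_zscale: "tensor (zscale k x) r = of_int k *\<^sub>R tensor x r"
  by (rule additive_zscale[of "\<lambda>x. tensor x r"]) (rule tensor_add)

lemma tensor_sum: "tensor (\<Sum>i\<in>I. f i) r = (\<Sum>i\<in>I. tensor (f i) r)"
  using Modules.additive.sum[of "\<lambda>x. tensor x r"] by (simp add: Modules.additive_def tensor_add)

text \<open>\<open>tensor x r\<close> is r / k times the tensor of \<open>zscale (int k) x\<close>
  with 1, and that multiple is an integer combination of elements of \<open>B\<close>.\<close>

lemma tensor_real_span:
  fixes B :: "'g::ab_group_add set"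
  assumes B: "finite B" "\<And>x. \<exists>k>0. zscale (int k) x \<in> zmod.span B"
  shows "span ((\<lambda>b. tensor b 1) ` B) = (UNIV :: 'g tensor_real set)"
proof -
  have "u \<in> span ((\<lambda>b. tensor b 1) ` B)" for u :: "'g tensor_real"
  proof (induction u rule: tensor_induct)
    case (tensor x r)
    obtain k where k: "k > 0" "zscale (int k) x \<in> zmod.span B" using B(2) by blast
    obtain n where n: "zscale (int k) x = (\<Sum>b\<in>B. zscale (n b) b)"
      using k(2) unfolding zmod.span_finite[OF B(1)] by (rule rangeE)
    have "tensor x r = (r / k) *\<^sub>R (real k *\<^sub>R tensor x 1)" using k(1) by (simp add: tensor_scaleR)
    also have "real k *\<^sub>R tensor x 1 = tensor (zscale (int k) x) 1" by (simp add: tensor_zscale)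
    also have "\<dots> = (\<Sum>b\<in>B. of_int (n b) *\<^sub>R tensor b 1)" by (simp add: n tensor_sum tensor_zscale)
    also have "(r / k) *\<^sub>R \<dots> \<in> span ((\<lambda>b. tensor b 1) ` B)"
      by (intro span_scale span_sum span_base) auto
    finally show ?case .
  qed (auto intro: span_zero span_diff)
  then show ?thesis by blast
qed

section \<open>Evaluation on the symmetric algebra\<close>

definition mon_eval :: "('u \<Rightarrow> real) \<Rightarrow> ('u \<Rightarrow>\<^sub>0 nat) \<Rightarrow> real" where
  "mon_eval L m = (\<Prod>u\<in>Poly_Mapping.keys m. L u ^ Poly_Mapping.lookup m u)"

definition pm_eval :: "('u \<Rightarrow> real) \<Rightarrow> (('u \<Rightarrow>\<^sub>0 nat) \<Rightarrow>\<^sub>0 real) \<Rightarrow> real" where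
  "pm_eval L p = (\<Sum>m\<in>Poly_Mapping.keys p. Poly_Mapping.lookup p m * mon_eval L m)"

lemma mon_eval_superset:
  assumes "finite S" "Poly_Mapping.keys m \<subseteq> S"
  shows "mon_eval L m = (\<Prod>u\<in>S. L u ^ Poly_Mapping.lookup m u)"
  unfolding mon_eval_def using assms by (intro prod.mono_neutral_left) (auto simp: in_keys_iff)

lemma mon_eval_add: "mon_eval L (m + n) = mon_eval L m * mon_eval L n"
proof -
  let ?S = "Poly_Mapping.keys m \<union> Poly_Mapping.keys n"
  have "Poly_Mapping.keys (m + n) \<subseteq> ?S" by (rule Poly_Mapping.keys_add)
  then show ?thesis
    by (simp add: mon_eval_superset[of ?S] lookup_add power_add prod.distrib)
qed

lemma pm_eval_superset:
  assumes "finite S" "Poly_Mapping.keys p \<subseteq> S"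
  shows "pm_eval L p = (\<Sum>m\<in>S. Poly_Mapping.lookup p m * mon_eval L m)"
  unfolding pm_eval_def using assms by (intro sum.mono_neutral_left) (auto simp: in_keys_iff)

lemma pm_eval_add: "pm_eval L (p + q) = pm_eval L p + pm_eval L q"
proof -
  let ?S = "Poly_Mapping.keys p \<union> Poly_Mapping.keys q"
  have "Poly_Mapping.keys (p + q) \<subseteq> ?S" by (rule Poly_Mapping.keys_add)
  then show ?thesis
    by (simp add: pm_eval_superset[of ?S] lookup_add distrib_right sum.distrib)
qed

lemma pm_eval_0: "pm_eval L 0 = 0"
  by (simp add: pm_eval_def)

lemma pm_eval_single: "pm_eval L (Poly_Mapping.single m c) = c * mon_eval L m"
  by (subst pm_eval_superset[of "{m}"]) (auto simp: lookup_single)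

lemma pm_eval_mult: "pm_eval L (p * q) = pm_eval L p * pm_eval L q"
proof -
  have *: "pm_eval L (p * Poly_Mapping.single m c) = pm_eval L p * pm_eval L (Poly_Mapping.single m c)" for m c
    by (induction p rule: poly_mapping_add_induct)
      (simp_all add: pm_eval_0 pm_eval_add pm_eval_single distrib_right mult_single mon_eval_add)
  show ?thesis
    by (induction q rule: poly_mapping_add_induct) (simp_all add: pm_eval_0 pm_eval_add * distrib_left)
qed

lemma pm_eval_minus: "pm_eval L (p - q) = pm_eval L p - pm_eval L q"
  using pm_eval_add[of L "p - q" q] by simp

lemma pm_eval_pvar: "pm_eval L (pvar u) = L u"
  by (simp add: pvar_def pm_eval_single mon_eval_def)

lemma pm_eval_pconst: "pm_eval L (pconst r) = r"
  by (simp add: pconst_def pm_eval_single mon_eval_def)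

text \<open>For a nonlinear \<open>L\<close> the default is evaluation at the zero functional. That
  is still a ring homomorphism, so the algebraic laws below, \<open>sym_eval L 1 = 1\<close> among
  them, hold for every \<open>L\<close>.\<close>

lift_definition sym_eval :: "('u::real_vector \<Rightarrow> real) \<Rightarrow> 'u sym \<Rightarrow> real"
  is "\<lambda>L p. if linear L then pm_eval L p else pm_eval (\<lambda>_. 0) p"
proof -
  fix L :: "'u \<Rightarrow> real" and a b :: "('u \<Rightarrow>\<^sub>0 nat) \<Rightarrow>\<^sub>0 real"
  assume "sym_rel a b"
  then have ab: "a - b \<in> ideal_gen sym_relations" by (simp add: sym_rel_def)
  have *: "pm_eval L c = 0" if L: "linear L" and c: "c \<in> ideal_gen sym_relations" for c and L :: "'u \<Rightarrow> real"
    using c unfolding ideal_gen_def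
  proof (induction rule: module.span_induct_alt[OF module_times, consumes 1, case_names base step])
    case base
    then show ?case by (simp add: pm_eval_0)
  next
    case (step k x y)
    have "pm_eval L x = 0"
      using step(1) unfolding sym_relations_def
      by (auto simp: pm_eval_minus pm_eval_mult pm_eval_pvar pm_eval_pconst linear_add[OF L] linear_scale[OF L])
    then show ?case using step by (simp add: pm_eval_add pm_eval_mult)
  qed
  show "(if linear L then pm_eval L a else pm_eval (\<lambda>_. 0) a) = (if linear L then pm_eval L b else pm_eval (\<lambda>_. 0) b)"
    using *[OF _ ab, of L] *[OF linear_zero ab] by (simp add: pm_eval_minus)
qed

lemma sym_eval_simps:
  "sym_eval L 0 = 0" "sym_eval L 1 = 1"
  "sym_eval L (f + g) = sym_eval L f + sym_eval L g"
  "sym_eval L (f * g) = sym_eval L f * sym_eval L g"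
  "sym_eval L (r *\<^sub>R f) = r * sym_eval L f"
  by (transfer; simp add: pm_eval_0 pm_eval_add pm_eval_mult pm_eval_pconst flip: pconst_simps(1))+

lemma sym_eval_sym_of: "linear L \<Longrightarrow> sym_eval L (sym_of u) = L u"
  by transfer (simp add: pm_eval_pvar)

lemma sym_eval_prod: "sym_eval L (\<Prod>i\<in>I. f i) = (\<Prod>i\<in>I. sym_eval L (f i))"
  by (induction I rule: infinite_finite_induct) (simp_all add: sym_eval_simps)

lemma sym_eval_poly: "sym_eval L (poly p x) = poly (map_poly (sym_eval L) p) (sym_eval L x)"
  by (induction p) (simp_all add: sym_eval_simps map_poly_pCons)

lemma sym_of_add: "sym_of (u + v) = sym_of u + sym_of v"
proof transfer
  fix u v :: 'a
  have "pvar (u + v) - pvar u - pvar v \<in> ideal_gen sym_relations"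
    unfolding ideal_gen_def sym_relations_def by (rule module.span_base[OF module_times]) blast
  then show "sym_rel (pvar (u + v)) (pvar u + pvar v)" by (simp add: sym_rel_def diff_diff_eq)
qed

lemma sym_of_scaleR: "sym_of (r *\<^sub>R u) = r *\<^sub>R sym_of u"
proof transfer
  fix r and u :: 'a
  have "pvar (r *\<^sub>R u) - pconst r * pvar u \<in> ideal_gen sym_relations"
    unfolding ideal_gen_def sym_relations_def by (rule module.span_base[OF module_times]) blast
  then show "sym_rel (pvar (r *\<^sub>R u)) (pconst r * pvar u)" by (simp add: sym_rel_def)
qed

section \<open>Generation of the symmetric algebra and faithfulness of evaluation\<close>

definition subalgebra :: "'u::real_vector sym set \<Rightarrow> bool" where
  "subalgebra A \<longleftrightarrow> (\<forall>r. r *\<^sub>R 1 \<in> A) \<and> (\<forall>f\<in>A. \<forall>g\<in>A. f + g \<in> A \<and> f * g \<in> A)"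

text \<open>An induction principle for \<open>Sym(U)\<close>: a representing polynomial is a sum of
  monomials, each built from a constant by adjoining one power of a variable at a time.\<close>

lemma subalgebra_UNIV:
  assumes A: "subalgebra A" and gen: "\<And>u. sym_of u \<in> A"
  shows "f \<in> A"
proof (rule sym.abs_induct)
  fix p
  have one: "1 \<in> A" using A unfolding subalgebra_def by (metis scaleR_one)
  have pow: "sym_of u ^ n \<in> A" for u n
    by (induction n) (use one A gen in \<open>auto simp: subalgebra_def\<close>)
  have absm: "abs_sym (a * b) = abs_sym a * abs_sym b" for a b :: "('a \<Rightarrow>\<^sub>0 nat) \<Rightarrow>\<^sub>0 real"
    by (simp add: times_sym.abs_eq)
  have "abs_sym (Poly_Mapping.single (Poly_Mapping.single u n) 1) = sym_of u ^ n" for u :: 'a and n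
  proof (induction n)
    case 0
    then show ?case by (simp add: one_sym_def)
  next
    case (Suc n)
    have "Poly_Mapping.single (Poly_Mapping.single u (Suc n)) (1::real) = pvar u * Poly_Mapping.single (Poly_Mapping.single u n) 1"
      by (simp add: pvar_def mult_single single_add[symmetric])
    then show ?case using Suc by (simp add: absm sym_of.abs_eq)
  qed
  then have var: "abs_sym (Poly_Mapping.single (Poly_Mapping.single u n) 1) \<in> A" for u n using pow by simp
  have const: "abs_sym (Poly_Mapping.single 0 c) \<in> A" for c
  proof -
    have "c *\<^sub>R (1 :: 'a sym) = abs_sym (pconst c * 1)" unfolding one_sym_def by (rule scaleR_sym.abs_eq)
    then show ?thesis using A unfolding subalgebra_def by (metis mult.right_neutral pconst_def)
  qed
  have mon: "abs_sym (Poly_Mapping.single m c) \<in> A" for m c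
  proof (induction m rule: poly_mapping_add_induct)
    case zero
    then show ?case by (rule const)
  next
    case (add m u n)
    have "Poly_Mapping.single (m + Poly_Mapping.single u n) c = Poly_Mapping.single m c * Poly_Mapping.single (Poly_Mapping.single u n) 1"
      by (simp add: mult_single)
    then show ?case using add var A by (simp add: absm subalgebra_def)
  qed
  show "abs_sym p \<in> A"
  proof (induction p rule: poly_mapping_add_induct)
    case zero
    then show ?case using const[of 0] by simp
  next
    case (add p m c)
    have "abs_sym (p + Poly_Mapping.single m c) = abs_sym p + abs_sym (Poly_Mapping.single m c)"
      by (simp add: plus_sym.abs_eq)
    then show ?case using add mon A by (simp add: subalgebra_def)
  qed
qed

text \<open>Polynomials in one generator at a time, so that injectivity can be proved by induction on the rank.\<close>

fun poly_alg :: "'u::real_vector list \<Rightarrow> 'u sym set" where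
  "poly_alg [] = range (\<lambda>r. r *\<^sub>R 1)"
| "poly_alg (u # us) = {poly p (sym_of u) | p. \<forall>i. coeff p i \<in> poly_alg us}"

lemma subalgebra_sum:
  assumes "subalgebra A" "\<And>i. i \<in> I \<Longrightarrow> f i \<in> A"
  shows "sum f I \<in> A"
proof -
  have "0 \<in> A" using assms(1) unfolding subalgebra_def by (metis scaleR_zero_left)
  then show ?thesis using assms(2)
    by (induction I rule: infinite_finite_induct) (use assms(1) in \<open>auto simp: subalgebra_def\<close>)
qed

lemma poly_alg_const:
  assumes "subalgebra (poly_alg us)" "f \<in> poly_alg us"
  shows "f \<in> poly_alg (u # us)"
proof -
  have "0 \<in> poly_alg us" using assms(1) unfolding subalgebra_def by (metis scaleR_zero_left)
  then show ?thesis using assms(2) by (auto intro!: exI[of _ "[:f:]"] simp: coeff_pCons split: nat.split)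
qed

lemma subalgebra_poly_alg: "subalgebra (poly_alg us)"
proof (induction us)
  case Nil
  have "r *\<^sub>R 1 + s *\<^sub>R 1 = (r + s) *\<^sub>R (1 :: 'a sym)" "r *\<^sub>R 1 * s *\<^sub>R 1 = (r * s) *\<^sub>R (1 :: 'a sym)" for r s
    by (simp_all add: scaleR_add_left)
  then show ?case unfolding subalgebra_def by (auto intro: rangeI)
next
  case (Cons u us)
  note closed = Cons[unfolded subalgebra_def]
  show ?case
    unfolding subalgebra_def
  proof (intro conjI ballI allI)
    show "r *\<^sub>R 1 \<in> poly_alg (u # us)" for r using poly_alg_const[OF Cons] closed by blast
    fix f g assume "f \<in> poly_alg (u # us)" "g \<in> poly_alg (u # us)"
    then obtain p q where p: "f = poly p (sym_of u)" "\<forall>i. coeff p i \<in> poly_alg us"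
      and q: "g = poly q (sym_of u)" "\<forall>i. coeff q i \<in> poly_alg us" by auto
    have "coeff (p + q) i \<in> poly_alg us" for i using p q closed by simp
    then show "f + g \<in> poly_alg (u # us)" using p(1) q(1) by (auto intro!: exI[of _ "p + q"])
    have "coeff (p * q) i \<in> poly_alg us" for i
      unfolding coeff_mult using p q closed by (intro subalgebra_sum[OF Cons]) simp
    then show "f * g \<in> poly_alg (u # us)" using p(1) q(1) by (auto intro!: exI[of _ "p * q"])
  qed
qed

lemma sym_of_in_poly_alg: "u \<in> set us \<Longrightarrow> sym_of u \<in> poly_alg us"
proof (induction us)
  case (Cons v us)
  show ?case
  proof (cases "u \<in> set us")
    case True
    then show ?thesis using Cons poly_alg_const[OF subalgebra_poly_alg] by blast
  next
    case False
    then have "u = v" using Cons by simp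
    have c: "(0 :: 'a sym) \<in> poly_alg us" "(1 :: 'a sym) \<in> poly_alg us"
      using subalgebra_poly_alg[of us] unfolding subalgebra_def by (metis scaleR_zero_left, metis scaleR_one)
    then show ?thesis
      using \<open>u = v\<close> by (auto intro!: exI[of _ "[:0, 1:]"] simp: coeff_pCons split: nat.split)
  qed
qed simp

lemma poly_alg_UNIV:
  assumes "span (set us) = UNIV"
  shows "f \<in> poly_alg us"
proof (rule subalgebra_UNIV[OF subalgebra_poly_alg])
  fix u
  have s: "r *\<^sub>R f \<in> poly_alg us" if "f \<in> poly_alg us" for r f
  proof -
    have "r *\<^sub>R f = (r *\<^sub>R 1) * f" by simp
    then show ?thesis using that subalgebra_poly_alg[of us] unfolding subalgebra_def by metis
  qed
  have "u \<in> span (set us)" using assms by simp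
  then show "sym_of u \<in> poly_alg us"
  proof (induction rule: span_induct_alt)
    case base
    have "sym_of (0 :: 'a) = 0 *\<^sub>R 1" using sym_of_scaleR[of 0 0] by simp
    then show ?case using subalgebra_poly_alg[of us] unfolding subalgebra_def by metis
  next
    case (step c x y)
    then show ?case
      using s[OF sym_of_in_poly_alg] subalgebra_poly_alg[of us]
      unfolding sym_of_add sym_of_scaleR subalgebra_def by blast
  qed
qed

text \<open>Used for coefficients: moving the point in a direction that the generators in
  \<open>us\<close> do not see leaves their values fixed.\<close>

lemma poly_alg_eval_cong:
  assumes "f \<in> poly_alg us" "linear L" "linear L'" "\<And>u. u \<in> set us \<Longrightarrow> L u = L' u"
  shows "sym_eval L f = sym_eval L' f"
  using assms(1,4)
proof (induction us arbitrary: f)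
  case Nil
  then show ?case by (auto simp: sym_eval_simps)
next
  case (Cons u us)
  then obtain p where p: "f = poly p (sym_of u)" "\<forall>i. coeff p i \<in> poly_alg us" by auto
  have "map_poly (sym_eval L) p = map_poly (sym_eval L') p"
    using Cons p(2) by (intro poly_eqI) (simp add: coeff_map_poly sym_eval_simps)
  moreover have "L u = L' u" using Cons(3) by simp
  ultimately show ?case
    by (simp add: p(1) sym_eval_poly sym_eval_sym_of[OF assms(2)] sym_eval_sym_of[OF assms(3)])
qed

lemma real_homs_line: "h \<in> real_homs \<Longrightarrow> e \<in> real_homs \<Longrightarrow> h + t *\<^sub>R e \<in> real_homs"
  by (simp add: subspace_add[OF subspace_real_homs] subspace_scale[OF subspace_real_homs])

lemma tensor_eval_line:
  assumes "h \<in> real_homs" "e \<in> real_homs"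
  shows "tensor_eval (h + t *\<^sub>R e) u = tensor_eval h u + t * tensor_eval e u"
proof (induction u rule: tensor_induct)
  case zero
  then show ?case by (simp add: linear_0[OF linear_tensor_eval])
next
  case (tensor x r)
  show ?case
    unfolding tensor_eval_tensor[OF assms(1)] tensor_eval_tensor[OF assms(2)]
      tensor_eval_tensor[OF real_homs_line[OF assms]]
    by (simp add: fun_ops algebra_simps)
next
  case (diff u v)
  then show ?case by (simp add: linear_diff[OF linear_tensor_eval] algebra_simps)
qed

text \<open>\<open>Sym(U)\<close> as functions on Hom(G, R), the dual of U, cut off to zero
  elsewhere so that the values land in the function spaces studied above.\<close>

definition sym_fun :: "'g::ab_group_add tensor_real sym \<Rightarrow> ('g \<Rightarrow> real) \<Rightarrow> real" where
  "sym_fun f = restr real_homs (\<lambda>h. sym_eval (tensor_eval h) f)"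

lemma linear_sym_fun: "linear sym_fun"
  by (rule linearI) (auto simp: sym_fun_def restr_def fun_eq_iff fun_ops sym_eval_simps)

lemma sym_fun_mult: "sym_fun (f * g) = sym_fun f * sym_fun g"
  by (auto simp: sym_fun_def restr_def fun_eq_iff fun_ops sym_eval_simps)

lemma sym_fun_pvec: "h \<in> real_homs \<Longrightarrow> sym_fun (pvec x) h = h x"
  by (simp add: sym_fun_def restr_apply pvec_def sym_eval_sym_of[OF linear_tensor_eval] tensor_eval_tensor)

lemma sym_fun_prod_pvec:
  "sym_fun (\<Prod>k\<in>Z. pvec (x k)) = restr real_homs (\<lambda>h. \<Prod>k\<in>Z. h (x k))"
  by (auto simp: sym_fun_def restr_def fun_eq_iff sym_eval_prod pvec_def
    sym_eval_sym_of[OF linear_tensor_eval] tensor_eval_tensor)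

text \<open>The elements that are polynomial along a given line form a subalgebra containing all
  vectors.\<close>

lemma sym_fun_line:
  assumes "h \<in> real_homs" "e \<in> real_homs"
  shows "\<exists>q :: real poly. \<forall>t. sym_fun f (h + t *\<^sub>R e) = poly q t"
proof -
  let ?A = "{f. \<exists>q :: real poly. \<forall>t. sym_eval (tensor_eval (h + t *\<^sub>R e)) f = poly q t}"
  have "subalgebra ?A"
    unfolding subalgebra_def
  proof (intro conjI ballI allI)
    fix r
    show "r *\<^sub>R 1 \<in> ?A" by (intro CollectI exI[of _ "[:r:]"]) (simp add: sym_eval_simps)
  next
    fix f g assume "f \<in> ?A" "g \<in> ?A"
    then obtain p q where pq: "\<forall>t. sym_eval (tensor_eval (h + t *\<^sub>R e)) f = poly p t"
      "\<forall>t. sym_eval (tensor_eval (h + t *\<^sub>R e)) g = poly q t" by blast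
    show "f + g \<in> ?A" by (intro CollectI exI[of _ "p + q"]) (simp add: sym_eval_simps pq)
    show "f * g \<in> ?A" by (intro CollectI exI[of _ "p * q"]) (simp add: sym_eval_simps pq)
  qed
  moreover have "sym_of u \<in> ?A" for u
    by (intro CollectI exI[of _ "[:tensor_eval h u, tensor_eval e u:]"])
      (simp add: sym_eval_sym_of[OF linear_tensor_eval] tensor_eval_line[OF assms])
  ultimately have "f \<in> ?A" by (rule subalgebra_UNIV)
  then show ?thesis using real_homs_line[OF assms] by (simp add: sym_fun_def restr_apply)
qed

text \<open>Induction on the number of generators. Write \<open>f\<close> as a polynomial in the
  first generator and let the point run along the dual direction, which changes that generator
  alone. The polynomial vanishes everywhere, hence so do its evaluated coefficients, and these
  involve fewer generators.\<close>

lemma sym_fun_eq_0: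
  fixes f :: "'g::ab_group_add tensor_real sym"
  assumes G: "fin_gen TYPE('g)" and f: "sym_fun f = 0"
  shows "f = 0"
proof -
  obtain B :: "'g set" where B: "finite B" "zmod.independent B" "card B = zrank (UNIV :: 'g set)"
    using zrank_props(1)[OF G, of UNIV] by blast
  obtain e :: "'g \<Rightarrow> 'g \<Rightarrow> real" where e: "\<And>b. b \<in> B \<Longrightarrow> e b \<in> real_homs"
    "\<And>b c. b \<in> B \<Longrightarrow> c \<in> B \<Longrightarrow> e b c = (if b = c then 1 else 0)"
    using dual_basis_exists[OF G B(1,2)] by blast
  have *: "f = 0" if "set bs \<subseteq> B" "distinct bs" "f \<in> poly_alg (map (\<lambda>b. tensor b 1) bs)"
    "\<And>h. h \<in> real_homs \<Longrightarrow> sym_eval (tensor_eval h) f = 0" for f bs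
    using that
  proof (induction bs arbitrary: f)
    case Nil
    then obtain r where r: "f = r *\<^sub>R 1" by auto
    have "sym_eval (tensor_eval (0 :: 'g \<Rightarrow> real)) f = 0" using Nil(4) real_homs_0 by blast
    then show ?case by (simp add: r sym_eval_simps)
  next
    case (Cons b bs)
    have b: "b \<in> B" "set bs \<subseteq> B" "distinct bs" "b \<notin> set bs" using Cons.prems(1,2) by auto
    obtain p where p: "f = poly p (sym_of (tensor b 1))" "\<And>i. coeff p i \<in> poly_alg (map (\<lambda>b. tensor b 1) bs)"
      using Cons.prems(3) by auto
    have "coeff p i = 0" for i
    proof (rule Cons.IH[OF b(2,3) p(2)])
      fix h :: "'g \<Rightarrow> real" assume h: "h \<in> real_homs"
      let ?q = "map_poly (sym_eval (tensor_eval h)) p"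
      have "poly ?q (h b + s) = 0" for s
      proof -
        let ?h = "h + s *\<^sub>R e b"
        have hh: "?h \<in> real_homs" using real_homs_line[OF h e(1)[OF b(1)]] .
        have "sym_eval (tensor_eval ?h) (coeff p i) = sym_eval (tensor_eval h) (coeff p i)" for i
        proof (rule poly_alg_eval_cong[OF p(2) linear_tensor_eval linear_tensor_eval])
          fix u assume "u \<in> set (map (\<lambda>b. tensor b 1) bs)"
          then obtain c where c: "c \<in> set bs" "u = tensor c 1" by auto
          then have "e b c = 0" using e(2)[OF b(1), of c] b(2,4) by auto
          then show "tensor_eval ?h u = tensor_eval h u"
            unfolding c(2) tensor_eval_tensor[OF hh] tensor_eval_tensor[OF h] by (simp add: fun_ops)
        qed
        then have "map_poly (sym_eval (tensor_eval ?h)) p = ?q"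
          by (intro poly_eqI) (simp add: coeff_map_poly sym_eval_simps)
        moreover have "tensor_eval ?h (tensor b 1) = h b + s"
          using e(2)[OF b(1) b(1)] unfolding tensor_eval_tensor[OF hh] by (simp add: fun_ops)
        moreover have "sym_eval (tensor_eval ?h) f = 0" using Cons.prems(4)[OF hh] .
        ultimately show ?thesis
          by (simp add: p(1) sym_eval_poly sym_eval_sym_of[OF linear_tensor_eval])
      qed
      from this[of "t - h b" for t] have "poly ?q t = 0" for t by simp
      then have "?q = 0" by (intro poly_cofinite_zero[of 0])
      then have "coeff ?q i = 0" by simp
      then show "sym_eval (tensor_eval h) (coeff p i) = 0" by (simp add: coeff_map_poly sym_eval_simps)
    qed
    then have "p = 0" by (simp add: poly_eq_iff)
    then show ?case by (simp add: p(1))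
  qed
  obtain bs where bs: "set bs = B" "distinct bs" using finite_distinct_list[OF B(1)] by auto
  have "span ((\<lambda>b. tensor b 1) ` B) = (UNIV :: 'g tensor_real set)"
    using maximal_independent_multiple[OF G B(1,2)] B(3) by (intro tensor_real_span[OF B(1)]) simp
  then have alg: "f \<in> poly_alg (map (\<lambda>b. tensor b 1) bs)" by (intro poly_alg_UNIV) (simp add: bs(1))
  have "sym_eval (tensor_eval h) f = 0" if "h \<in> real_homs" for h
    using fun_cong[OF f, of h] that by (simp add: sym_fun_def restr_apply fun_ops)
  then show ?thesis using *[OF _ bs(2) alg] bs(1) by simp
qed

lemma inj_sym_fun:
  assumes "fin_gen TYPE('g::ab_group_add)"
  shows "inj (sym_fun :: 'g tensor_real sym \<Rightarrow> _)"
  using sym_fun_eq_0[OF assms] linear_injective_0[OF linear_sym_fun] by blast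

text \<open>An element of infinite order is a nonzero form: some \<open>e\<close> has
  \<open>e y = 1\<close>, and along \<open>e\<close> the factor \<open>h y + t\<close> has a single
  zero.\<close>

lemma sym_cancel_pvec:
  fixes y :: "'g::ab_group_add"
  assumes G: "fin_gen TYPE('g)" and y: "\<not> torsion y" and f: "pvec y * f = 0"
  shows "f = 0"
proof (rule sym_fun_eq_0[OF G], rule ext)
  have "zscale k y \<notin> {0}" if "k > 0" for k using y that by (auto simp: torsion_def)
  then obtain e :: "'g \<Rightarrow> real" where e: "e \<in> real_homs" "e y = 1"
    using real_hom_exists[OF G zmod.subspace_single_0, of y] by auto
  fix h :: "'g \<Rightarrow> real"
  show "sym_fun f h = 0 h"
  proof (cases "h \<in> real_homs")
    case True
    obtain q where q: "\<And>t. sym_fun f (h + t *\<^sub>R e) = poly q t" using sym_fun_line[OF True e(1)] by blast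
    have "poly q t = 0" if "t \<noteq> - h y" for t
    proof -
      let ?h = "h + t *\<^sub>R e"
      have "sym_fun (pvec y * f) ?h = 0" by (simp add: f linear_0[OF linear_sym_fun] fun_ops)
      moreover have "?h y \<noteq> 0" using that e(2) by (simp add: fun_ops)
      ultimately show ?thesis
        by (simp add: sym_fun_mult times_fun_apply sym_fun_pvec[OF real_homs_line[OF True e(1)]] q)
    qed
    then have "q = 0" by (rule poly_cofinite_zero)
    then show ?thesis using q[of 0] by (simp add: fun_ops)
  qed (simp add: sym_fun_def restr_apply fun_ops)
qed

lemma sym_cancel_pprod:
  fixes Y :: "'g::ab_group_add list"
  assumes G: "fin_gen TYPE('g)" and Y: "\<And>y. y \<in> set Y \<Longrightarrow> \<not> torsion y" and f: "pprod Y * f = 0"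
  shows "f = 0"
  using Y f
proof (induction Y)
  case (Cons y Y)
  have "pvec y * (pprod Y * f) = 0" using Cons(3) by (simp add: pprod_def mult.assoc)
  moreover have "\<not> torsion y" using Cons(2) by simp
  ultimately have "pprod Y * f = 0" using sym_cancel_pvec[OF G] by blast
  then show ?case using Cons by simp
qed (simp add: pprod_def)

section \<open>The grading of the symmetric algebra\<close>

lemma subspace_sym_degree: "subspace (sym_degree i)"
  by (simp add: sym_degree_def)

lemma sym_degree_mult:
  assumes f: "f \<in> sym_degree a" and g: "g \<in> sym_degree b"
  shows "f * g \<in> sym_degree (a + b)"
proof -
  have *: "prod_list (map sym_of us) * g \<in> sym_degree (a + b)" if "length us = a" for us :: "'a list"
    using g unfolding sym_degree_def[of b]
  proof (induction rule: span_induct_alt)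
    case base
    then show ?case by (simp add: subspace_0[OF subspace_sym_degree])
  next
    case (step c x y)
    then obtain vs where vs: "x = prod_list (map sym_of vs)" "length vs = b" by blast
    have "prod_list (map sym_of us) * x = prod_list (map sym_of (us @ vs))" by (simp add: vs)
    also have "\<dots> \<in> sym_degree (a + b)"
      unfolding sym_degree_def using that vs by (intro span_base CollectI exI[of _ "us @ vs"]) simp
    finally show ?case
      using step by (simp add: distrib_left subspace_add[OF subspace_sym_degree] subspace_scale[OF subspace_sym_degree])
  qed
  show ?thesis
    using f unfolding sym_degree_def[of a]
  proof (induction rule: span_induct_alt)
    case base
    then show ?case by (simp add: subspace_0[OF subspace_sym_degree])
  next
    case (step c x y)
    then show ?case
      using * by (auto simp: distrib_right subspace_add[OF subspace_sym_degree] subspace_scale[OF subspace_sym_degree])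
  qed
qed

lemma pprod_sym_degree: "pprod Y \<in> sym_degree (length Y)"
  unfolding sym_degree_def pprod_def
  by (intro span_base CollectI exI[of _ "map (\<lambda>y. tensor y 1) Y"]) (simp add: pvec_def[abs_def] comp_def)

lemma sym_degree_homogeneous:
  assumes f: "f \<in> sym_degree i" and h: "h \<in> real_homs"
  shows "sym_fun f (t *\<^sub>R h) = t ^ i * sym_fun f h"
proof -
  have th: "t *\<^sub>R h \<in> real_homs" using h by (rule subspace_scale[OF subspace_real_homs])
  have te: "tensor_eval (t *\<^sub>R h) u = t * tensor_eval h u" for u
    using tensor_eval_line[OF real_homs_0 h, of t u] tensor_eval_line[OF real_homs_0 real_homs_0, of 1 u] by simp
  have st: "sym_eval (tensor_eval (t *\<^sub>R h)) (sym_of u) = t * tensor_eval h u" for u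
    by (simp only: sym_eval_sym_of[OF linear_tensor_eval] te)
  have "sym_eval (tensor_eval (t *\<^sub>R h)) f = t ^ i * sym_eval (tensor_eval h) f"
    using f unfolding sym_degree_def
  proof (induction rule: span_induct_alt)
    case base
    then show ?case by (simp add: sym_eval_simps)
  next
    case (step c x y)
    then obtain us where us: "x = prod_list (map sym_of us)" "length us = i" by blast
    have "sym_eval (tensor_eval (t *\<^sub>R h)) (prod_list (map sym_of us)) =
        t ^ length us * sym_eval (tensor_eval h) (prod_list (map sym_of us))" for us
      by (induction us) (simp_all add: sym_eval_simps st sym_eval_sym_of[OF linear_tensor_eval, of h])
    then show ?case using step us by (simp add: sym_eval_simps algebra_simps)
  qed
  then show ?thesis using h th by (simp add: sym_fun_def restr_apply)
qed

text \<open>Scaling the point by \<open>t\<close> turns degrees into powers of \<open>t\<close>,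
  which are told apart by coefficients. The offset \<open>c\<close> accounts for a common
  homogeneous factor of the components.\<close>

lemma sym_degree_unique:
  fixes f :: "nat \<Rightarrow> 'g::ab_group_add tensor_real sym"
  assumes G: "fin_gen TYPE('g)" and f: "\<And>j. j \<le> n \<Longrightarrow> f j \<in> sym_degree (c + j)"
    and s: "(\<Sum>j\<le>n. f j) \<in> sym_degree a" and j: "j \<le> n" "c + j \<noteq> a"
  shows "f j = 0"
proof (rule sym_fun_eq_0[OF G], rule ext)
  fix h :: "'g \<Rightarrow> real"
  show "sym_fun (f j) h = 0 h"
  proof (cases "h \<in> real_homs")
    case h: True
    let ?F = "\<Sum>j\<le>n. f j"
    \<comment> \<open>The difference of two expressions in \<open>t\<close> for the value at
      \<open>t *\<^sub>R h\<close>. As \<open>c + j\<close> is not \<open>a\<close>, its coefficient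
      there is the value of the single component \<open>f j\<close>.\<close>
    define q where "q = (\<Sum>j\<le>n. monom (sym_fun (f j) h) (c + j)) - monom (sym_fun ?F h) a"
    have sF: "sym_fun ?F x = (\<Sum>j\<le>n. sym_fun (f j) x)" for x
      unfolding linear_sum[OF linear_sym_fun]
      by (induction n) (simp_all add: fun_ops)
    have "poly q t = 0" for t
    proof -
      have "(\<Sum>j\<le>n. t ^ (c + j) * sym_fun (f j) h) = (\<Sum>j\<le>n. sym_fun (f j) (t *\<^sub>R h))"
        using sym_degree_homogeneous[OF f h] by (intro sum.cong) auto
      also have "\<dots> = t ^ a * sym_fun ?F h" using sym_degree_homogeneous[OF s h] by (simp add: sF)
      finally show ?thesis by (simp add: q_def poly_sum poly_monom mult.commute)
    qed
    then have "q = 0" by (intro poly_cofinite_zero[of 0])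
    then have "0 = coeff q (c + j)" by simp
    also have "\<dots> = (\<Sum>i\<le>n. if i = j then sym_fun (f i) h else 0)"
      using j(2) by (simp add: q_def coeff_sum coeff_monom)
    also have "\<dots> = sym_fun (f j) h" using j(1) by simp
    finally show ?thesis by (simp add: fun_ops)
  qed (simp add: sym_fun_def restr_apply fun_ops)
qed

section \<open>The Hilbert series of the central spaces\<close>

text \<open>The part of degree \<open>i\<close> of the central space, with index sets in place of
  sublists.\<close>

definition central_deg :: "('i \<Rightarrow> 'g::ab_group_add) \<Rightarrow> 'i set \<Rightarrow> nat \<Rightarrow> 'g tensor_real sym set" where
  "central_deg x I i = span {\<Prod>k\<in>Z. pvec (x k) | Z. Z \<subseteq> I \<and> card Z = i \<and>
     finite_index UNIV (zmod.span (x ` (I - Z)))}"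

abbreviation (input) forms :: "('i \<Rightarrow> 'g::ab_group_add) \<Rightarrow> 'i \<Rightarrow> ('g \<Rightarrow> real) \<Rightarrow> real" where
  "forms x \<equiv> \<lambda>k h. h (x k)"

lemma subspace_central_deg: "subspace (central_deg x I i)"
  by (simp add: central_deg_def)

text \<open>Evaluation is injective and carries the generators to products of forms; finite index of
  the complement becomes separation.\<close>

lemma dim_central_deg:
  fixes x :: "'i \<Rightarrow> 'g::ab_group_add"
  assumes G: "fin_gen TYPE('g)" and I: "finite I"
  shows "int (dim (central_deg x I i)) = coeff (hilb_poly (forms x) I real_homs) i"
proof -
  have "sym_fun ` central_deg x I i = P_space (forms x) I real_homs i"
    unfolding central_deg_def P_space_def linear_span_image[OF linear_sym_fun, symmetric]
      finite_index_iff_separating[OF G]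
    by (intro arg_cong[of _ _ span]) (force simp: sym_fun_prod_pvec[symmetric] image_iff)
  moreover have "dim (sym_fun ` central_deg x I i) = dim (central_deg x I i)"
    by (rule dim_injective_image[OF linear_sym_fun inj_on_subset[OF inj_sym_fun[OF G] subset_UNIV]])
  ultimately have d: "dim (central_deg x I i) = dim (P_space (forms x) I real_homs i)" by simp
  obtain F where F: "finite F" "(real_homs :: ('g \<Rightarrow> real) set) \<subseteq> span F"
    using real_homs_finite_dim[OF G] by blast
  show ?thesis
    unfolding d by (rule dim_P_space[OF I linear_eval subspace_real_homs F])
qed

lemma central_deg_finite_dim:
  assumes "finite I"
  shows "\<exists>F. finite F \<and> central_deg x I i \<subseteq> span F"
proof -
  let ?F = "(\<lambda>Z. \<Prod>k\<in>Z. pvec (x k)) ` Pow I"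
  have "central_deg x I i \<subseteq> span ?F" unfolding central_deg_def by (rule span_mono) auto
  moreover have "finite ?F" using assms by simp
  ultimately show ?thesis by blast
qed

lemma central_deg_sym_degree:
  assumes "finite I"
  shows "central_deg x I i \<subseteq> sym_degree i"
  unfolding central_deg_def
proof (rule span_minimal[OF _ subspace_sym_degree], clarify)
  fix Z assume Z: "Z \<subseteq> I" "i = card Z"
  then obtain zs where zs: "set zs = Z" "distinct zs" using finite_distinct_list finite_subset[OF _ assms] by metis
  have "(\<Prod>k\<in>Z. pvec (x k)) = pprod (map x zs)"
    using zs(2) unfolding zs(1)[symmetric] by (simp add: pprod_def comp_def prod.distinct_set_conv_list)
  then show "(\<Prod>k\<in>Z. pvec (x k)) \<in> sym_degree (card Z)"
    using pprod_sym_degree[of "map x zs"] zs distinct_card[OF zs(2)] by simp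
qed

text \<open>Each generator is homogeneous, its degree being the number of factors, so the span is
  the sum of its graded parts.\<close>

lemma central_P_graded:
  assumes ks: "distinct ks"
  shows "central_P (map x ks) = {\<Sum>i\<le>length ks. g i | g. \<forall>i\<le>length ks. g i \<in> central_deg x (set ks) i}"
    (is "_ = ?S")
proof -
  let ?I = "set ks" and ?n = "length ks"
  have card_le: "card Z \<le> ?n" if "Z \<subseteq> ?I" for Z
    using card_mono[OF _ that] distinct_card[OF ks] by simp
  have bij: "inj_on ((!) ks) {..<?n}" using ks by (simp add: inj_on_nth)
  have set_nths: "set (nths ks S) = (!) ks ` S" if "S \<subseteq> {..<?n}" for S
    using that by (auto simp: set_nths)
  \<comment> \<open>Sets of positions in the list correspond to subsets of \<open>set ks\<close>;
    distinctness of \<open>ks\<close> makes this a bijection that respects complements.\<close>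
  have gens: "{pprod (nths (map x ks) S) | S. S \<subseteq> {..<length (map x ks)} \<and>
       finite_index UNIV (zmod.span (set (nths (map x ks) ({..<length (map x ks)} - S))))}
     = {\<Prod>k\<in>Z. pvec (x k) | Z. Z \<subseteq> ?I \<and> finite_index UNIV (zmod.span (x ` (?I - Z)))}" (is "?L = ?R")
  proof -
    have pp: "pprod (nths (map x ks) S) = (\<Prod>k\<in>(!) ks ` S. pvec (x k))" if S: "S \<subseteq> {..<?n}" for S
    proof -
      have "(\<Prod>k\<in>set (nths ks S). pvec (x k)) = prod_list (map (\<lambda>k. pvec (x k)) (nths ks S))"
        by (rule prod.distinct_set_conv_list) (rule distinct_nthsI[OF ks])
      then show ?thesis by (simp add: pprod_def nths_map comp_def set_nths[OF S])
    qed
    have rest: "set (nths (map x ks) ({..<?n} - S)) = x ` (?I - (!) ks ` S)" if S: "S \<subseteq> {..<?n}" for S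
    proof -
      have "(!) ks ` ({..<?n} - S) = (!) ks ` {..<?n} - (!) ks ` S"
        by (rule inj_on_image_set_diff[OF bij]) (use S in auto)
      also have "(!) ks ` {..<?n} = ?I" by (auto simp: in_set_conv_nth)
      finally show ?thesis by (simp add: nths_map set_nths)
    qed
    show ?thesis
    proof (intro equalityI subsetI)
      fix p assume "p \<in> ?L"
      then obtain S where S: "S \<subseteq> {..<?n}" "p = pprod (nths (map x ks) S)"
        "finite_index UNIV (zmod.span (set (nths (map x ks) ({..<?n} - S))))" by auto
      then show "p \<in> ?R" using pp[OF S(1)] rest[OF S(1)]
        by (intro CollectI exI[of _ "(!) ks ` S"]) auto
    next
      fix p assume "p \<in> ?R"
      then obtain Z where Z: "Z \<subseteq> ?I" "p = (\<Prod>k\<in>Z. pvec (x k))" "finite_index UNIV (zmod.span (x ` (?I - Z)))" by blast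
      define S where "S = {i\<in>{..<?n}. ks ! i \<in> Z}"
      have "z \<in> (!) ks ` S" if z: "z \<in> Z" for z
      proof -
        have "z \<in> set ks" using z Z(1) by blast
        then obtain i where "i < ?n" "ks ! i = z" unfolding in_set_conv_nth by blast
        then show ?thesis using z by (intro image_eqI[of _ _ i]) (simp_all add: S_def)
      qed
      then have S: "S \<subseteq> {..<?n}" "(!) ks ` S = Z" by (auto simp: S_def)
      then show "p \<in> ?L" using pp[OF S(1)] rest[OF S(1)] Z
        by (intro CollectI exI[of _ S]) auto
    qed
  qed
  have "span ?R = ?S"
  proof (rule span_subspace)
    show sub: "subspace ?S"
    proof (rule subspaceI)
      show "0 \<in> ?S" by (intro CollectI exI[of _ "\<lambda>_. 0"]) (simp add: subspace_0[OF subspace_central_deg])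
      fix f g assume "f \<in> ?S" "g \<in> ?S"
      then obtain u v where u: "f = (\<Sum>i\<le>?n. u i)" "\<forall>i\<le>?n. u i \<in> central_deg x ?I i"
        and v: "g = (\<Sum>i\<le>?n. v i)" "\<forall>i\<le>?n. v i \<in> central_deg x ?I i" by blast
      show "f + g \<in> ?S" using u v
        by (intro CollectI exI[of _ "\<lambda>i. u i + v i"]) (simp add: sum.distrib subspace_add[OF subspace_central_deg])
    next
      fix f and c :: real assume "f \<in> ?S"
      then obtain u where u: "f = (\<Sum>i\<le>?n. u i)" "\<forall>i\<le>?n. u i \<in> central_deg x ?I i" by blast
      then show "c *\<^sub>R f \<in> ?S"
        by (intro CollectI exI[of _ "\<lambda>i. c *\<^sub>R u i"]) (simp add: scaleR_sum_right subspace_scale[OF subspace_central_deg])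
    qed
    show "?R \<subseteq> ?S"
    proof clarify
      fix Z assume Z: "Z \<subseteq> ?I" "finite_index UNIV (zmod.span (x ` (?I - Z)))"
      let ?p = "\<Prod>k\<in>Z. pvec (x k)"
      let ?g = "\<lambda>i. if i = card Z then ?p else 0"
      have "?p \<in> central_deg x ?I (card Z)"
        unfolding central_deg_def using Z by (intro span_base) blast
      then have "\<forall>i\<le>?n. ?g i \<in> central_deg x ?I i" by (simp add: subspace_0[OF subspace_central_deg])
      moreover have "?p = (\<Sum>i\<le>?n. ?g i)" using card_le[OF Z(1)] by simp
      ultimately show "\<exists>g. ?p = (\<Sum>i\<le>?n. g i) \<and> (\<forall>i\<le>?n. g i \<in> central_deg x ?I i)" by blast
    qed
    show "?S \<subseteq> span ?R"
    proof clarify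
      fix g assume g: "\<forall>i\<le>?n. g i \<in> central_deg x ?I i"
      have "central_deg x ?I i \<subseteq> span ?R" for i unfolding central_deg_def by (rule span_mono) blast
      then show "(\<Sum>i\<le>?n. g i) \<in> span ?R" using g by (intro span_sum) auto
    qed
  qed
  then show ?thesis by (simp only: central_P_def gens)
qed

lemma dim_central_P:
  fixes x :: "'i \<Rightarrow> 'g::ab_group_add"
  assumes G: "fin_gen TYPE('g)" and ks: "distinct ks"
  shows "dim (central_P (map x ks)) = (\<Sum>i\<le>length ks. dim (central_deg x (set ks) i))"
  unfolding central_P_graded[OF ks]
proof -
  have "dim {\<Sum>i\<in>{..length ks}. g i | g. \<forall>i\<in>{..length ks}. g i \<in> central_deg x (set ks) i}
      = (\<Sum>i\<in>{..length ks}. dim (central_deg x (set ks) i))"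
  proof (rule dim_direct_sum)
    fix v assume v: "\<And>i. i \<in> {..length ks} \<Longrightarrow> v i \<in> central_deg x (set ks) i" and z: "(\<Sum>i\<le>length ks. v i) = 0"
    show "\<forall>i\<in>{..length ks}. v i = 0"
    proof
      fix i assume i: "i \<in> {..length ks}"
      \<comment> \<open>The degree \<open>Suc (length ks)\<close> differs from that of every
        component, and the zero sum belongs to it.\<close>
      show "v i = 0"
      proof (rule sym_degree_unique[OF G, where c = 0 and n = "length ks" and a = "Suc (length ks)"])
        show "v j \<in> sym_degree (0 + j)" if "j \<le> length ks" for j
          using v[of j] that central_deg_sym_degree[of "set ks" x j] by auto
      qed (use i in \<open>auto simp: z subspace_0[OF subspace_sym_degree]\<close>)
    qed
  qed (auto intro: subspace_central_deg central_deg_finite_dim)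
  then show "dim {\<Sum>i\<le>length ks. g i | g. \<forall>i\<le>length ks. g i \<in> central_deg x (set ks) i}
      = (\<Sum>i\<le>length ks. dim (central_deg x (set ks) i))" by (simp only: atMost_iff Ball_def)
qed

text \<open>If \<open>P * f\<close> is homogeneous of degree \<open>a\<close>, then
  \<open>P * g j\<close> vanishes for every component \<open>g j\<close> of \<open>f\<close> with
  \<open>c + j \<noteq> a\<close>, and cancelling \<open>P\<close> removes that component.\<close>

lemma central_P_shift_degree:
  fixes x :: "'i \<Rightarrow> 'g::ab_group_add"
  assumes G: "fin_gen TYPE('g)" and ks: "distinct ks"
    and P: "P \<in> sym_degree c" and cancel: "\<And>f. P * f = 0 \<Longrightarrow> f = 0"
  shows "{f \<in> central_P (map x ks). P * f \<in> sym_degree a} =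
    (if c \<le> a then central_deg x (set ks) (a - c) else {0})"
proof -
  let ?n = "length ks"
  have cd: "central_deg x (set ks) j = {0}" if j: "j > ?n" for j
  proof -
    have "card Z \<noteq> j" if "Z \<subseteq> set ks" for Z
      using card_mono[OF _ that] distinct_card[OF ks] j by simp
    then have "{\<Prod>k\<in>Z. pvec (x k) | Z. Z \<subseteq> set ks \<and> card Z = j \<and>
       finite_index UNIV (zmod.span (x ` (set ks - Z)))} = {}" by blast
    then show ?thesis unfolding central_deg_def by (simp only: span_empty)
  qed
  show ?thesis
  proof (intro equalityI subsetI)
    fix f assume "f \<in> {f \<in> central_P (map x ks). P * f \<in> sym_degree a}"
    then obtain g where f: "f = (\<Sum>i\<le>?n. g i)" and g: "\<forall>i\<le>?n. g i \<in> central_deg x (set ks) i"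
      and Pf: "P * f \<in> sym_degree a" unfolding central_P_graded[OF ks] by blast
    have g0: "g j = 0" if j: "j \<le> ?n" "c + j \<noteq> a" for j
    proof (rule cancel, rule sym_degree_unique[OF G, where f = "\<lambda>j. P * g j", OF _ _ j])
      show "P * g j \<in> sym_degree (c + j)" if "j \<le> ?n" for j
        using g that central_deg_sym_degree[of "set ks" x j] by (intro sym_degree_mult[OF P]) auto
      show "(\<Sum>j\<le>?n. P * g j) \<in> sym_degree a" using Pf by (simp add: f sum_distrib_left)
    qed
    show "f \<in> (if c \<le> a then central_deg x (set ks) (a - c) else {0})"
    proof (cases "c \<le> a \<and> a - c \<le> ?n")
      case True
      have "g i = 0" if "i \<le> ?n" "i \<noteq> a - c" for i
        using True that by (intro g0) auto
      then have "f = (\<Sum>i\<in>{a - c}. g i)"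
        unfolding f using True by (intro sum.mono_neutral_right) auto
      then show ?thesis using True g by simp
    next
      case False
      then have "g i = 0" if "i \<le> ?n" for i using that by (intro g0) auto
      then have "f = 0" unfolding f by (intro sum.neutral) auto
      then show ?thesis by (simp add: subspace_0[OF subspace_central_deg])
    qed
  next
    fix f assume f: "f \<in> (if c \<le> a then central_deg x (set ks) (a - c) else {0})"
    have z: "0 \<in> central_P (map x ks)" by (simp add: central_P_def span_zero)
    show "f \<in> {f \<in> central_P (map x ks). P * f \<in> sym_degree a}"
    proof (cases "c \<le> a \<and> a - c \<le> ?n")
      case True
      then have fc: "f \<in> central_deg x (set ks) (a - c)" using f by simp
      let ?g = "\<lambda>i. if i = a - c then f else 0"
      have "f = (\<Sum>i\<le>?n. ?g i)" "\<forall>i\<le>?n. ?g i \<in> central_deg x (set ks) i"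
        using True fc by (auto simp: subspace_0[OF subspace_central_deg])
      then have "f \<in> central_P (map x ks)" unfolding central_P_graded[OF ks] by blast
      moreover have "P * f \<in> sym_degree (c + (a - c))"
        using fc central_deg_sym_degree[of "set ks" x "a - c"] by (intro sym_degree_mult[OF P]) auto
      ultimately show ?thesis using True by simp
    next
      case False
      then have "f = 0" using f cd[of "a - c"] by (auto split: if_splits)
      then show ?thesis using z by (simp add: subspace_0[OF subspace_sym_degree])
    qed
  qed
qed

section \<open>The summand of one character\<close>

definition kernel_positions :: "'g::ab_group_add list \<Rightarrow> ('g \<Rightarrow> complex) \<Rightarrow> nat set" where
  "kernel_positions X \<phi> = {k\<in>{..<length X}. \<phi> (X ! k) = 1}"

lemma kernel_sublist_map:
  "\<exists>ks. distinct ks \<and> set ks = kernel_positions X \<phi> \<and> kernel_sublist X \<phi> = map ((!) X) ks"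
proof -
  let ?ks = "filter (\<lambda>k. \<phi> (X ! k) = 1) [0..<length X]"
  have "X = map ((!) X) [0..<length X]" by (simp add: map_nth)
  then have "kernel_sublist X \<phi> = filter (\<lambda>x. \<phi> x = 1) (map ((!) X) [0..<length X])"
    unfolding kernel_sublist_def by simp
  also have "\<dots> = map ((!) X) ?ks" by (simp add: filter_map comp_def)
  finally show ?thesis by (intro exI[of _ ?ks]) (auto simp: kernel_positions_def)
qed

abbreviation (input) outer_part :: "'g::ab_group_add list \<Rightarrow> ('g \<Rightarrow> complex) \<Rightarrow> 'g list" where
  "outer_part X \<phi> \<equiv> filter (\<lambda>x. \<phi> x \<noteq> 1 \<and> \<not> torsion x) X"

text \<open>Each entry on which the character is nontrivial contributes one degree, through
  \<open>s\<^sub>0\<close> if it is torsion and through a linear factor otherwise.\<close>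

lemma degree_shift: "length (outer_part X \<phi>) + tors X \<phi> = length X - card (kernel_positions X \<phi>)"
proof -
  obtain ks where ks: "distinct ks" "set ks = kernel_positions X \<phi>" "kernel_sublist X \<phi> = map ((!) X) ks"
    using kernel_sublist_map by blast
  have "card (kernel_positions X \<phi>) = length (filter (\<lambda>x. \<phi> x = 1) X)"
    using ks distinct_card[of ks] by (metis kernel_sublist_def length_map)
  moreover have "length (filter (\<lambda>x. \<phi> x = 1) Y) + (length (outer_part Y \<phi>) + tors Y \<phi>) = length Y" for Y
    unfolding tors_def by (induction Y) auto
  ultimately show ?thesis by (metis add_diff_cancel_left')
qed

lemma linear_monom: "linear (\<lambda>f. monom f k :: 'a::real_vector poly)"
  by (rule linearI) (auto simp: poly_eq_iff scaleR_poly_def coeff_map_poly coeff_monom)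

lemma linear_mult_sym: "linear (\<lambda>g. P * g)" for P :: "'u::real_vector sym"
  by (rule linearI) (simp_all add: distrib_left)

lemma linear_component_map: "linear (\<lambda>g. monom (P * g) k)" for P :: "'u::real_vector sym"
  using linear_compose[OF linear_mult_sym[of P] linear_monom[of k]] by (simp add: comp_def)

lemma subspace_central_P: "subspace (central_P Y)"
  by (simp add: central_P_def)

lemma subspace_Pper_component: "subspace (Pper_component X \<phi>)"
  unfolding Pper_component_def
  by (rule linear_subspace_image[OF linear_component_map subspace_central_P])

lemma monom_homogeneous_iff:
  "monom f k \<in> homogeneous i \<longleftrightarrow> (if k \<le> i then f \<in> sym_degree (i - k) else f = 0)"
  by (auto simp: homogeneous_def coeff_monom subspace_0[OF subspace_sym_degree] split: if_splits)

lemma inj_component_map: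
  assumes "fin_gen TYPE('g::ab_group_add)"
  shows "inj (\<lambda>g :: 'g tensor_real sym. monom (pprod (outer_part X \<phi>) * g) (tors X \<phi>))"
  unfolding linear_injective_0[OF linear_component_map]
  using sym_cancel_pprod[OF assms, of "outer_part X \<phi>"] by auto

text \<open>Multiplication by the common factor is injective, so the summand is a copy of the
  central space of the kernel sublist, moved up by the degree of that factor.\<close>

lemma component_degree:
  fixes X :: "'g::ab_group_add list"
  assumes G: "fin_gen TYPE('g)"
  shows "int (dim (Pper_component X \<phi> \<inter> homogeneous i)) =
    coeff (monom 1 (length X - card (kernel_positions X \<phi>)) *
      hilb_poly (forms ((!) X)) (kernel_positions X \<phi>) real_homs) i"
proof -
  let ?P = "pprod (outer_part X \<phi>)" and ?t = "tors X \<phi>" and ?K = "kernel_positions X \<phi>"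
  let ?c = "length (outer_part X \<phi>)"
  obtain ks where ks: "distinct ks" "set ks = ?K" "kernel_sublist X \<phi> = map ((!) X) ks"
    using kernel_sublist_map by blast
  have fK: "finite ?K" by (simp add: kernel_positions_def)
  have cancel: "f = 0" if "?P * f = 0" for f
    using sym_cancel_pprod[OF G _ that] by auto
  have im: "Pper_component X \<phi> \<inter> homogeneous i = (\<lambda>f. monom (?P * f) ?t) `
      {f \<in> central_P (map ((!) X) ks). monom (?P * f) ?t \<in> homogeneous i}"
    unfolding Pper_component_def ks(3) by auto
  have d: "dim (Pper_component X \<phi> \<inter> homogeneous i) =
      dim {f \<in> central_P (map ((!) X) ks). monom (?P * f) ?t \<in> homogeneous i}"
    unfolding im by (rule dim_injective_image[OF linear_component_map inj_on_subset[OF inj_component_map[OF G] subset_UNIV]])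
  have sets: "{f \<in> central_P (map ((!) X) ks). monom (?P * f) ?t \<in> homogeneous i} =
      (if ?c + ?t \<le> i then central_deg ((!) X) ?K (i - (?c + ?t)) else {0})"
  proof (cases "?t \<le> i")
    case True
    then show ?thesis
      using central_P_shift_degree[where x = "(!) X" and a = "i - ?t", OF G ks(1) pprod_sym_degree cancel]
      by (auto simp: monom_homogeneous_iff ks(2) le_diff_conv2 diff_diff_eq add.commute)
  next
    case False
    then have "{f \<in> central_P (map ((!) X) ks). monom (?P * f) ?t \<in> homogeneous i} = {0}"
      using cancel subspace_0[OF subspace_central_P] by (auto simp: monom_homogeneous_iff)
    then show ?thesis using False by simp
  qed
  have "dim {0 :: 'g tensor_real sym} = 0"
    by (rule real_vector.dim_unique[of "{}"]) (simp_all add: independent_empty)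
  then show ?thesis
    unfolding d sets degree_shift
    by (simp add: coeff_monom_mult dim_central_deg[OF G fK])
qed

text \<open>Full-rank subsets may replace bases because each contains one. In rank zero the empty
  sublist is a basis annihilated by every character, in agreement with the convention in
  \<open>vertices\<close>.\<close>

lemma finite_vertices_annihilator:
  fixes X :: "'g::ab_group_add list"
  assumes G: "fin_gen TYPE('g)" and X: "finite_index UNIV (zmod.span (set X))"
  shows "vertices X = (\<Union>S\<in>{S. S \<subseteq> {..<length X} \<and> finite_index UNIV (zmod.span ((!) X ` S))}.
    annihilator (zmod.span ((!) X ` S)))" (is "_ = ?U")
    and "finite (vertices X)"
proof -
  let ?N = "length X"
  let ?fi = "\<lambda>S. finite_index UNIV (zmod.span ((!) X ` S))"
  have nths: "set (nths X S) = (!) X ` S" if "S \<subseteq> {..<?N}" for S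
    using that by (auto simp: set_nths)
  have X': "?fi {..<?N}" using X by (metis nth_image order_refl take_all lessThan_atLeast0)
  have sub: "\<exists>S'\<subseteq>S. card S' = zrank (UNIV :: 'g set) \<and> ?fi S'" if S: "S \<subseteq> {..<?N}" "?fi S" for S
  proof -
    have sep: "separating (forms ((!) X)) S real_homs" using S(2) finite_index_iff_separating[OF G] by blast
    have fS: "finite S" using S(1) finite_subset by blast
    obtain F where F: "finite F" "(real_homs :: ('g \<Rightarrow> real) set) \<subseteq> span F"
      using real_homs_finite_dim[OF G] by blast
    obtain S' where S': "S' \<subseteq> S" "card S' = dim (real_homs :: ('g \<Rightarrow> real) set)"
      "separating (forms ((!) X)) S' real_homs"
      using separating_subset[OF fS sep linear_eval subspace_real_homs F] by blast
    have "card S' = zrank (UNIV :: 'g set)" using S'(2) by (simp add: dim_real_homs[OF G])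
    moreover have "?fi S'" using S'(3) finite_index_iff_separating[OF G] by blast
    ultimately show ?thesis using S'(1) by blast
  qed
  show eq: "vertices X = ?U"
  proof (cases "zrank (UNIV :: 'g set) = 0")
    case True
    obtain S where S: "S \<subseteq> {..<?N}" "card S = 0" "?fi S" using sub[OF order_refl X'] True by auto
    have "finite S" using S(1) finite_subset by blast
    then have "S = {}" using S(2) by simp
    then have "characters \<subseteq> ?U" using S by (auto simp: annihilator_span)
    moreover have "?U \<subseteq> characters" by (auto simp: annihilator_def)
    ultimately show ?thesis using True by (simp add: vertices_def)
  next
    case False
    have "vertices X = {\<phi> \<in> characters. \<exists>B\<in>bases X. \<forall>b\<in>set B. \<phi> b = 1}" using False by (simp add: vertices_def)
    also have "\<dots> = ?U"
    proof (intro equalityI subsetI)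
      fix \<phi> assume "\<phi> \<in> {\<phi> \<in> characters. \<exists>B\<in>bases X. \<forall>b\<in>set B. \<phi> b = 1}"
      then obtain S where S: "S \<subseteq> {..<?N}" "finite_index UNIV (zmod.span (set (nths X S)))"
        "\<forall>b\<in>set (nths X S). \<phi> b = 1" "\<phi> \<in> characters" unfolding bases_def by blast
      then have "\<phi> \<in> annihilator (zmod.span ((!) X ` S))" by (simp add: annihilator_span nths)
      then show "\<phi> \<in> ?U" using S(1,2) by (auto simp: nths)
    next
      fix \<phi> assume "\<phi> \<in> ?U"
      then obtain S where S: "S \<subseteq> {..<?N}" "?fi S" "\<phi> \<in> annihilator (zmod.span ((!) X ` S))" by blast
      obtain S' where S': "S' \<subseteq> S" "card S' = zrank (UNIV :: 'g set)" "?fi S'" using sub[OF S(1,2)] by blast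
      have S'N: "S' \<subseteq> {..<?N}" using S'(1) S(1) by blast
      then have "nths X S' \<in> bases X" unfolding bases_def using S' by (auto simp: nths)
      moreover have "\<forall>b\<in>set (nths X S'). \<phi> b = 1" using S(3) S'(1) by (auto simp: annihilator_span nths[OF S'N])
      moreover have "\<phi> \<in> characters" using S(3) by (simp add: annihilator_def)
      ultimately show "\<phi> \<in> {\<phi> \<in> characters. \<exists>B\<in>bases X. \<forall>b\<in>set B. \<phi> b = 1}" by blast
    qed
    finally show ?thesis .
  qed
  have "finite {S. S \<subseteq> {..<?N} \<and> ?fi S}" by (rule finite_subset[of _ "Pow {..<?N}"]) auto
  then show "finite (vertices X)" unfolding eq using card_annihilator(1)[OF G] by (intro finite_UN_I) auto
qed

text \<open>Double counting. \<open>S\<close> lies in the kernel of \<phi> exactly if \<phi>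
  annihilates the subgroup generated by \<open>S\<close>; all these characters are vertices, and
  their number is the index, that is, \<open>arith_mult\<close>.\<close>

lemma sum_vertices:
  fixes X :: "'g::ab_group_add list" and F :: "nat set \<Rightarrow> 'b::comm_semiring_1"
  assumes G: "fin_gen TYPE('g)" and X: "finite_index UNIV (zmod.span (set X))"
  shows "(\<Sum>\<phi>\<in>vertices X. \<Sum>S\<in>Pow (kernel_positions X \<phi>).
      if finite_index UNIV (zmod.span ((!) X ` S)) then F S else 0)
    = (\<Sum>S\<in>Pow {..<length X}. if finite_index UNIV (zmod.span ((!) X ` S))
      then of_nat (arith_mult ((!) X ` S)) * F S else 0)"
proof -
  let ?N = "length X" and ?fi = "\<lambda>S. finite_index UNIV (zmod.span ((!) X ` S))"
  note fin = finite_vertices_annihilator(2)[OF G X]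
  have "(\<Sum>\<phi>\<in>vertices X. \<Sum>S\<in>Pow (kernel_positions X \<phi>). if ?fi S then F S else 0)
      = (\<Sum>\<phi>\<in>vertices X. \<Sum>S\<in>Pow {..<?N}. if S \<subseteq> kernel_positions X \<phi> then (if ?fi S then F S else 0) else 0)"
  proof (rule sum.cong[OF refl])
    fix \<phi>
    have "Pow (kernel_positions X \<phi>) = {S\<in>Pow {..<?N}. S \<subseteq> kernel_positions X \<phi>}"
      by (auto simp: kernel_positions_def)
    then show "(\<Sum>S\<in>Pow (kernel_positions X \<phi>). if ?fi S then F S else 0)
      = (\<Sum>S\<in>Pow {..<?N}. if S \<subseteq> kernel_positions X \<phi> then (if ?fi S then F S else 0) else 0)"
      by (simp only: sum.inter_filter[OF finite_Pow_iff[THEN iffD2, OF finite_lessThan]])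
  qed
  also have "\<dots> = (\<Sum>S\<in>Pow {..<?N}. \<Sum>\<phi>\<in>vertices X. if S \<subseteq> kernel_positions X \<phi> then (if ?fi S then F S else 0) else 0)"
    by (rule sum.swap)
  also have "\<dots> = (\<Sum>S\<in>Pow {..<?N}. if ?fi S then of_nat (arith_mult ((!) X ` S)) * F S else 0)"
  proof (rule sum.cong[OF refl])
    fix S assume S: "S \<in> Pow {..<?N}"
    show "(\<Sum>\<phi>\<in>vertices X. if S \<subseteq> kernel_positions X \<phi> then (if ?fi S then F S else 0) else 0)
        = (if ?fi S then of_nat (arith_mult ((!) X ` S)) * F S else 0)"
    proof (cases "?fi S")
      case True
      have "{\<phi>\<in>vertices X. S \<subseteq> kernel_positions X \<phi>} = annihilator (zmod.span ((!) X ` S))"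
      proof (intro equalityI subsetI)
        fix \<phi> assume p: "\<phi> \<in> {\<phi>\<in>vertices X. S \<subseteq> kernel_positions X \<phi>}"
        have "\<phi> \<in> characters"
          using p unfolding finite_vertices_annihilator(1)[OF G X] by (auto simp: annihilator_def)
        then show "\<phi> \<in> annihilator (zmod.span ((!) X ` S))"
          using p by (auto simp: annihilator_span kernel_positions_def)
      next
        fix \<phi> assume p: "\<phi> \<in> annihilator (zmod.span ((!) X ` S))"
        then have "\<phi> \<in> vertices X"
          unfolding finite_vertices_annihilator(1)[OF G X] using S True by blast
        then show "\<phi> \<in> {\<phi>\<in>vertices X. S \<subseteq> kernel_positions X \<phi>}"
          using p S by (auto simp: annihilator_span kernel_positions_def)
      qed
      then have "card {\<phi>\<in>vertices X. S \<subseteq> kernel_positions X \<phi>} = arith_mult ((!) X ` S)"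
        using card_annihilator(2)[OF G True] arith_mult_finite_index[OF True] by simp
      moreover have "(\<Sum>\<phi>\<in>vertices X. if S \<subseteq> kernel_positions X \<phi> then F S else 0)
          = of_nat (card {\<phi>\<in>vertices X. S \<subseteq> kernel_positions X \<phi>}) * F S"
        by (simp only: sum.inter_filter[OF fin, symmetric] sum_constant)
      ultimately show ?thesis using True by simp
    qed simp
  qed
  finally show ?thesis .
qed

section \<open>The Hilbert series and the arithmetic Tutte polynomial\<close>

lemma hilb_poly_forms:
  fixes X :: "'g::ab_group_add list"
  assumes G: "fin_gen TYPE('g)"
  shows "hilb_poly (forms ((!) X)) A real_homs = (\<Sum>S\<in>Pow A.
    if finite_index UNIV (zmod.span ((!) X ` S))
    then [:0, 1:] ^ (card A - card S) * [:1, -1:] ^ (card S - zrank (UNIV :: 'g set)) else 0)"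
  unfolding hilb_poly_def finite_index_iff_separating[OF G] dim_real_homs[OF G] by simp

lemma finite_index_card_ge:
  fixes X :: "'g::ab_group_add list"
  assumes G: "fin_gen TYPE('g)" and S: "finite S" "finite_index UNIV (zmod.span ((!) X ` S))"
  shows "zrank (UNIV :: 'g set) \<le> card S"
proof -
  have "separating (forms ((!) X)) S real_homs" using S(2) finite_index_iff_separating[OF G] by blast
  from separating_dim_le[OF subspace_real_homs S(1) this linear_eval]
  show ?thesis by (simp add: dim_real_homs[OF G])
qed

lemma single_in_Pper_iff:
  assumes "\<phi> \<in> vertices X"
  shows "Poly_Mapping.single \<phi> f \<in> Pper X \<longleftrightarrow> f \<in> Pper_component X \<phi>"
  using assms subspace_0[OF subspace_Pper_component, of X]
  by (auto simp: Pper_def lookup_single when_def split: if_splits)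

lemma Hilb_Pper_poly:
  fixes X :: "'g::ab_group_add list"
  assumes G: "fin_gen TYPE('g)" and X: "finite_index UNIV (zmod.span (set X))"
  shows "Hilb_Pper X = fps_of_poly (\<Sum>S\<in>Pow {..<length X}.
    if finite_index UNIV (zmod.span ((!) X ` S))
    then of_nat (arith_mult ((!) X ` S)) *
      ([:0, 1:] ^ (length X - card S) * [:1, -1:] ^ (card S - zrank (UNIV :: 'g set))) else 0)"
proof -
  let ?N = "length X" and ?d = "zrank (UNIV :: 'g set)"
  let ?fi = "\<lambda>S. finite_index UNIV (zmod.span ((!) X ` S))"
  \<comment> \<open>The shift by N - |X_phi| turns the exponent |X_phi| - |S| into N - |S|. The term
    of \<open>S\<close> is then the same for all characters, as the exchange of summations
    requires.\<close>
  have comp: "monom 1 (?N - card (kernel_positions X \<phi>)) * hilb_poly (forms ((!) X)) (kernel_positions X \<phi>) real_homs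
      = (\<Sum>S\<in>Pow (kernel_positions X \<phi>). if ?fi S then [:0, 1:] ^ (?N - card S) * [:1, -1:] ^ (card S - ?d) else 0)" for \<phi>
    unfolding hilb_poly_forms[OF G] sum_distrib_left
  proof (rule sum.cong[OF refl])
    fix S assume S: "S \<in> Pow (kernel_positions X \<phi>)"
    have K: "kernel_positions X \<phi> \<subseteq> {..<?N}" by (auto simp: kernel_positions_def)
    have "card S \<le> card (kernel_positions X \<phi>)"
      using S K by (intro card_mono) (auto intro: finite_subset)
    moreover have "card (kernel_positions X \<phi>) \<le> ?N" using card_mono[OF _ K] by simp
    ultimately have e: "?N - card S = (?N - card (kernel_positions X \<phi>)) + (card (kernel_positions X \<phi>) - card S)" by simp
    have "monom 1 n = [:0, 1 :: int:] ^ n" for n by (simp add: monom_altdef)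
    then show "monom 1 (?N - card (kernel_positions X \<phi>)) * (if ?fi S then [:0, 1:] ^ (card (kernel_positions X \<phi>) - card S) * [:1, -1:] ^ (card S - ?d) else 0)
      = (if ?fi S then [:0, 1:] ^ (?N - card S) * [:1, -1:] ^ (card S - ?d) else (0 :: int poly))"
      by (simp only: e power_add mult.assoc mult_zero_right split: if_split) simp
  qed
  have "fps_nth (Hilb_Pper X) i = coeff (\<Sum>\<phi>\<in>vertices X. monom 1 (?N - card (kernel_positions X \<phi>)) *
      hilb_poly (forms ((!) X)) (kernel_positions X \<phi>) real_homs) i" for i
  proof -
    have "Pper_degree X i \<phi> = Pper_component X \<phi> \<inter> homogeneous i" if "\<phi> \<in> vertices X" for \<phi>
      using single_in_Pper_iff[OF that] by (auto simp: Pper_degree_def)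
    then show ?thesis
      unfolding Hilb_Pper_def coeff_sum by (simp add: component_degree[OF G])
  qed
  then have "Hilb_Pper X = fps_of_poly (\<Sum>\<phi>\<in>vertices X. monom 1 (?N - card (kernel_positions X \<phi>)) *
      hilb_poly (forms ((!) X)) (kernel_positions X \<phi>) real_homs)"
    by (simp add: fps_eq_iff)
  then show ?thesis unfolding comp sum_vertices[OF G X] .
qed

lemma fps_to_fls_sum: "fps_to_fls (\<Sum>i\<in>I. f i) = (\<Sum>i\<in>I. fps_to_fls (f i))"
  by (induction I rule: infinite_finite_induct) simp_all

text \<open>The factor for the rank defect becomes a power of 0: it is 1 for subsets of full rank
  and 0 for all others.\<close>

lemma arith_Tutte_1:
  fixes X :: "'g::ab_group_add list"
  assumes G: "fin_gen TYPE('g)"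
  shows "arith_Tutte X 1 (b :: 'r::comm_ring_1) = (\<Sum>S\<in>Pow {..<length X}.
    if finite_index UNIV (zmod.span ((!) X ` S))
    then of_nat (arith_mult ((!) X ` S)) * (b - 1) ^ (card S - zrank (UNIV :: 'g set)) else 0)"
  unfolding arith_Tutte_def
proof (rule sum.cong[OF refl])
  fix S assume "S \<in> Pow {..<length X}"
  then have S: "set (nths X S) = (!) X ` S" by (auto simp: set_nths)
  let ?K = "zmod.span ((!) X ` S)"
  note z = zrank_eq_iff_finite_index[OF G zmod.subspace_span, of "(!) X ` S"]
  show "(let H = set (nths X S); r = zrank (zmod.span H)
        in of_nat (arith_mult H) * (1 - 1) ^ (zrank (UNIV :: 'g set) - r) * (b - 1) ^ (card S - r))
      = (if finite_index UNIV ?K then of_nat (arith_mult ((!) X ` S)) * (b - 1) ^ (card S - zrank (UNIV :: 'g set)) else 0)"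
  proof (cases "finite_index UNIV ?K")
    case True
    then have "zrank ?K = zrank (UNIV :: 'g set)" using z by simp
    then show ?thesis using True by (simp add: S Let_def)
  next
    case False
    then have "zrank (UNIV :: 'g set) - zrank ?K > 0" using z by simp
    then have "(0 :: 'r) ^ (zrank (UNIV :: 'g set) - zrank ?K) = 0" by (rule zero_power)
    then show ?thesis using False by (simp add: S Let_def)
  qed
qed

text \<open>Term by term, q^(N-|S|) (1-q)^(|S|-d) = q^(N-d) (1/q - 1)^(|S|-d). Laurent series
  provide 1/q.\<close>

theorem Hilb_Pper_arith_Tutte:
  fixes X :: "'g::ab_group_add list"
  assumes G: "fin_gen TYPE('g)" and X: "finite_index UNIV (zmod.span (set X))"
  shows "fps_to_fls (Hilb_Pper X) = fls_X_intpow (int (length X) - int (zrank (UNIV :: 'g set))) *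
    arith_Tutte X 1 (fls_X_inv :: int fls)"
  unfolding Hilb_Pper_poly[OF assms] arith_Tutte_1[OF G] fps_of_poly_sum fps_to_fls_sum sum_distrib_left
proof (rule sum.cong[OF refl])
  fix S assume "S \<in> Pow {..<length X}"
  then have S: "finite S" "card S \<le> length X"
    using card_mono[of "{..<length X}" S] by (auto intro: finite_subset)
  let ?d = "zrank (UNIV :: 'g set)" and ?N = "length X"
  show "fps_to_fls (fps_of_poly (if finite_index UNIV (zmod.span ((!) X ` S))
        then of_nat (arith_mult ((!) X ` S)) * ([:0, 1:] ^ (?N - card S) * [:1, -1:] ^ (card S - ?d)) else 0))
      = fls_X_intpow (int ?N - int ?d) * (if finite_index UNIV (zmod.span ((!) X ` S))
        then of_nat (arith_mult ((!) X ` S)) * (fls_X_inv - 1) ^ (card S - ?d) else (0 :: int fls))"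
  proof (cases "finite_index UNIV (zmod.span ((!) X ` S))")
    case True
    have d: "?d \<le> card S" using finite_index_card_ge[OF G S(1) True] .
    have p: "fps_of_poly [:1, -1 :: int:] = 1 - fps_X"
      by (simp add: fps_eq_iff coeff_pCons split: nat.split)
    have m: "fps_of_poly (of_nat k) = (of_nat k :: int fps)" for k
      by (simp add: of_nat_poly fps_of_poly_const fps_of_nat)
    have x: "1 - fls_X = (fls_X :: int fls) * (fls_X_inv - 1)"
      by (simp add: right_diff_distrib fls_X_times_conv_shift)
    have "(fls_X :: int fls) ^ (?N - card S) * fls_X ^ (card S - ?d) = fls_X ^ (?N - ?d)"
      using d S(2) by (simp add: power_add[symmetric])
    also have "\<dots> = fls_X_intpow (int ?N - int ?d)"
      using d S(2) by (simp add: fls_X_power_conv_shift_1 of_nat_diff)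
    finally have e: "(fls_X :: int fls) ^ (?N - card S) * fls_X ^ (card S - ?d) = fls_X_intpow (int ?N - int ?d)" .
    have "fps_to_fls (fps_of_poly (of_nat (arith_mult ((!) X ` S)) * ([:0, 1:] ^ (?N - card S) * [:1, -1:] ^ (card S - ?d))))
        = of_nat (arith_mult ((!) X ` S)) * (fls_X ^ (?N - card S) * (1 - fls_X :: int fls) ^ (card S - ?d))"
      unfolding fps_of_poly_mult fps_of_poly_power fps_to_fls_power fls_times_fps_to_fls m p
        fps_of_poly_fps_X by (simp add: fps_to_fls_of_nat)
    also have "\<dots> = of_nat (arith_mult ((!) X ` S)) * ((fls_X ^ (?N - card S) * fls_X ^ (card S - ?d)) * (fls_X_inv - 1) ^ (card S - ?d))"
      unfolding x power_mult_distrib by (simp only: mult.assoc)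
    also have "\<dots> = fls_X_intpow (int ?N - int ?d) * (of_nat (arith_mult ((!) X ` S)) * (fls_X_inv - 1) ^ (card S - ?d))"
      unfolding e by (simp only: mult_ac)
    finally show ?thesis using True by simp
  qed simp
qed

text \<open>The total dimension is the value of the Hilbert polynomial at 1, where (1-q)^(|S|-d)
  retains only the subsets of size d. The degree bound ensures that the sum over degrees collects
  all coefficients.\<close>

lemma dim_Pper_component:
  fixes X :: "'g::ab_group_add list"
  assumes G: "fin_gen TYPE('g)"
  shows "int (dim (Pper_component X \<phi>)) = (\<Sum>S\<in>Pow (kernel_positions X \<phi>).
    if finite_index UNIV (zmod.span ((!) X ` S))
    then (if card S = zrank (UNIV :: 'g set) then 1 else 0) else 0)"
proof -
  let ?K = "kernel_positions X \<phi>" and ?d = "zrank (UNIV :: 'g set)"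
  let ?h = "hilb_poly (forms ((!) X)) ?K real_homs"
  obtain ks where ks: "distinct ks" "set ks = ?K" "kernel_sublist X \<phi> = map ((!) X) ks"
    using kernel_sublist_map by blast
  have fK: "finite ?K" by (simp add: kernel_positions_def)
  have len: "length ks = card ?K" using ks distinct_card by metis
  have "dim (Pper_component X \<phi>) = dim (central_P (map ((!) X) ks))"
    unfolding Pper_component_def ks(3)
    by (rule dim_injective_image[OF linear_component_map inj_on_subset[OF inj_component_map[OF G] subset_UNIV]])
  then have "int (dim (Pper_component X \<phi>)) = (\<Sum>i\<le>card ?K. coeff ?h i)"
    by (simp add: dim_central_P[OF G ks(1)] ks(2) len dim_central_deg[OF G fK])
  also have "\<dots> = poly ?h 1"
  proof -
    have "degree ?h \<le> card ?K"
      unfolding hilb_poly_forms[OF G]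
    proof (rule degree_sum_le)
      fix S assume S: "S \<in> Pow ?K"
      then have "card S \<le> card ?K" using fK by (intro card_mono) auto
      moreover have "degree ([:0, 1:] ^ (card ?K - card S) * [:1, -1:] ^ (card S - ?d) :: int poly)
          \<le> (card ?K - card S) + (card S - ?d)"
        by (intro order_trans[OF degree_mult_le] add_mono order_trans[OF degree_power_le]) simp_all
      ultimately show "degree (if finite_index UNIV (zmod.span ((!) X ` S))
          then [:0, 1:] ^ (card ?K - card S) * [:1, -1:] ^ (card S - ?d) else 0 :: int poly) \<le> card ?K"
        by auto
    qed (use fK in simp)
    then have "(\<Sum>i\<le>degree ?h. coeff ?h i) = (\<Sum>i\<le>card ?K. coeff ?h i)"
      by (intro sum.mono_neutral_left) (auto simp: coeff_eq_0)
    then show ?thesis by (simp add: poly_altdef)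
  qed
  also have "\<dots> = (\<Sum>S\<in>Pow ?K. if finite_index UNIV (zmod.span ((!) X ` S)) then (if card S = ?d then 1 else 0) else 0)"
    unfolding hilb_poly_forms[OF G] poly_sum
  proof (rule sum.cong[OF refl])
    fix S assume S: "S \<in> Pow ?K"
    then have fS: "finite S" using fK finite_subset by auto
    show "poly (if finite_index UNIV (zmod.span ((!) X ` S))
          then [:0, 1:] ^ (card ?K - card S) * [:1, -1:] ^ (card S - ?d) else 0) 1
        = (if finite_index UNIV (zmod.span ((!) X ` S)) then (if card S = ?d then 1 else 0) else (0::int))"
      using finite_index_card_ge[OF G fS] by (auto simp: poly_power power_0_left)
  qed
  finally show ?thesis .
qed

text \<open>There are finitely many vertices, so every element is a sum of \<open>single\<close>
  terms over them and the dimensions of the summands add up.\<close>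

theorem dim_Pper:
  fixes X :: "'g::ab_group_add list"
  assumes G: "fin_gen TYPE('g)" and X: "finite_index UNIV (zmod.span (set X))"
  shows "dim (Pper X) = (\<Sum>S | S \<subseteq> {..<length X} \<and> card S = zrank (UNIV :: 'g set) \<and>
    finite_index UNIV (zmod.span ((!) X ` S)). arith_mult ((!) X ` S))"
proof -
  let ?d = "zrank (UNIV :: 'g set)" and ?fi = "\<lambda>S. finite_index UNIV (zmod.span ((!) X ` S))"
  let ?V = "\<lambda>\<phi>. Poly_Mapping.single \<phi> ` Pper_component X \<phi>"
  note fin = finite_vertices_annihilator(2)[OF G X]
  have ls: "linear (Poly_Mapping.single \<phi> :: _ \<Rightarrow> ('g \<Rightarrow> complex) \<Rightarrow>\<^sub>0 'g tensor_real sym poly)" for \<phi>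
    by (rule linearI; rule poly_mapping_eqI) (simp_all add: lookup_single lookup_add lookup_scaleR when_def)
  have inj: "inj (Poly_Mapping.single \<phi> :: _ \<Rightarrow> ('g \<Rightarrow> complex) \<Rightarrow>\<^sub>0 'g tensor_real sym poly)" for \<phi>
    by (rule injI) (metis lookup_single_eq)
  have look: "Poly_Mapping.lookup (\<Sum>\<psi>\<in>vertices X. v \<psi>) \<phi> = (\<Sum>\<psi>\<in>vertices X. Poly_Mapping.lookup (v \<psi>) \<phi>)"
    for v :: "('g \<Rightarrow> complex) \<Rightarrow> ('g \<Rightarrow> complex) \<Rightarrow>\<^sub>0 'g tensor_real sym poly" and \<phi>
    by (induction rule: finite_induct[OF fin]) (simp_all add: lookup_add)
  have sum_single: "Poly_Mapping.lookup (\<Sum>\<psi>\<in>vertices X. Poly_Mapping.single \<psi> (f \<psi>)) \<phi> = (if \<phi> \<in> vertices X then f \<phi> else 0)"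
    for f :: "('g \<Rightarrow> complex) \<Rightarrow> 'g tensor_real sym poly" and \<phi>
    unfolding look using fin by (simp add: lookup_single when_def)
  have "Pper X = {\<Sum>\<phi>\<in>vertices X. v \<phi> | v. \<forall>\<phi>\<in>vertices X. v \<phi> \<in> ?V \<phi>}"
  proof (intro equalityI subsetI)
    fix F assume F: "F \<in> Pper X"
    let ?v = "\<lambda>\<phi>. Poly_Mapping.single \<phi> (Poly_Mapping.lookup F \<phi>)"
    have "F = (\<Sum>\<phi>\<in>vertices X. ?v \<phi>)"
    proof (rule poly_mapping_eqI)
      fix \<phi>
      have "Poly_Mapping.lookup F \<phi> = 0" if "\<phi> \<notin> vertices X"
        using F that by (auto simp: Pper_def in_keys_iff)
      then show "Poly_Mapping.lookup F \<phi> = Poly_Mapping.lookup (\<Sum>\<phi>\<in>vertices X. ?v \<phi>) \<phi>"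
        unfolding sum_single by simp
    qed
    moreover have "\<forall>\<phi>\<in>vertices X. ?v \<phi> \<in> ?V \<phi>" using F by (simp add: Pper_def)
    ultimately show "F \<in> {\<Sum>\<phi>\<in>vertices X. v \<phi> | v. \<forall>\<phi>\<in>vertices X. v \<phi> \<in> ?V \<phi>}"
      by (intro CollectI exI[of _ ?v] conjI)
  next
    fix F assume "F \<in> {\<Sum>\<phi>\<in>vertices X. v \<phi> | v. \<forall>\<phi>\<in>vertices X. v \<phi> \<in> ?V \<phi>}"
    then obtain v where F: "F = (\<Sum>\<phi>\<in>vertices X. v \<phi>)" and v: "\<forall>\<phi>\<in>vertices X. v \<phi> \<in> ?V \<phi>" by blast
    define f where "f \<phi> = Poly_Mapping.lookup (v \<phi>) \<phi>" for \<phi>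
    have vf: "v \<phi> = Poly_Mapping.single \<phi> (f \<phi>)" "f \<phi> \<in> Pper_component X \<phi>" if "\<phi> \<in> vertices X" for \<phi>
      using v that by (auto simp: f_def)
    have F': "F = (\<Sum>\<phi>\<in>vertices X. Poly_Mapping.single \<phi> (f \<phi>))"
      unfolding F by (rule sum.cong) (simp_all add: vf)
    show "F \<in> Pper X"
      unfolding F' Pper_def
      by (auto simp: in_keys_iff sum_single vf split: if_splits)
  qed
  also have "dim \<dots> = (\<Sum>\<phi>\<in>vertices X. dim (?V \<phi>))"
  proof (rule dim_direct_sum[OF fin])
    fix \<phi> assume "\<phi> \<in> vertices X"
    show "subspace (?V \<phi>)" by (rule linear_subspace_image[OF ls subspace_Pper_component])
    obtain C where C: "finite C" "central_P (kernel_sublist X \<phi>) \<subseteq> span C"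
    proof
      let ?C = "(\<lambda>S. pprod (nths (kernel_sublist X \<phi>) S)) ` Pow {..<length (kernel_sublist X \<phi>)}"
      show "finite ?C" by simp
      show "central_P (kernel_sublist X \<phi>) \<subseteq> span ?C" unfolding central_P_def by (rule span_mono) auto
    qed
    let ?f = "\<lambda>g. Poly_Mapping.single \<phi> (monom (pprod (outer_part X \<phi>) * g) (tors X \<phi>))"
    have lf: "linear ?f" using linear_compose[OF linear_component_map ls] by (simp add: comp_def)
    have "?V \<phi> = ?f ` central_P (kernel_sublist X \<phi>)" unfolding Pper_component_def by auto
    also have "\<dots> \<subseteq> ?f ` span C" using C(2) by blast
    also have "\<dots> = span (?f ` C)" by (rule linear_span_image[OF lf, symmetric])
    finally have "?V \<phi> \<subseteq> span (?f ` C)" .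
    moreover have "finite (?f ` C)" using C(1) by simp
    ultimately show "\<exists>F. finite F \<and> ?V \<phi> \<subseteq> span F" by blast
  next
    fix v assume v: "\<And>\<phi>. \<phi> \<in> vertices X \<Longrightarrow> v \<phi> \<in> ?V \<phi>" and z: "(\<Sum>\<phi>\<in>vertices X. v \<phi>) = 0"
    define f where "f \<phi> = Poly_Mapping.lookup (v \<phi>) \<phi>" for \<phi>
    have vf: "v \<phi> = Poly_Mapping.single \<phi> (f \<phi>)" if "\<phi> \<in> vertices X" for \<phi>
      using v[OF that] by (auto simp: f_def)
    have "(\<Sum>\<phi>\<in>vertices X. Poly_Mapping.single \<phi> (f \<phi>)) = (\<Sum>\<phi>\<in>vertices X. v \<phi>)"
      by (rule sum.cong) (simp_all add: vf)
    then have "f \<phi> = 0" if "\<phi> \<in> vertices X" for \<phi>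
      using sum_single[of f \<phi>] z that by simp
    then show "\<forall>\<phi>\<in>vertices X. v \<phi> = 0" using vf by simp
  qed
  also have "\<dots> = (\<Sum>\<phi>\<in>vertices X. dim (Pper_component X \<phi>))"
    by (intro sum.cong refl dim_injective_image[OF ls inj_on_subset[OF inj subset_UNIV]])
  finally have "int (dim (Pper X)) = (\<Sum>\<phi>\<in>vertices X. int (dim (Pper_component X \<phi>)))" by simp
  also have "\<dots> = (\<Sum>S\<in>Pow {..<length X}. if ?fi S then of_nat (arith_mult ((!) X ` S)) * (if card S = ?d then 1 else 0) else 0)"
    unfolding dim_Pper_component[OF G] sum_vertices[OF G X] ..
  also have "\<dots> = (\<Sum>S\<in>Pow {..<length X}. if card S = ?d \<and> ?fi S then int (arith_mult ((!) X ` S)) else 0)"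
    by (intro sum.cong) auto
  also have "\<dots> = (\<Sum>S\<in>{S\<in>Pow {..<length X}. card S = ?d \<and> ?fi S}. int (arith_mult ((!) X ` S)))"
    by (rule sum.inter_filter[symmetric]) simp
  also have "{S\<in>Pow {..<length X}. card S = ?d \<and> ?fi S} = {S. S \<subseteq> {..<length X} \<and> card S = ?d \<and> ?fi S}" by auto
  finally show ?thesis by (simp only: of_nat_sum[symmetric] of_nat_eq_iff)
qed

section \<open>Volumes of zonotopes\<close>

definition extrude :: "'v::real_vector set \<Rightarrow> 'v \<Rightarrow> real \<Rightarrow> 'v set" where
  "extrude K x s = {k + r *\<^sub>R x | k r. k \<in> K \<and> 0 \<le> r \<and> r \<le> s}"

lemma extrudeI: "k \<in> K \<Longrightarrow> 0 \<le> r \<Longrightarrow> r \<le> s \<Longrightarrow> k + r *\<^sub>R x \<in> extrude K x s"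
  unfolding extrude_def by auto

lemma extrudeE:
  assumes "v \<in> extrude K x s"
  obtains k r where "v = k + r *\<^sub>R x" "k \<in> K" "0 \<le> r" "r \<le> s"
  using assms unfolding extrude_def by auto

lemma extrude_0 [simp]: "extrude K x 0 = K"
proof -
  have "r = 0" if "0 \<le> r" "r \<le> 0" for r :: real using that by linarith
  then show ?thesis using extrudeI[of _ K 0 0 x] by (auto elim!: extrudeE)
qed

lemma convex_extrude:
  assumes "convex K"
  shows "convex (extrude K x s)"
proof (rule convexI)
  fix a b and u v :: real
  assume ab: "a \<in> extrude K x s" "b \<in> extrude K x s" and uv: "0 \<le> u" "0 \<le> v" "u + v = 1"
  from ab(1) obtain k r where a: "a = k + r *\<^sub>R x" "k \<in> K" "0 \<le> r" "r \<le> s" by (rule extrudeE)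
  from ab(2) obtain l q where b: "b = l + q *\<^sub>R x" "l \<in> K" "0 \<le> q" "q \<le> s" by (rule extrudeE)
  have "u * r + v * q \<le> u * s + v * s"
    by (rule add_mono[OF mult_left_mono[OF a(4) uv(1)] mult_left_mono[OF b(4) uv(2)]])
  also have "u * s + v * s = (u + v) * s" by (rule distrib_right[symmetric])
  finally have le: "u * r + v * q \<le> s" unfolding uv(3) by simp
  have "u *\<^sub>R k + v *\<^sub>R l \<in> K" using assms a(2) b(2) uv by (rule convexD)
  moreover have "u *\<^sub>R a + v *\<^sub>R b = (u *\<^sub>R k + v *\<^sub>R l) + (u * r + v * q) *\<^sub>R x"
    by (simp add: a(1) b(1) algebra_simps)
  moreover have "0 \<le> u * r + v * q" by (intro add_nonneg_nonneg mult_nonneg_nonneg a(3) b(3) uv)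
  ultimately show "u *\<^sub>R a + v *\<^sub>R b \<in> extrude K x s" using extrudeI le by metis
qed

lemma bounded_extrude:
  fixes K :: "'v::real_normed_vector set"
  assumes "bounded K"
  shows "bounded (extrude K x s)"
proof -
  obtain M where M: "\<And>k. k \<in> K \<Longrightarrow> norm k \<le> M" using assms unfolding bounded_iff by blast
  have "norm y \<le> M + \<bar>s\<bar> * norm x" if "y \<in> extrude K x s" for y
  proof -
    from that obtain k r where y: "y = k + r *\<^sub>R x" "k \<in> K" "0 \<le> r" "r \<le> s" by (rule extrudeE)
    have "norm y \<le> norm k + \<bar>r\<bar> * norm x" unfolding y(1) using norm_triangle_ineq[of k "r *\<^sub>R x"] by simp
    moreover have "\<bar>r\<bar> * norm x \<le> \<bar>s\<bar> * norm x" using y(3,4) by (intro mult_right_mono) auto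
    ultimately show ?thesis using M[OF y(2)] by linarith
  qed
  then show ?thesis unfolding bounded_iff by blast
qed

lemma extrude_mono: "s \<le> s' \<Longrightarrow> extrude K x s \<subseteq> extrude K x s'"
  by (auto elim!: extrudeE intro!: extrudeI)

text \<open>
  On each line parallel to \<open>x\<close>, growing the segment only moves the upper end of the section; the
  added caps are translates of each other, so the volume is affine in the length.
\<close>

lemma extrude_cap:
  assumes K: "convex K" and s: "0 \<le> s" "0 \<le> h"
  shows "extrude K x (s + h) - extrude K x s = (+) (s *\<^sub>R x) ` (extrude K x h - K)"
proof (intro equalityI subsetI)
  fix y assume y: "y \<in> extrude K x (s + h) - extrude K x s"
  then have "y \<in> extrude K x (s + h)" by blast
  then obtain k r where kr: "y = k + r *\<^sub>R x" "k \<in> K" "0 \<le> r" "r \<le> s + h" by (rule extrudeE)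
  have "r > s"
  proof (rule ccontr)
    assume "\<not> r > s"
    then have "y \<in> extrude K x s" unfolding kr(1) using kr by (intro extrudeI) auto
    then show False using y by blast
  qed
  then have "k + (r - s) *\<^sub>R x \<in> extrude K x h" using kr by (intro extrudeI) auto
  moreover have "k + (r - s) *\<^sub>R x \<notin> K"
  proof
    assume "k + (r - s) *\<^sub>R x \<in> K"
    moreover have "y = (k + (r - s) *\<^sub>R x) + s *\<^sub>R x" by (simp add: kr(1) algebra_simps)
    ultimately have "y \<in> extrude K x s" using s by (metis extrudeI order_refl)
    then show False using y by blast
  qed
  moreover have "y = s *\<^sub>R x + (k + (r - s) *\<^sub>R x)" by (simp add: kr(1) algebra_simps)
  ultimately show "y \<in> (+) (s *\<^sub>R x) ` (extrude K x h - K)" by blast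
next
  fix y assume "y \<in> (+) (s *\<^sub>R x) ` (extrude K x h - K)"
  then obtain z where z: "y = s *\<^sub>R x + z" "z \<in> extrude K x h" "z \<notin> K" by blast
  from z(2) obtain k r where kr: "z = k + r *\<^sub>R x" "k \<in> K" "0 \<le> r" "r \<le> h" by (rule extrudeE)
  have "y = k + (s + r) *\<^sub>R x" by (simp add: z(1) kr(1) algebra_simps)
  then have "y \<in> extrude K x (s + h)" using kr s extrudeI[of k K "s + r" "s + h" x] by simp
  moreover have "y \<notin> extrude K x s"
  proof
    assume "y \<in> extrude K x s"
    then obtain k' r' where kr': "y = k' + r' *\<^sub>R x" "k' \<in> K" "0 \<le> r'" "r' \<le> s" by (rule extrudeE)
    \<comment> \<open>On a line parallel to \<open>x\<close> the point \<open>z\<close> lies between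
      \<open>k\<close> and \<open>k'\<close>, at parameters \<open>- r\<close> and \<open>c\<close>
      from it, so convexity puts it into \<open>K\<close>. If both parameters are 0, then
      \<open>z = k\<close>.\<close>
    define c where "c = s - r'"
    have c: "0 \<le> c" using kr'(4) by (simp add: c_def)
    have k': "k' = z + c *\<^sub>R x" using z(1) kr'(1) by (simp add: c_def algebra_simps)
    have "z \<in> K"
    proof (cases "r + c = 0")
      case True
      then have "r = 0" using kr(3) c by linarith
      then show ?thesis using kr by simp
    next
      case False
      then have pos: "r + c > 0" using kr(3) c by linarith
      have "(c / (r + c)) *\<^sub>R k + (r / (r + c)) *\<^sub>R k' \<in> K"
        using kr c pos kr'(2) by (intro convexD[OF K]) (auto simp: add_divide_distrib[symmetric] add.commute)
      moreover have "(c / (r + c)) *\<^sub>R k + (r / (r + c)) *\<^sub>R k' = z"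
      proof -
        have k: "k = z - r *\<^sub>R x" using kr(1) by simp
        have "(c / (r + c)) *\<^sub>R (z - r *\<^sub>R x) + (r / (r + c)) *\<^sub>R (z + c *\<^sub>R x) =
            (c / (r + c) + r / (r + c)) *\<^sub>R z + (r / (r + c) * c - c / (r + c) * r) *\<^sub>R x"
          by (simp add: algebra_simps)
        then have "(c / (r + c)) *\<^sub>R k + (r / (r + c)) *\<^sub>R k' =
            (c / (r + c) + r / (r + c)) *\<^sub>R z + (r / (r + c) * c - c / (r + c) * r) *\<^sub>R x"
          by (simp only: k k')
        moreover have "c / (r + c) + r / (r + c) = 1" using pos by (simp add: add_divide_distrib[symmetric] add.commute)
        ultimately show ?thesis by (simp add: mult.commute)
      qed
      ultimately show ?thesis by simp
    qed
    then show False using z(3) by blast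
  qed
  ultimately show "y \<in> extrude K x (s + h) - extrude K x s" by blast
qed

text \<open>Each further unit of length adds a translate of the first cap. Natural lengths are
  enough for the comparison of polynomials below.\<close>

lemma measure_extrude_nat:
  fixes K :: "'v::euclidean_space set"
  assumes K: "convex K" "bounded K"
  shows "measure lebesgue (extrude K x (real n)) =
    measure lebesgue K + real n * (measure lebesgue (extrude K x 1) - measure lebesgue K)"
proof -
  have meas: "extrude K x s \<in> lmeasurable" for s
    by (rule measurable_convex[OF convex_extrude[OF K(1)] bounded_extrude[OF K(2)]])
  have diff: "measure lebesgue (extrude K x t - extrude K x s) = measure lebesgue (extrude K x t) - measure lebesgue (extrude K x s)"
    if "s \<le> t" for s t
    by (rule measurable_measure_Diff[OF meas fmeasurableD[OF meas] extrude_mono[OF that]])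
  show ?thesis
  proof (induction n)
    case (Suc n)
    have "measure lebesgue (extrude K x (real n + 1) - extrude K x (real n)) = measure lebesgue (extrude K x 1 - K)"
      using extrude_cap[OF K(1), of "real n" 1 x] by (simp add: measure_translation)
    then have "measure lebesgue (extrude K x (real n + 1)) - measure lebesgue (extrude K x (real n))
        = measure lebesgue (extrude K x 1) - measure lebesgue K"
      using diff[of "real n" "real n + 1"] diff[of 0 1] by simp
    then show ?case using Suc by (simp add: algebra_simps)
  qed simp
qed

section \<open>Sums of segments and the volume polynomial\<close>

definition zono_sum :: "'v::real_vector set \<Rightarrow> ('i \<Rightarrow> 'v) \<Rightarrow> ('i \<Rightarrow> real) \<Rightarrow> 'i set \<Rightarrow> 'v set" where
  "zono_sum K y t A = {k + (\<Sum>j\<in>A. r j *\<^sub>R y j) | k r. k \<in> K \<and> (\<forall>j\<in>A. 0 \<le> r j \<and> r j \<le> t j)}"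

lemma zono_sumI:
  "k \<in> K \<Longrightarrow> (\<And>j. j \<in> A \<Longrightarrow> 0 \<le> r j \<and> r j \<le> t j) \<Longrightarrow> k + (\<Sum>j\<in>A. r j *\<^sub>R y j) \<in> zono_sum K y t A"
  unfolding zono_sum_def by auto

lemma zono_sumE:
  assumes "v \<in> zono_sum K y t A"
  obtains k r where "v = k + (\<Sum>j\<in>A. r j *\<^sub>R y j)" "k \<in> K" "\<forall>j\<in>A. 0 \<le> r j \<and> r j \<le> t j"
  using assms unfolding zono_sum_def by auto

lemma zono_sum_empty [simp]: "zono_sum K y t {} = K"
  by (simp add: zono_sum_def)

lemma zono_sum_insert:
  assumes "finite A" "x \<notin> A"
  shows "zono_sum K y t (insert x A) = extrude (zono_sum K y t A) (y x) (t x)"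
proof (intro equalityI subsetI)
  fix v assume "v \<in> zono_sum K y t (insert x A)"
  then obtain k r where v: "v = k + (\<Sum>j\<in>insert x A. r j *\<^sub>R y j)" "k \<in> K" "\<forall>j\<in>insert x A. 0 \<le> r j \<and> r j \<le> t j"
    by (rule zono_sumE)
  have "v = (k + (\<Sum>j\<in>A. r j *\<^sub>R y j)) + r x *\<^sub>R y x" using v(1) assms by (simp add: algebra_simps)
  moreover have "k + (\<Sum>j\<in>A. r j *\<^sub>R y j) \<in> zono_sum K y t A" using v(2,3) by (intro zono_sumI) auto
  ultimately show "v \<in> extrude (zono_sum K y t A) (y x) (t x)" using v(3) extrudeI by (metis insertI1)
next
  fix v assume "v \<in> extrude (zono_sum K y t A) (y x) (t x)"
  then obtain w q where v: "v = w + q *\<^sub>R y x" "w \<in> zono_sum K y t A" "0 \<le> q" "q \<le> t x"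
    by (rule extrudeE)
  from v(2) obtain k r where w: "w = k + (\<Sum>j\<in>A. r j *\<^sub>R y j)" "k \<in> K" "\<forall>j\<in>A. 0 \<le> r j \<and> r j \<le> t j"
    by (rule zono_sumE)
  have "(\<Sum>j\<in>A. (r(x := q)) j *\<^sub>R y j) = (\<Sum>j\<in>A. r j *\<^sub>R y j)"
    using assms(2) by (intro sum.cong) auto
  then have "v = k + (\<Sum>j\<in>insert x A. (r(x := q)) j *\<^sub>R y j)" using v(1) w(1) assms by (simp add: algebra_simps)
  moreover have "\<forall>j\<in>insert x A. 0 \<le> (r(x := q)) j \<and> (r(x := q)) j \<le> t j" using v(3,4) w(3) by simp
  ultimately show "v \<in> zono_sum K y t (insert x A)" using w(2) by (simp only: zono_sumI)
qed

lemma extrude_commute: "extrude (extrude K x s) y t = extrude (extrude K y t) x s"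
proof -
  have "extrude (extrude K x s) y t \<subseteq> extrude (extrude K y t) x s" for x y :: 'a and s t
  proof
    fix v assume "v \<in> extrude (extrude K x s) y t"
    then obtain w q where w: "v = w + q *\<^sub>R y" "w \<in> extrude K x s" "0 \<le> q" "q \<le> t" by (rule extrudeE)
    from w(2) obtain k r where k: "w = k + r *\<^sub>R x" "k \<in> K" "0 \<le> r" "r \<le> s" by (rule extrudeE)
    have "k + q *\<^sub>R y + r *\<^sub>R x \<in> extrude (extrude K y t) x s" using w k by (intro extrudeI) auto
    then show "v \<in> extrude (extrude K y t) x s" by (simp add: w(1) k(1) algebra_simps)
  qed
  then show ?thesis by blast
qed

lemma zono_sum_extrude:
  assumes "finite A"
  shows "zono_sum (extrude K v s) y t A = extrude (zono_sum K y t A) v s"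
  using assms
proof (induction A rule: finite_induct)
  case (insert x A)
  then show ?case by (simp add: zono_sum_insert extrude_commute[of _ v])
qed simp

lemma convex_bounded_zono_sum:
  fixes K :: "'v::real_normed_vector set"
  assumes "finite A" "convex K" "bounded K"
  shows "convex (zono_sum K y t A)" "bounded (zono_sum K y t A)"
  using assms(1)
  by (induction A rule: finite_induct) (simp_all add: assms zono_sum_insert convex_extrude bounded_extrude)

text \<open>The body \<open>K\<close> stays free in the induction: the coefficient of a new
  multiplicity is the volume with one unit segment added to \<open>K\<close> minus the volume
  without it, and both expand by the induction hypothesis.\<close>

lemma measure_zono_sum_multiaffine:
  fixes y :: "'i \<Rightarrow> 'v::euclidean_space"
  assumes A: "finite A" and K: "convex K" "bounded K"
  shows "\<exists>c. \<forall>t :: 'i \<Rightarrow> nat. measure lebesgue (zono_sum K y (\<lambda>j. real (t j)) A) =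
    (\<Sum>S\<in>Pow A. c S * (\<Prod>k\<in>S. real (t k)))"
  using A K
proof (induction A arbitrary: K rule: finite_induct)
  case empty
  show ?case by (intro exI[of _ "\<lambda>_. measure lebesgue K"]) simp
next
  case (insert x A)
  let ?K' = "extrude K (y x) 1"
  obtain c where c: "\<And>t :: 'i \<Rightarrow> nat. measure lebesgue (zono_sum K y (\<lambda>j. real (t j)) A) = (\<Sum>S\<in>Pow A. c S * (\<Prod>k\<in>S. real (t k)))"
    using insert(3)[OF insert(4,5)] by blast
  obtain c' where c': "\<And>t :: 'i \<Rightarrow> nat. measure lebesgue (zono_sum ?K' y (\<lambda>j. real (t j)) A) = (\<Sum>S\<in>Pow A. c' S * (\<Prod>k\<in>S. real (t k)))"
    using insert(3)[OF convex_extrude[OF insert(4)] bounded_extrude[OF insert(5)]] by blast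
  define C where "C S = (if x \<in> S then c' (S - {x}) - c (S - {x}) else c S)" for S
  show ?case
  proof (intro exI[of _ C] allI)
    fix t :: "'i \<Rightarrow> nat"
    let ?Z = "zono_sum K y (\<lambda>j. real (t j)) A"
    have "measure lebesgue (zono_sum K y (\<lambda>j. real (t j)) (insert x A)) =
        measure lebesgue ?Z + real (t x) * (measure lebesgue (extrude ?Z (y x) 1) - measure lebesgue ?Z)"
      unfolding zono_sum_insert[OF insert(1,2)]
      by (rule measure_extrude_nat[OF convex_bounded_zono_sum[OF insert(1,4,5)]])
    also have "extrude ?Z (y x) 1 = zono_sum ?K' y (\<lambda>j. real (t j)) A"
      by (rule zono_sum_extrude[OF insert(1), symmetric])
    also have "measure lebesgue ?Z + real (t x) * (measure lebesgue (zono_sum ?K' y (\<lambda>j. real (t j)) A) - measure lebesgue ?Z)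
        = (\<Sum>S\<in>Pow A. c S * (\<Prod>k\<in>S. real (t k))) + (\<Sum>S\<in>Pow A. (c' S - c S) * (real (t x) * (\<Prod>k\<in>S. real (t k))))"
      unfolding c c' by (simp add: sum_distrib_left sum_subtractf algebra_simps)
    also have "\<dots> = (\<Sum>S\<in>Pow A. C S * (\<Prod>k\<in>S. real (t k))) + (\<Sum>S\<in>Pow A. C (insert x S) * (\<Prod>k\<in>insert x S. real (t k)))"
    proof (intro arg_cong2[of _ _ _ _ "(+)"] sum.cong refl)
      fix S assume "S \<in> Pow A"
      then have S: "x \<notin> S" "finite S" using insert(1,2) finite_subset by auto
      show "c S * (\<Prod>k\<in>S. real (t k)) = C S * (\<Prod>k\<in>S. real (t k))" using S by (simp add: C_def)
      show "(c' S - c S) * (real (t x) * (\<Prod>k\<in>S. real (t k))) = C (insert x S) * (\<Prod>k\<in>insert x S. real (t k))"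
        using S by (simp add: C_def)
    qed
    also have "\<dots> = (\<Sum>S\<in>Pow (insert x A). C S * (\<Prod>k\<in>S. real (t k)))"
      by (rule sum_Pow_insert[OF insert(1,2), symmetric])
    finally show "measure lebesgue (zono_sum K y (\<lambda>j. real (t j)) (insert x A)) = (\<Sum>S\<in>Pow (insert x A). C S * (\<Prod>k\<in>S. real (t k)))" .
  qed
qed

text \<open>The link to homogeneity: multiplicity \<open>m\<close> on \<open>T\<close> and 0
  elsewhere is a dilation by \<open>m\<close>.\<close>

lemma zono_sum_scale:
  assumes A: "finite A" "T \<subseteq> A" and m: "m > 0"
  shows "zono_sum {0} y (\<lambda>j. m * (if j \<in> T then 1 else 0)) A = (*\<^sub>R) m ` zono_sum {0} y (\<lambda>_. 1) T"
proof (intro equalityI subsetI)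
  fix v assume "v \<in> zono_sum {0} y (\<lambda>j. m * (if j \<in> T then 1 else 0)) A"
  then obtain r where v: "v = (\<Sum>j\<in>A. r j *\<^sub>R y j)" "\<forall>j\<in>A. 0 \<le> r j \<and> r j \<le> m * (if j \<in> T then 1 else 0)"
    by (auto elim: zono_sumE)
  have "r j = 0" if "j \<in> A - T" for j
  proof -
    have "0 \<le> r j" "r j \<le> 0" using v(2) that by auto
    then show ?thesis by linarith
  qed
  then have "v = (\<Sum>j\<in>T. r j *\<^sub>R y j)" unfolding v(1) using A by (intro sum.mono_neutral_right) auto
  also have "\<dots> = m *\<^sub>R (\<Sum>j\<in>T. (r j / m) *\<^sub>R y j)" using m by (simp add: scaleR_sum_right)
  finally have "v = m *\<^sub>R (\<Sum>j\<in>T. (r j / m) *\<^sub>R y j)" .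
  moreover have "0 \<le> r j \<and> r j \<le> m" if "j \<in> T" for j using bspec[OF v(2), of j] A(2) that by auto
  then have "\<forall>j\<in>T. 0 \<le> r j / m \<and> r j / m \<le> 1" using m by (simp add: divide_le_eq)
  then have "(\<Sum>j\<in>T. (r j / m) *\<^sub>R y j) \<in> zono_sum {0} y (\<lambda>_. 1) T"
    using zono_sumI[of 0 "{0}" T "\<lambda>j. r j / m" "\<lambda>_. 1" y] by simp
  ultimately show "v \<in> (*\<^sub>R) m ` zono_sum {0} y (\<lambda>_. 1) T" by blast
next
  fix v assume "v \<in> (*\<^sub>R) m ` zono_sum {0} y (\<lambda>_. 1) T"
  then obtain w where w: "v = m *\<^sub>R w" "w \<in> zono_sum {0} y (\<lambda>_. 1) T" by (rule imageE)
  from w(2) obtain r where "w = (\<Sum>j\<in>T. r j *\<^sub>R y j)" "\<forall>j\<in>T. 0 \<le> r j \<and> r j \<le> 1"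
    by (auto elim: zono_sumE)
  then have v: "v = m *\<^sub>R (\<Sum>j\<in>T. r j *\<^sub>R y j)" "\<forall>j\<in>T. 0 \<le> r j \<and> r j \<le> 1"
    using w(1) by simp_all
  let ?r = "\<lambda>j. if j \<in> T then m * r j else 0"
  have "(\<Sum>j\<in>A. ?r j *\<^sub>R y j) = (\<Sum>j\<in>T. ?r j *\<^sub>R y j)" using A by (intro sum.mono_neutral_right) auto
  also have "\<dots> = (\<Sum>j\<in>T. m *\<^sub>R (r j *\<^sub>R y j))" by (intro sum.cong) auto
  also have "\<dots> = v" unfolding v(1) by (simp add: scaleR_sum_right)
  finally have "v = 0 + (\<Sum>j\<in>A. ?r j *\<^sub>R y j)" by simp
  moreover have "\<forall>j\<in>A. 0 \<le> ?r j \<and> ?r j \<le> m * (if j \<in> T then 1 else 0)" using v(2) m by auto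
  ultimately show "v \<in> zono_sum {0} y (\<lambda>j. m * (if j \<in> T then 1 else 0)) A"
    by (simp only: zono_sumI insertI1)
qed

text \<open>
  Being affine in every edge multiplicity and homogeneous of degree \<open>DIM('v)\<close>, the volume has only the
  square-free coefficients of that degree.
\<close>

theorem measure_zonotope:
  fixes y :: "'i \<Rightarrow> 'v::euclidean_space"
  assumes A: "finite A"
  shows "measure lebesgue (zono_sum {0} y (\<lambda>_. 1) A) =
    (\<Sum>S | S \<subseteq> A \<and> card S = DIM('v). measure lebesgue (zono_sum {0} y (\<lambda>_. 1) S))"
proof -
  let ?V = "\<lambda>S. measure lebesgue (zono_sum {0} y (\<lambda>_. 1) S)"
  have K: "convex {0 :: 'v}" "bounded {0 :: 'v}" by auto
  obtain c where c: "\<And>t :: 'i \<Rightarrow> nat. measure lebesgue (zono_sum {0} y (\<lambda>j. real (t j)) A) = (\<Sum>S\<in>Pow A. c S * (\<Prod>k\<in>S. real (t k)))"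
    using measure_zono_sum_multiaffine[OF A K] by blast
  \<comment> \<open>With multiplicity \<open>m\<close> on \<open>T\<close> and 0 off it, the volume
    is a polynomial in \<open>m\<close> and at the same time \<open>m ^ DIM('v)\<close> times the
    volume for \<open>T\<close>. Comparing the coefficients of that power leaves the subsets of size
    \<open>DIM('v)\<close>.\<close>
  have key: "?V T = (\<Sum>S | S \<subseteq> T \<and> card S = DIM('v). c S)" if T: "T \<subseteq> A" for T
  proof -
    have fT: "finite T" using T A finite_subset by blast
    define p where "p = (\<Sum>S\<in>Pow T. monom (c S) (card S)) - monom (?V T) DIM('v)"
    have root: "poly p (real m) = 0" if m: "m > 0" for m
    proof -
      let ?t = "\<lambda>j. if j \<in> T then m else 0"
      have "real m ^ DIM('v) * ?V T = measure lebesgue ((*\<^sub>R) (real m) ` zono_sum {0} y (\<lambda>_. 1) T)"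
        using measure_lebesgue_affine[of "real m" 0 "zono_sum {0} y (\<lambda>_. 1) T"] by simp
      also have "(*\<^sub>R) (real m) ` zono_sum {0} y (\<lambda>_. 1) T = zono_sum {0} y (\<lambda>j. real m * (if j \<in> T then 1 else 0)) A"
        using m by (intro zono_sum_scale[OF A T, symmetric]) simp
      also have "(\<lambda>j. real m * (if j \<in> T then 1 else 0)) = (\<lambda>j. real (?t j))" by auto
      also have "measure lebesgue (zono_sum {0} y (\<lambda>j. real (?t j)) A) = (\<Sum>S\<in>Pow A. c S * (\<Prod>k\<in>S. real (?t k)))" by (rule c)
      also have "\<dots> = (\<Sum>S\<in>Pow T. c S * (\<Prod>k\<in>S. real (?t k)))"
      proof (rule sum.mono_neutral_right)
        show "\<forall>S\<in>Pow A - Pow T. c S * (\<Prod>k\<in>S. real (?t k)) = 0"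
        proof
          fix S assume S: "S \<in> Pow A - Pow T"
          then have "finite S" using A finite_subset by auto
          moreover have "\<exists>k\<in>S. real (?t k) = 0" using S by auto
          ultimately have "(\<Prod>k\<in>S. real (?t k)) = 0" by (rule prod_zero)
          then show "c S * (\<Prod>k\<in>S. real (?t k)) = 0" by simp
        qed
      qed (use A T in auto)
      also have "\<dots> = (\<Sum>S\<in>Pow T. c S * real m ^ card S)"
      proof (rule sum.cong[OF refl])
        fix S assume "S \<in> Pow T"
        then have "(\<Prod>k\<in>S. real (?t k)) = (\<Prod>k\<in>S. real m)" by (intro prod.cong) auto
        then show "c S * (\<Prod>k\<in>S. real (?t k)) = c S * real m ^ card S" by simp
      qed
      finally show ?thesis by (simp add: p_def poly_sum poly_monom mult.commute)
    qed
    have "p = 0"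
    proof (rule ccontr)
      assume "p \<noteq> 0"
      then have "finite {x. poly p x = 0}" by (rule poly_roots_finite)
      moreover have "real ` {0<..} \<subseteq> {x. poly p x = 0}" using root by auto
      ultimately have "finite (real ` {0<..})" by (rule finite_subset[rotated])
      then have "finite {0::nat<..}" by (rule finite_imageD) simp
      then show False by (simp add: infinite_Ioi)
    qed
    then have "0 = coeff p DIM('v)" by simp
    also have "\<dots> = (\<Sum>S\<in>Pow T. if card S = DIM('v) then c S else 0) - ?V T"
      by (simp add: p_def coeff_sum coeff_monom)
    also have "(\<Sum>S\<in>Pow T. if card S = DIM('v) then c S else 0) = (\<Sum>S\<in>{S\<in>Pow T. card S = DIM('v)}. c S)"
      using fT by (intro sum.inter_filter[symmetric]) simp
    also have "{S\<in>Pow T. card S = DIM('v)} = {S. S \<subseteq> T \<and> card S = DIM('v)}" by auto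
    finally show ?thesis by simp
  qed
  \<comment> \<open>For a set of exactly this size, the formula just proved has a single
    term.\<close>
  have "?V S = c S" if S: "S \<subseteq> A" "card S = DIM('v)" for S
  proof -
    have fS: "finite S" using S(1) A finite_subset by blast
    have "{R. R \<subseteq> S \<and> card R = DIM('v)} = {S}"
      using S(2) card_subset_eq[OF fS] by auto
    then show ?thesis using key[OF S(1)] by simp
  qed
  then show ?thesis unfolding key[OF order_refl] by (intro sum.cong) auto
qed

section \<open>Lattices and fundamental domains\<close>

lemma zmod_span_finite_real:
  fixes C :: "'v::real_vector set"
  assumes "finite C"
  shows "zmod.span C = {\<Sum>b\<in>C. of_int (u b) *\<^sub>R b | u. True}"
proof -
  have z: "zscale k v = of_int k *\<^sub>R v" for k and v :: 'v
    using additive_zscale[of "\<lambda>x. x" k v] by simp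
  show ?thesis unfolding zmod.span_finite[OF assms] by (auto simp: z image_def)
qed

lemma fundamental_regionE:
  assumes "v \<in> fundamental_region C"
  obtains t where "v = (\<Sum>b\<in>C. t b *\<^sub>R b)" "\<And>b. b \<in> C \<Longrightarrow> 0 \<le> t b \<and> t b < 1"
  using assms unfolding fundamental_region_def by auto

lemma fundamental_regionI:
  "(\<And>b. b \<in> C \<Longrightarrow> 0 \<le> t b \<and> t b < 1) \<Longrightarrow> (\<Sum>b\<in>C. t b *\<^sub>R b) \<in> fundamental_region C"
  unfolding fundamental_region_def by auto

lemma convex_fundamental_region: "convex (fundamental_region C)"
proof (rule convexI)
  fix v w :: 'a and a b :: real
  assume vw: "v \<in> fundamental_region C" "w \<in> fundamental_region C" and ab: "0 \<le> a" "0 \<le> b" "a + b = 1"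
  from vw(1) obtain t where t: "v = (\<Sum>b\<in>C. t b *\<^sub>R b)" "\<And>b. b \<in> C \<Longrightarrow> 0 \<le> t b \<and> t b < 1"
    by (rule fundamental_regionE) blast
  from vw(2) obtain s where s: "w = (\<Sum>b\<in>C. s b *\<^sub>R b)" "\<And>b. b \<in> C \<Longrightarrow> 0 \<le> s b \<and> s b < 1"
    by (rule fundamental_regionE) blast
  have "a *\<^sub>R v + b *\<^sub>R w = (\<Sum>x\<in>C. (a * t x + b * s x) *\<^sub>R x)"
    by (simp add: t(1) s(1) scaleR_sum_right sum.distrib[symmetric] algebra_simps)
  moreover have "0 \<le> a * t x + b * s x \<and> a * t x + b * s x < 1" if "x \<in> C" for x
    using t(2)[OF that] s(2)[OF that] ab convex_bound_lt[of "t x" 1 "s x" a b] by simp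
  ultimately show "a *\<^sub>R v + b *\<^sub>R w \<in> fundamental_region C"
    using fundamental_regionI[of C "\<lambda>x. a * t x + b * s x"] by simp
qed

lemma bounded_fundamental_region:
  assumes "finite C"
  shows "bounded (fundamental_region C)"
proof -
  have "norm v \<le> (\<Sum>b\<in>C. norm b)" if "v \<in> fundamental_region C" for v
  proof -
    from that obtain t where t: "v = (\<Sum>b\<in>C. t b *\<^sub>R b)" "\<And>b. b \<in> C \<Longrightarrow> 0 \<le> t b \<and> t b < 1"
      by (rule fundamental_regionE) blast
    have "norm v \<le> (\<Sum>b\<in>C. norm (t b *\<^sub>R b))" unfolding t(1) by (rule norm_sum)
    also have "\<dots> \<le> (\<Sum>b\<in>C. norm b)"
    proof (rule sum_mono)
      fix b assume "b \<in> C"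
      then have "\<bar>t b\<bar> \<le> 1" using t(2)[of b] by simp
      then show "norm (t b *\<^sub>R b) \<le> norm b" by (simp add: mult_left_le_one_le)
    qed
    finally show ?thesis .
  qed
  then show ?thesis unfolding bounded_iff by blast
qed

lemma measurable_fundamental_region: "finite C \<Longrightarrow> fundamental_region C \<in> lmeasurable"
  by (rule measurable_convex[OF convex_fundamental_region bounded_fundamental_region])

text \<open>Exact tiling by translates under a subgroup \<open>L\<close>, in a purely set-theoretic
  form: half-open cells and finite unions of translated cells are treated alike.\<close>

definition fund_domain :: "'v::ab_group_add set \<Rightarrow> 'v set \<Rightarrow> bool" where
  "fund_domain L D \<longleftrightarrow> (\<forall>v. \<exists>\<mu>\<in>L. v - \<mu> \<in> D) \<and> (\<forall>\<mu>\<in>L. \<forall>v\<in>D. v + \<mu> \<in> D \<longrightarrow> \<mu> = 0)"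

text \<open>Existence by rounding the coordinates down; uniqueness because two numbers in [0, 1)
  with integer difference are equal.\<close>

lemma fund_domain_fundamental_region:
  fixes C :: "'v::euclidean_space set"
  assumes C: "independent C" "span C = UNIV"
  shows "fund_domain (zmod.span C) (fundamental_region C)"
proof -
  have fC: "finite C" using C(1) by (rule independent_imp_finite)
  show ?thesis
    unfolding fund_domain_def
  proof (intro conjI allI ballI impI)
    fix v
    have "v \<in> span C" using C(2) by simp
    then obtain u where u: "v = (\<Sum>b\<in>C. u b *\<^sub>R b)" unfolding span_finite[OF fC] by blast
    let ?m = "\<Sum>b\<in>C. of_int \<lfloor>u b\<rfloor> *\<^sub>R b"
    have "v - ?m = (\<Sum>b\<in>C. (u b - of_int \<lfloor>u b\<rfloor>) *\<^sub>R b)"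
      by (simp add: u scaleR_left_diff_distrib sum_subtractf)
    moreover have "0 \<le> u b - of_int \<lfloor>u b\<rfloor> \<and> u b - of_int \<lfloor>u b\<rfloor> < 1" for b by linarith
    ultimately have "v - ?m \<in> fundamental_region C"
      using fundamental_regionI[of C "\<lambda>b. u b - of_int \<lfloor>u b\<rfloor>"] by simp
    moreover have "?m \<in> zmod.span C"
      unfolding zmod_span_finite_real[OF fC] by (intro CollectI exI[of _ "\<lambda>b. \<lfloor>u b\<rfloor>"]) simp
    ultimately show "\<exists>\<mu>\<in>zmod.span C. v - \<mu> \<in> fundamental_region C" by blast
  next
    fix \<mu> v assume m: "\<mu> \<in> zmod.span C" and v: "v \<in> fundamental_region C" "v + \<mu> \<in> fundamental_region C"
    obtain n where n: "\<mu> = (\<Sum>b\<in>C. of_int (n b) *\<^sub>R b)" using m unfolding zmod_span_finite_real[OF fC] by blast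
    from v(1) obtain t where t: "v = (\<Sum>b\<in>C. t b *\<^sub>R b)" "\<And>b. b \<in> C \<Longrightarrow> 0 \<le> t b \<and> t b < 1"
      by (rule fundamental_regionE) blast
    from v(2) obtain s where s: "v + \<mu> = (\<Sum>b\<in>C. s b *\<^sub>R b)" "\<And>b. b \<in> C \<Longrightarrow> 0 \<le> s b \<and> s b < 1"
      by (rule fundamental_regionE) blast
    have "(\<Sum>b\<in>C. (t b + of_int (n b) - s b) *\<^sub>R b) =
        (\<Sum>b\<in>C. t b *\<^sub>R b) + (\<Sum>b\<in>C. of_int (n b) *\<^sub>R b) - (\<Sum>b\<in>C. s b *\<^sub>R b)"
      by (simp add: scaleR_left_diff_distrib scaleR_left_distrib sum_subtractf sum.distrib)
    then have z: "(\<Sum>b\<in>C. (t b + of_int (n b) - s b) *\<^sub>R b) = 0"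
      by (simp only: t(1)[symmetric] n[symmetric] s(1)[symmetric] diff_self)
    have "n b = 0" if b: "b \<in> C" for b
    proof -
      have "t b + of_int (n b) - s b = 0" using independentD[OF C(1) fC subset_refl z b] .
      then have "\<bar>of_int (n b) :: real\<bar> < 1" using t(2)[OF b] s(2)[OF b] by linarith
      then show ?thesis by linarith
    qed
    then show "\<mu> = 0" by (simp add: n)
  qed
qed

text \<open>Cut each domain along the translates of the other and move the pieces by the group.\<close>

lemma fund_domain_emeasure_eq:
  fixes L :: "'v::euclidean_space set"
  assumes L: "countable L" "zmod.subspace L"
    and D: "D \<in> sets lebesgue" "fund_domain L D" and E: "E \<in> sets lebesgue" "fund_domain L E"
  shows "emeasure lebesgue D = emeasure lebesgue E"
proof -
  have tr: "(+) a ` S \<in> sets lebesgue" "emeasure lebesgue ((+) a ` S) = emeasure lebesgue S"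
    if "S \<in> sets lebesgue" for a :: 'v and S
    using lebesgue_sets_translation[OF that, of a] emeasure_lebesgue_affine[of 1 a S]
    by (simp_all add: ac_simps cong: image_cong_simp)
  have cut: "emeasure lebesgue P = (\<integral>\<^sup>+\<mu>. emeasure lebesgue (P \<inter> (+) \<mu> ` Q) \<partial>count_space L)"
    if P: "P \<in> sets lebesgue" and Q: "Q \<in> sets lebesgue" "fund_domain L Q" for P Q
  proof -
    have "P = (\<Union>\<mu>\<in>L. P \<inter> (+) \<mu> ` Q)"
    proof (intro equalityI subsetI)
      fix v assume v: "v \<in> P"
      obtain \<mu> where m: "\<mu> \<in> L" "v - \<mu> \<in> Q" using Q(2) unfolding fund_domain_def by blast
      then have "v \<in> (+) \<mu> ` Q" by (intro image_eqI[of _ _ "v - \<mu>"]) simp_all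
      then show "v \<in> (\<Union>\<mu>\<in>L. P \<inter> (+) \<mu> ` Q)" using v m(1) by blast
    qed blast
    moreover have "disjoint_family_on (\<lambda>\<mu>. P \<inter> (+) \<mu> ` Q) L"
      unfolding disjoint_family_on_def
    proof (intro ballI impI, rule ccontr)
      fix \<mu> \<nu> assume mn: "\<mu> \<in> L" "\<nu> \<in> L" "\<mu> \<noteq> \<nu>" "(P \<inter> (+) \<mu> ` Q) \<inter> (P \<inter> (+) \<nu> ` Q) \<noteq> {}"
      then obtain a b where ab: "a \<in> Q" "b \<in> Q" "\<mu> + a = \<nu> + b" by auto
      have "\<mu> - \<nu> \<in> L" using zmod.subspace_diff[OF L(2)] mn(1,2) by blast
      moreover have "a + (\<mu> - \<nu>) = b" using ab(3) by (simp add: algebra_simps)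
      ultimately have "\<mu> - \<nu> = 0" using Q(2) ab(1,2) unfolding fund_domain_def by blast
      then show False using mn(3) by simp
    qed
    ultimately show ?thesis
      using emeasure_UN_countable[of L "\<lambda>\<mu>. P \<inter> (+) \<mu> ` Q" lebesgue] P tr(1)[OF Q(1)] L(1) by simp
  qed
  have "emeasure lebesgue D = (\<integral>\<^sup>+\<mu>. emeasure lebesgue (D \<inter> (+) \<mu> ` E) \<partial>count_space L)"
    by (rule cut[OF D(1) E])
  \<comment> \<open>Translation by \<open>- \<mu>\<close> carries each piece of \<open>D\<close> to
    a piece of \<open>E\<close>; negating the summation index then gives the decomposition of
    \<open>E\<close>.\<close>
  also have "\<dots> = (\<integral>\<^sup>+\<mu>. emeasure lebesgue (E \<inter> (+) (- \<mu>) ` D) \<partial>count_space L)"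
  proof (rule nn_integral_cong)
    fix \<mu>
    have "(+) (- \<mu>) ` (D \<inter> (+) \<mu> ` E) = E \<inter> (+) (- \<mu>) ` D" by force
    then show "emeasure lebesgue (D \<inter> (+) \<mu> ` E) = emeasure lebesgue (E \<inter> (+) (- \<mu>) ` D)"
      using tr(2)[of "D \<inter> (+) \<mu> ` E" "- \<mu>"] D(1) tr(1)[OF E(1)] by simp
  qed
  also have "\<dots> = (\<integral>\<^sup>+\<mu>. emeasure lebesgue (E \<inter> (+) \<mu> ` D) \<partial>count_space L)"
  proof (rule nn_integral_bij_count_space[where g = uminus and f = "\<lambda>\<mu>. emeasure lebesgue (E \<inter> (+) \<mu> ` D)"])
    show "bij_betw uminus L L"
      by (rule bij_betwI[of _ _ _ uminus]) (auto intro: zmod.subspace_neg[OF L(2)])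
  qed
  also have "\<dots> = emeasure lebesgue E" by (rule cut[OF E(1) D, symmetric])
  finally show ?thesis .
qed

lemma countable_zmod_span:
  fixes C :: "'v::real_vector set"
  assumes "finite C"
  shows "countable (zmod.span C)"
proof -
  have "zmod.span C \<subseteq> (\<lambda>u. \<Sum>b\<in>C. of_int (u b) *\<^sub>R b) ` PiE C (\<lambda>_. UNIV :: int set)"
  proof
    fix v assume "v \<in> zmod.span C"
    then obtain u where u: "v = (\<Sum>b\<in>C. of_int (u b) *\<^sub>R b)" unfolding zmod_span_finite_real[OF assms] by blast
    have "v = (\<Sum>b\<in>C. of_int (restrict u C b) *\<^sub>R b)" unfolding u by (rule sum.cong) auto
    then show "v \<in> (\<lambda>u. \<Sum>b\<in>C. of_int (u b) *\<^sub>R b) ` PiE C (\<lambda>_. UNIV :: int set)"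
      by (rule image_eqI[where x = "restrict u C"]) simp
  qed
  moreover have "countable (PiE C (\<lambda>_. UNIV :: int set))" using assms by (rule countable_PiE) simp
  ultimately show ?thesis by (meson countable_image countable_subset)
qed

text \<open>The closed cell lies in every dilate of the half-open one by a factor above 1. Letting
  the factor tend to 1 shows that the missing faces have no volume.\<close>

lemma measure_closed_parallelepiped:
  fixes C :: "'v::euclidean_space set"
  assumes C: "finite C"
  shows "measure lebesgue (zono_sum {0} (\<lambda>b. b) (\<lambda>_. 1) C) = measure lebesgue (fundamental_region C)"
proof (rule antisym)
  let ?P = "zono_sum {0} (\<lambda>b. b) (\<lambda>_. 1) C" and ?F = "fundamental_region C"
  have P: "?P \<in> lmeasurable"
    using convex_bounded_zono_sum[OF C, of "{0}"] by (intro measurable_convex) auto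
  have F: "?F \<in> lmeasurable" by (rule measurable_fundamental_region[OF C])
  have "?F \<subseteq> ?P"
  proof
    fix v assume "v \<in> ?F"
    then obtain t where t: "v = (\<Sum>b\<in>C. t b *\<^sub>R b)" "\<And>b. b \<in> C \<Longrightarrow> 0 \<le> t b \<and> t b < 1"
      by (rule fundamental_regionE) blast
    show "v \<in> ?P" using zono_sumI[of 0 "{0}" C t "\<lambda>_. 1" "\<lambda>b. b"] t(2) by (simp add: t(1) less_imp_le)
  qed
  then show "measure lebesgue ?F \<le> measure lebesgue ?P"
    by (rule measure_mono_fmeasurable) (use F P in auto)
  have le: "measure lebesgue ?P \<le> (1 + e) ^ DIM('v) * measure lebesgue ?F" if e: "e > 0" for e
  proof -
    have "?P \<subseteq> (*\<^sub>R) (1 + e) ` ?F"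
    proof
      fix v assume "v \<in> ?P"
      then obtain r where r: "v = (\<Sum>b\<in>C. r b *\<^sub>R b)" "\<And>b. b \<in> C \<Longrightarrow> 0 \<le> r b \<and> r b \<le> 1"
        by (auto elim: zono_sumE)
      have "0 \<le> r b / (1 + e) \<and> r b / (1 + e) < 1" if "b \<in> C" for b
        using r(2)[OF that] e by (simp add: divide_less_eq)
      then have "(\<Sum>b\<in>C. (r b / (1 + e)) *\<^sub>R b) \<in> ?F" by (rule fundamental_regionI)
      moreover have "v = (1 + e) *\<^sub>R (\<Sum>b\<in>C. (r b / (1 + e)) *\<^sub>R b)"
        using e by (simp add: r(1) scaleR_sum_right)
      ultimately show "v \<in> (*\<^sub>R) (1 + e) ` ?F" by blast
    qed
    moreover have "(*\<^sub>R) (1 + e) ` ?F \<in> lmeasurable"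
      by (intro measurable_convex convex_scaling bounded_scaling convex_fundamental_region bounded_fundamental_region C)
    ultimately have "measure lebesgue ?P \<le> measure lebesgue ((*\<^sub>R) (1 + e) ` ?F)"
      by (intro measure_mono_fmeasurable) (use P in auto)
    also have "\<dots> = (1 + e) ^ DIM('v) * measure lebesgue ?F"
      using measure_lebesgue_affine[of "1 + e" 0 ?F] e by simp
    finally show ?thesis .
  qed
  show "measure lebesgue ?P \<le> measure lebesgue ?F"
  proof (rule tendsto_lowerbound)
    have "((\<lambda>e. (1 + e) ^ DIM('v) * measure lebesgue ?F) \<longlongrightarrow> (1 + 0) ^ DIM('v) * measure lebesgue ?F) (at_right 0)"
      by (intro tendsto_intros)
    then show "((\<lambda>e. (1 + e) ^ DIM('v) * measure lebesgue ?F) \<longlongrightarrow> measure lebesgue ?F) (at_right 0)" by simp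
    show "\<forall>\<^sub>F e in at_right 0. measure lebesgue ?P \<le> (1 + e) ^ DIM('v) * measure lebesgue ?F"
      using eventually_at_right_less[of 0] by (rule eventually_mono) (rule le)
  qed simp
qed

section \<open>Embedded lattices, sublattices and parallelepipeds\<close>

locale lattice_embedding =
  fixes \<iota> :: "'g::ab_group_add \<Rightarrow> 'v::euclidean_space" and B :: "'v set"
  assumes add: "\<iota> (x + y) = \<iota> x + \<iota> y" and inj: "inj \<iota>" and range: "range \<iota> = zmod.span B"
    and indep: "independent B" and spanB: "span B = UNIV"
begin

sublocale Modules.additive \<iota>
  by unfold_locales (rule add)

lemma finite_B: "finite B"
  using indep by (rule independent_imp_finite)

lemma card_B: "card B = DIM('v)"
  using real_vector.dim_eq_card_independent[OF indep] spanB dim_span[of B] by (simp add: dim_UNIV)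

lemma zscale_iota: "\<iota> (zscale k x) = of_int k *\<^sub>R \<iota> x"
  by (rule additive_zscale[OF add])

lemma iota_inv: "b \<in> B \<Longrightarrow> \<iota> (inv \<iota> b) = b"
  using range zmod.span_base[of b B] by (metis f_inv_into_f)

lemma eq_0_iff: "\<iota> x = 0 \<longleftrightarrow> x = 0"
  using inj zero by (metis injD)

lemma coordinates: "\<exists>u. x = (\<Sum>b\<in>B. zscale (u b) (inv \<iota> b))"
proof -
  have "\<iota> x \<in> zmod.span B" using range by blast
  then obtain u where u: "\<iota> x = (\<Sum>b\<in>B. of_int (u b) *\<^sub>R b)" unfolding zmod_span_finite_real[OF finite_B] by blast
  also have "\<dots> = \<iota> (\<Sum>b\<in>B. zscale (u b) (inv \<iota> b))"
    by (simp add: sum zscale_iota iota_inv)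
  finally show ?thesis using inj by (metis injD)
qed

lemma inj_inv: "inj_on (inv \<iota>) B"
  by (rule inj_onI) (metis iota_inv)

lemma span_inv: "zmod.span (inv \<iota> ` B) = UNIV"
proof -
  have "x \<in> zmod.span (inv \<iota> ` B)" for x
  proof -
    obtain u where "x = (\<Sum>b\<in>B. zscale (u b) (inv \<iota> b))" using coordinates by blast
    then show ?thesis by (auto intro: zmod.span_sum zmod.span_scale zmod.span_base)
  qed
  then show ?thesis by blast
qed

lemma fin_gen: "fin_gen TYPE('g)"
  unfolding fin_gen_def using span_inv finite_B by blast

text \<open>The preimages of \<open>B\<close> generate the group and are independent, which bounds
  the rank from both sides.\<close>

lemma zrank_eq: "zrank (UNIV :: 'g set) = DIM('v)"
proof (rule antisym)
  have "separating (\<lambda>x h. h x) (inv \<iota> ` B) real_homs" by (rule generators_separate[OF span_inv])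
  from separating_dim_le[OF subspace_real_homs _ this linear_eval] finite_B
  have "zrank (UNIV :: 'g set) \<le> card (inv \<iota> ` B)" by (simp add: dim_real_homs[OF fin_gen])
  then show "zrank (UNIV :: 'g set) \<le> DIM('v)" by (simp add: card_image[OF inj_inv] card_B)
  have "zmod.independent (inv \<iota> ` B)"
  proof (rule ccontr)
    assume "\<not> zmod.independent (inv \<iota> ` B)"
    then obtain u where u: "\<exists>v\<in>inv \<iota> ` B. u v \<noteq> 0" "(\<Sum>v\<in>inv \<iota> ` B. zscale (u v) v) = 0"
      using zmod.dependent_finite[of "inv \<iota> ` B"] finite_B by auto
    have "(\<Sum>b\<in>B. of_int (u (inv \<iota> b)) *\<^sub>R b) = \<iota> (\<Sum>b\<in>B. zscale (u (inv \<iota> b)) (inv \<iota> b))"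
      by (simp add: sum zscale_iota iota_inv)
    also have "\<dots> = 0" using u(2) by (simp add: sum.reindex[OF inj_inv] zero)
    finally have s: "(\<Sum>b\<in>B. of_int (u (inv \<iota> b)) *\<^sub>R b) = 0" .
    have "of_int (u (inv \<iota> b)) = (0::real)" if "b \<in> B" for b
      using independentD[OF indep finite_B subset_refl s that] .
    then show False using u(1) by auto
  qed
  then have "card (inv \<iota> ` B) \<le> zrank (UNIV :: 'g set)"
    using finite_B by (intro zrank_props(2)[OF fin_gen]) auto
  then show "DIM('v) \<le> zrank (UNIV :: 'g set)" by (simp add: card_image[OF inj_inv] card_B)
qed

lemma finite_index_iff_spanning: "finite_index UNIV (zmod.span T) \<longleftrightarrow> span (\<iota> ` T) = UNIV"
proof
  assume fi: "finite_index UNIV (zmod.span T)"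
  have mem: "\<iota> x \<in> span (\<iota> ` T)" if "x \<in> zmod.span T" for x
    using that
  proof (induction rule: zmod.span_induct_alt)
    case base
    then show ?case by (simp add: zero span_zero)
  next
    case (step c x y)
    then show ?case by (simp add: add zscale_iota span_add span_scale span_base)
  qed
  have "b \<in> span (\<iota> ` T)" if b: "b \<in> B" for b
  proof -
    obtain k where k: "k > 0" "zscale (int k) (inv \<iota> b) \<in> zmod.span T" using finite_index_multiple[OF fi] by blast
    have "(1 / real k) *\<^sub>R (real k *\<^sub>R b) \<in> span (\<iota> ` T)"
      by (rule span_scale) (use mem[OF k(2)] in \<open>simp add: zscale_iota iota_inv[OF b]\<close>)
    then show ?thesis using k(1) by simp
  qed
  then have "span B \<subseteq> span (\<iota> ` T)" by (intro span_minimal) auto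
  then show "span (\<iota> ` T) = UNIV" using spanB by blast
next
  assume sp: "span (\<iota> ` T) = UNIV"
  have "separating (\<lambda>x h. h x) T real_homs"
    unfolding separating_def
  proof (intro ballI impI ext)
    fix h :: "'g \<Rightarrow> real" and x assume h: "h \<in> real_homs" "\<forall>x\<in>T. h x = 0"
    \<comment> \<open>A real homomorphism extends to a linear functional prescribed on the basis
      \<open>B\<close>. It agrees with \<open>h\<close> on the lattice, and being zero on a spanning
      set it is zero.\<close>
    obtain H where H: "linear H" "\<And>b. b \<in> B \<Longrightarrow> H b = h (inv \<iota> b)"
      using linear_independent_extend[OF indep, of "\<lambda>b. h (inv \<iota> b)"] by blast
    have Hh: "H (\<iota> x) = h x" for x
    proof -
      obtain u where u: "x = (\<Sum>b\<in>B. zscale (u b) (inv \<iota> b))" using coordinates by blast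
      have "H (\<iota> x) = (\<Sum>b\<in>B. of_int (u b) * h (inv \<iota> b))"
        by (simp add: u sum zscale_iota iota_inv linear_sum[OF H(1)] linear_scale[OF H(1)] H(2))
      also have "\<dots> = h x" by (simp add: u real_hom_sum[OF h(1)] real_hom_zscale[OF h(1)])
      finally show ?thesis .
    qed
    have "H v = 0" if "v \<in> \<iota> ` T" for v using that h(2) Hh by auto
    then have "H v = 0" if "v \<in> span (\<iota> ` T)" for v using linear_eq_0_on_span[OF H(1)] that by blast
    then have "H (\<iota> x) = 0" using sp by blast
    then show "h x = 0 x" by (simp add: Hh fun_ops)
  qed
  then show "finite_index UNIV (zmod.span T)"
    using finite_index_iff_separating[OF fin_gen, of "\<lambda>x. x" T] by simp
qed

lemma zmod_span_image: "zmod.span (\<iota> ` T) = \<iota> ` zmod.span T"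
proof -
  have "zscale k v = of_int k *\<^sub>R v" for k and v :: 'v
    using additive_zscale[of "\<lambda>x. x" k v] by simp
  then have "module_hom zscale zscale \<iota>"
    by (intro module_hom.intro zmod.module_axioms module_hom_axioms.intro) (simp_all add: add zscale_iota)
  then show ?thesis by (rule module_hom.span_image)
qed

text \<open>One translate of the cell of \<open>B\<close> per coset makes up a fundamental domain of
  the sublattice; the parallelepiped of its own basis is another one.\<close>

lemma measure_sublattice:
  assumes C: "independent (\<iota> ` T)" "span (\<iota> ` T) = UNIV"
  shows "measure lebesgue (fundamental_region (\<iota> ` T)) =
    real (card (cosets UNIV (zmod.span T))) * measure lebesgue (fundamental_region B)"
proof -
  let ?K = "zmod.span T" and ?F = "fundamental_region B"
  let ?Q = "cosets UNIV ?K"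
  have K: "zmod.subspace ?K" by simp
  have fQ: "finite ?Q" using C(2) finite_index_iff_spanning[of T] by (simp add: finite_index_def)
  have fC: "finite (\<iota> ` T)" using C(1) by (rule independent_imp_finite)
  have F: "?F \<in> lmeasurable" by (rule measurable_fundamental_region[OF finite_B])
  have fdB: "fund_domain (range \<iota>) ?F" unfolding range by (rule fund_domain_fundamental_region[OF indep spanB])
  define rep where "rep Z = (SOME x. Z = (+) x ` ?K)" for Z
  have rep: "Z = (+) (rep Z) ` ?K" if "Z \<in> ?Q" for Z
  proof -
    have "\<exists>x. Z = (+) x ` ?K" using that by (auto simp: cosets_def)
    then show ?thesis unfolding rep_def by (rule someI_ex)
  qed
  have collide: "\<iota> (x - y) = 0" if "f \<in> ?F" "f' \<in> ?F" "\<iota> x + f = \<iota> y + f'" for x y f f'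
  proof -
    have "f + \<iota> (x - y) = f'" using that(3) by (simp add: diff algebra_simps)
    then show ?thesis using fdB that(1,2) unfolding fund_domain_def by blast
  qed
  define D where "D = (\<Union>Z\<in>?Q. (+) (\<iota> (rep Z)) ` ?F)"
  have fd: "fund_domain (zmod.span (\<iota> ` T)) D"
    unfolding fund_domain_def zmod_span_image
  proof (intro conjI allI ballI impI)
    fix v
    obtain x where x: "v - \<iota> x \<in> ?F" using fdB unfolding fund_domain_def by blast
    let ?Z = "(+) x ` ?K"
    have Z: "?Z \<in> ?Q" by (simp add: cosets_def)
    have k: "x - rep ?Z \<in> ?K" using rep[OF Z] coset_eq_iff[OF K] by blast
    have "v - \<iota> (x - rep ?Z) = \<iota> (rep ?Z) + (v - \<iota> x)" by (simp add: diff)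
    then have "v - \<iota> (x - rep ?Z) \<in> D" unfolding D_def using Z x by blast
    then show "\<exists>\<mu>\<in>\<iota> ` ?K. v - \<mu> \<in> D" using k by blast
  next
    fix \<mu> w assume m: "\<mu> \<in> \<iota> ` ?K" and w: "w \<in> D" "w + \<mu> \<in> D"
    obtain k where k: "k \<in> ?K" "\<mu> = \<iota> k" using m by blast
    obtain Z f where Z: "Z \<in> ?Q" "f \<in> ?F" "w = \<iota> (rep Z) + f" using w(1) unfolding D_def by blast
    obtain Z' f' where Z': "Z' \<in> ?Q" "f' \<in> ?F" "w + \<mu> = \<iota> (rep Z') + f'" using w(2) unfolding D_def by blast
    have "\<iota> (rep Z + k) + f = \<iota> (rep Z') + f'"
      unfolding Z'(3)[symmetric] by (simp add: add Z(3) k(2))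
    then have "rep Z + k - rep Z' = 0" using collide[OF Z(2) Z'(2)] eq_0_iff by blast
    then have kk: "k = rep Z' - rep Z" by (simp add: algebra_simps)
    then have "Z' = Z" using rep[OF Z(1)] rep[OF Z'(1)] coset_eq_iff[OF K, of "rep Z'" "rep Z"] k(1) by simp
    then show "\<mu> = 0" using kk k(2) by (simp add: zero)
  qed
  have meas: "(+) (\<iota> (rep Z)) ` ?F \<in> lmeasurable" for Z by (rule measurable_translation[OF F])
  have "disjoint_family_on (\<lambda>Z. (+) (\<iota> (rep Z)) ` ?F) ?Q"
    unfolding disjoint_family_on_def
  proof (intro ballI impI, rule ccontr)
    fix Z Z' assume Z: "Z \<in> ?Q" "Z' \<in> ?Q" "Z \<noteq> Z'" "(+) (\<iota> (rep Z)) ` ?F \<inter> (+) (\<iota> (rep Z')) ` ?F \<noteq> {}"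
    then obtain f f' where f: "f \<in> ?F" "f' \<in> ?F" "\<iota> (rep Z) + f = \<iota> (rep Z') + f'" by auto
    have "rep Z - rep Z' = 0" using collide[OF f] eq_0_iff by blast
    then show False using rep[OF Z(1)] rep[OF Z(2)] Z(3) by simp
  qed
  then have "measure lebesgue D = (\<Sum>Z\<in>?Q. measure lebesgue ((+) (\<iota> (rep Z)) ` ?F))"
    unfolding D_def using fQ fmeasurableD[OF meas] fmeasurableD2[OF meas]
    by (intro measure_finite_Union) (blast, blast, assumption, simp only: infinity_ennreal_def not_False_eq_True)
  then have D: "measure lebesgue D = real (card ?Q) * measure lebesgue ?F" by (simp add: measure_translation)
  have "D \<in> sets lebesgue" unfolding D_def using fQ meas by (intro sets.finite_UN) (auto intro: fmeasurableD)
  then have "emeasure lebesgue (fundamental_region (\<iota> ` T)) = emeasure lebesgue D"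
    using countable_zmod_span[OF fC] fd fmeasurableD[OF measurable_fundamental_region[OF fC]]
      fund_domain_fundamental_region[OF C]
    by (intro fund_domain_emeasure_eq[of "zmod.span (\<iota> ` T)"]) auto
  then show ?thesis using D by (simp add: measure_def)
qed

text \<open>In full rank the volume is the index in units of the cell of \<open>B\<close>, which is
  1. Otherwise everything lies in a proper subspace and has measure zero.\<close>

lemma measure_parallelepiped:
  assumes S: "finite S" "card S = DIM('v)" and vol: "measure lebesgue (fundamental_region B) = 1"
  shows "measure lebesgue (zono_sum {0} (\<lambda>k. \<iota> (x k)) (\<lambda>_. 1) S) =
    (if finite_index UNIV (zmod.span (x ` S)) then real (arith_mult (x ` S)) else 0)"
proof (cases "finite_index UNIV (zmod.span (x ` S))")
  case True
  let ?C = "\<iota> ` x ` S" and ?y = "\<lambda>k. \<iota> (x k)"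
  have sp: "span ?C = UNIV" using True finite_index_iff_spanning by blast
  have C: "?y ` S = ?C" by auto
  \<comment> \<open>Spanning requires \<open>DIM('v)\<close> different vectors, so no two positions
    in \<open>S\<close> carry the same entry and sums over positions become sums over
    vectors.\<close>
  have "dim (UNIV :: 'v set) \<le> card ?C"
    using S(1) sp by (intro real_vector.span_card_ge_dim) auto
  moreover have "card ?C \<le> card S" unfolding C[symmetric] by (rule card_image_le[OF S(1)])
  ultimately have card: "card ?C = DIM('v)" using S(2) by (simp add: dim_UNIV)
  have inj: "inj_on ?y S" using card S C by (intro eq_card_imp_inj_on) auto
  have ind: "independent ?C"
    by (rule card_le_dim_spanning[of _ UNIV]) (use S(1) sp card in \<open>auto simp: dim_UNIV\<close>)
  have "zono_sum {0} ?y (\<lambda>_. 1) S = zono_sum {0} (\<lambda>b. b) (\<lambda>_. 1) ?C"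
  proof (intro equalityI subsetI)
    fix v assume "v \<in> zono_sum {0} ?y (\<lambda>_. 1) S"
    then obtain r where r: "v = (\<Sum>k\<in>S. r k *\<^sub>R ?y k)" "\<forall>k\<in>S. 0 \<le> r k \<and> r k \<le> 1" by (auto elim: zono_sumE)
    define q where "q b = r (the_inv_into S ?y b)" for b
    have q: "q (?y k) = r k" if "k \<in> S" for k using that by (simp add: q_def the_inv_into_f_f[OF inj])
    have "v = (\<Sum>b\<in>?y ` S. q b *\<^sub>R b)" unfolding sum.reindex[OF inj] r(1) by (intro sum.cong) (simp_all add: q)
    moreover have "0 \<le> q b \<and> q b \<le> 1" if "b \<in> ?y ` S" for b using that r(2) q by auto
    ultimately show "v \<in> zono_sum {0} (\<lambda>b. b) (\<lambda>_. 1) ?C"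
      using zono_sumI[of 0 "{0}" "?y ` S" q "\<lambda>_. 1" "\<lambda>b. b"] unfolding C by simp
  next
    fix v assume "v \<in> zono_sum {0} (\<lambda>b. b) (\<lambda>_. 1) ?C"
    then obtain r where r: "v = (\<Sum>b\<in>?y ` S. r b *\<^sub>R b)" "\<forall>b\<in>?y ` S. 0 \<le> r b \<and> r b \<le> 1"
      unfolding C[symmetric] by (auto elim: zono_sumE)
    have "v = (\<Sum>k\<in>S. r (?y k) *\<^sub>R ?y k)" unfolding r(1) by (simp add: sum.reindex[OF inj])
    then show "v \<in> zono_sum {0} ?y (\<lambda>_. 1) S"
      using zono_sumI[of 0 "{0}" S "\<lambda>k. r (?y k)" "\<lambda>_. 1" ?y] r(2) by simp
  qed
  then have "measure lebesgue (zono_sum {0} ?y (\<lambda>_. 1) S) = measure lebesgue (fundamental_region ?C)"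
    using S(1) by (simp add: measure_closed_parallelepiped)
  also have "\<dots> = real (card (cosets UNIV (zmod.span (x ` S))))"
    using measure_sublattice[OF ind sp] vol by simp
  finally show ?thesis using True by (simp add: arith_mult_finite_index)
next
  case False
  let ?C = "\<iota> ` x ` S"
  have "span ?C \<noteq> UNIV" using False finite_index_iff_spanning by blast
  then have "dim ?C < DIM('v)" using dim_eq_full[of ?C] dim_subset_UNIV[of ?C] by linarith
  then have "negligible (span ?C)" by (intro negligible_lowdim) simp
  moreover have "zono_sum {0} (\<lambda>k. \<iota> (x k)) (\<lambda>_. 1) S \<subseteq> span ?C"
  proof
    fix v assume "v \<in> zono_sum {0} (\<lambda>k. \<iota> (x k)) (\<lambda>_. 1) S"
    then obtain r where r: "v = (\<Sum>k\<in>S. r k *\<^sub>R \<iota> (x k))" by (auto elim: zono_sumE)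
    show "v \<in> span ?C" unfolding r by (intro span_sum span_scale span_base) auto
  qed
  ultimately have "negligible (zono_sum {0} (\<lambda>k. \<iota> (x k)) (\<lambda>_. 1) S)" by (rule negligible_subset)
  then show ?thesis using False by (simp add: negligible_imp_measure0)
qed

text \<open>Both sides are the sum of \<open>arith_mult\<close> over the bases.\<close>

lemma measure_zonotope_dim_Pper:
  assumes X: "finite_index UNIV (zmod.span (set X))" and vol: "measure lebesgue (fundamental_region B) = 1"
  shows "real (dim (Pper X)) = measure lebesgue (zonotope (map \<iota> X))"
proof -
  let ?N = "length X"
  have "zonotope (map \<iota> X) = zono_sum {0} (\<lambda>k. \<iota> (X ! k)) (\<lambda>_. 1) {..<?N}"
  proof -
    have "(\<Sum>k<length (map \<iota> X). t k *\<^sub>R map \<iota> X ! k) = (\<Sum>k<?N. t k *\<^sub>R \<iota> (X ! k))" for t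
      by (intro sum.cong) auto
    then show ?thesis unfolding zonotope_def zono_sum_def by auto
  qed
  then have "measure lebesgue (zonotope (map \<iota> X)) =
      (\<Sum>S | S \<subseteq> {..<?N} \<and> card S = DIM('v). measure lebesgue (zono_sum {0} (\<lambda>k. \<iota> (X ! k)) (\<lambda>_. 1) S))"
    by (simp only: measure_zonotope[OF finite_lessThan])
  also have "\<dots> = (\<Sum>S | S \<subseteq> {..<?N} \<and> card S = DIM('v).
      if finite_index UNIV (zmod.span ((!) X ` S)) then real (arith_mult ((!) X ` S)) else 0)"
    by (intro sum.cong refl measure_parallelepiped vol) (auto intro: finite_subset)
  also have "\<dots> = (\<Sum>S\<in>{S\<in>{S. S \<subseteq> {..<?N} \<and> card S = DIM('v)}. finite_index UNIV (zmod.span ((!) X ` S))}.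
      real (arith_mult ((!) X ` S)))"
    by (rule sum.inter_filter[symmetric]) (rule finite_subset[of _ "Pow {..<?N}"], auto)
  also have "{S\<in>{S. S \<subseteq> {..<?N} \<and> card S = DIM('v)}. finite_index UNIV (zmod.span ((!) X ` S))}
      = {S. S \<subseteq> {..<?N} \<and> card S = zrank (UNIV :: 'g set) \<and> finite_index UNIV (zmod.span ((!) X ` S))}"
    by (auto simp: zrank_eq)
  finally show ?thesis by (simp add: dim_Pper[OF fin_gen X])
qed

end

text \<open>The lattice of rank zero, whose zonotope is a point: the empty sublist is the only basis
  and has multiplicity 1.\<close>

lemma dim_Pper_trivial_group:
  fixes X :: "'g::ab_group_add list"
  assumes "(UNIV :: 'g set) = {0}"
  shows "dim (Pper X) = 1"
proof -
  have eq: "x = 0" for x :: 'g using assms by blast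
  have G: "fin_gen TYPE('g)"
    unfolding fin_gen_def by (intro exI[of _ "{}"]) (simp add: assms)
  have K: "zmod.span S = UNIV" for S :: "'g set" 
  proof -
    have "x \<in> zmod.span S" for x unfolding eq[of x] by (rule zmod.span_zero)
    then show ?thesis by auto
  qed
  have co: "cosets UNIV (UNIV :: 'g set) = {{0}}" unfolding cosets_def assms by simp
  have fi: "finite_index UNIV (UNIV :: 'g set)" by (simp add: finite_index_def co)
  obtain C :: "'g set" where C: "zmod.independent C" "card C = zrank (UNIV :: 'g set)"
    using zrank_props(1)[OF G, of UNIV] by blast
  have "C = {}" using C(1) zmod.dependent_zero[of C] eq by (metis all_not_in_conv)
  then have r: "zrank (UNIV :: 'g set) = 0" using C(2) by simp
  have am: "arith_mult S = 1" for S :: "'g set"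
    using arith_mult_finite_index[of S] by (simp add: K fi co)
  have "{S. S \<subseteq> {..<length X} \<and> card S = 0} = {{}}" by (auto simp: finite_subset)
  then show ?thesis by (simp add: dim_Pper[OF G] K fi r am)
qed

text \<open>The space \<open>real ^ 'n\<close> has positive dimension, so the volume statement for
  the zero lattice takes the form of the last conjunct.\<close>

theorem theorem6p4:
  fixes X :: "'g::ab_group_add list" and N d :: nat
  assumes fin_gen: "\<exists>F :: 'g set. finite F \<and> zmod.span F = UNIV"
    and rank: "zrank (UNIV :: 'g set) = d"
    and len: "length X = N"
    and fin_index: "finite_index UNIV (zmod.span (set X))"
  shows "fps_to_fls (Hilb_Pper X) =
           fls_X_intpow (int N - int d) * arith_Tutte X 1 (fls_X_inv :: int fls)
       \<and> (\<forall>(\<iota> :: 'g \<Rightarrow> real ^ 'n) \<Lambda> B.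
            (\<forall>x y. \<iota> (x + y) = \<iota> x + \<iota> y) \<and> inj \<iota> \<and> range \<iota> = \<Lambda> \<and> lattice_basis B \<Lambda> \<and>
            measure lebesgue (fundamental_region B) = 1 \<longrightarrow>
              real (dim (Pper X)) = measure lebesgue (zonotope (map \<iota> X)))
       \<and> ((UNIV :: 'g set) = {0} \<longrightarrow> dim (Pper X) = 1)"
proof (intro conjI allI impI)
  have G: "fin_gen TYPE('g)" using fin_gen by (simp add: fin_gen_def)
  show "fps_to_fls (Hilb_Pper X) = fls_X_intpow (int N - int d) * arith_Tutte X 1 (fls_X_inv :: int fls)"
    using Hilb_Pper_arith_Tutte[OF G fin_index] rank len by simp
next
  fix \<iota> :: "'g \<Rightarrow> real ^ 'n" and \<Lambda> B
  assume a: "(\<forall>x y. \<iota> (x + y) = \<iota> x + \<iota> y) \<and> inj \<iota> \<and> range \<iota> = \<Lambda> \<and> lattice_basis B \<Lambda> \<and>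
    measure lebesgue (fundamental_region B) = 1"
  interpret lattice_embedding \<iota> B
    using a by unfold_locales (auto simp: lattice_basis_def)
  show "real (dim (Pper X)) = measure lebesgue (zonotope (map \<iota> X))"
    using measure_zonotope_dim_Pper[OF fin_index] a by blast
next
  assume "(UNIV :: 'g set) = {0}"
  then show "dim (Pper X) = 1" by (rule dim_Pper_trivial_group)
qed

end
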